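(* Let $h\in\mathcal H^{1}(\mu)$ and $f\in\mathfrak{rbmo}(\mu)$. Then the product $f\times h$ can be given a meaning in the sense of distributions, namely, for a decomposition $h=\sum_{j}b_{j}$ into atomic blocks $b_j$ supported in cubes $R_j$ with $\sum_j|b_j|_{\mathcal H^{1,\infty}_{atb}(\mu)}<\infty$, as the sum of the two series (converging in the sense of distributions) $$f\times h:=\sum_{j=1}^{\infty}\left(f-f_{\tilde R_j}\right)b_j+\sum_{j=1}^{\infty}f_{\tilde R_j}\,b_j.$$ Moreover, $$f\times h\in L^{1}(\mu)+\mathcal H^{\wp}_{*}(\mu),$$ where $\wp(t)=\dfrac{t}{\log(e+t)}$.
   Context: Setting. $0<n\le d$ are fixed integers and $\mu$ is a positive Radon measure on $\mathbb R^d$ (Euclidean norm $|\cdot|$) with $\mu(B(x,r))\le C_0r^n$ for all $x\in\mathbb R^d$, $r>0$; $\mu$ need not be doubling. A cube is a closed cube with sides parallel to the axes, centered at a point $x_Q$ of $\mathrm{supp}(\mu)$; if $\mu(\mathbb R^d)<\infty$, $Q=\mathbb R^d$ is also allowed. $\ell(Q)$ is the side length and $\alpha Q$ the concentric cube of side length $\alpha\ell(Q)$; $C_0$ is chosen so that also $\mu(Q)\le C_0\ell(Q)^n$ for all cubes. For cubes $Q\subset R$, $S_{Q,R}=1+\sum_{k=1}^{N_{Q,R}}\frac{\mu(2^kQ)}{\ell(2^kQ)^n}$, where $N_{Q,R}$ is the smallest positive integer $k$ with $\ell(2^kQ)\ge\ell(R)$ ($N_{Q,R}=\infty$ if $R=\mathbb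 R^d\ne Q$). Doubling cubes. Let $\alpha>1$ and $\beta>\alpha^n$. A cube $Q$ is $(\alpha,\beta)$-doubling if $\mu(\alpha Q)\le\beta\mu(Q)$. For $\rho>1$, $\beta_\rho$ is a fixed large constant $\beta$ (for definiteness, twice the infimum of such constants) for which there are arbitrarily large $(\rho,\beta)$-doubling cubes centered at every point of $\mathrm{supp}(\mu)$, and, for $\mu$-a.e. $x$, a sequence of $(\rho,\beta)$-doubling cubes centered at $x$ with side lengths tending to $0$. For a cube $Q$, $\tilde Q=2^NQ$ with $N$ the smallest non-negative integer such that $2^NQ$ is $(\rho,\beta_\rho)$-doubling. $f_Q$ denotes the $\mu$-mean of $f$ over $Q$. $\mathfrak{rbmo}(\mu)$. Fix $1<\eta\le\rho<\infty$. $f\in L^1_{loc}(\mu)$ is in $\mathfrak{rbmo}(\mu)$ if there is a constant $C_3$ such that: $\frac1{\mu(\eta Q)}\int_Q|f-f_{\tilde Q}|\,d\mu\le C_3$ for every cube $Q$ with $\ell(Q)\le1$; $|f_Q-f_R|\le C_3S_{Q,R}$ for any two $(\rho,\beta_\rho)$-doubling cubes $Q\subset R$ with $\ell(Q)\le1$; and $\frac1{\mu(\eta Q)}\int_Q|f|\,d\mu\le C_3$ for every cube $Q$ with $\ell(Q)>1$. The norm $\|f\|_{\mathfrak{rbmo}(\mu)}$ is the infimum of such $C_3$. The space does not depend on the choice of $\eta,\rho,\beta_\rho$. $\mathcal H^1(\mu)=\mathcal H^{1,\infty}_{atb}(\mu)$. An ($\infty$-)atomic block is $b\in L^1_{loc}(\mu)$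 such that (i) $\mathrm{supp}\,b\subset R$ for some cube $R$; (ii) $\int b\,d\mu=0$; (iii) $b=\sum_{i}\lambda_ia_i$ with $\lambda_i\in\mathbb R$ and $a_i$ supported in cubes $Q_i\subset R$ with $\|a_i\|_{L^\infty(\mu)}\le\mu(2Q_i)^{-1}S_{Q_i,R}^{-1}$; one puts $|b|_{\mathcal H^{1,\infty}_{atb}(\mu)}=\sum_i|\lambda_i|$. $h\in\mathcal H^1(\mu)$ iff $h=\sum_jb_j$ with atomic blocks $b_j$ such that $\sum_j|b_j|_{\mathcal H^{1,\infty}_{atb}(\mu)}<\infty$. Amalgam-type spaces. For a measurable set $E$, $\|g\|_{L^\wp(E)}=\inf\{k>0:\int_E\wp(|g|/k)\,d\mu\le1\}$. With $\mathbb Q$ the unit cube centered at $0$, $L^\wp_*(\mu)$ is the space of functions $g$ with $\|g\|_{L^\wp_*}=\sum_{j\in\mathbb Z^d}\|g\|_{L^\wp(j+\mathbb Q)}<\infty$. For $x\in\mathbb R^d$, $F(x)$ is the set of $\varphi\in L^1(\mu)\cap C^1(\mathbb R^d)$ with $\|\varphi\|_{L^1(\mu)}\le1$, $0\le\varphi(y)\le|y-x|^{-n}$ and $|\nabla\varphi(y)|\le|y-x|^{-n-1}$ for all $y\in\mathbb R^d$. For $g\in L^1_{loc}(\mu)$, the maximal function is $\mathcal Mg(x)=\sup_{\varphi\in F(x)}\left|\int g\varphi\,d\mu\right|$. $\mathcal H^\wp_*(\mu)$ is the space of locally integrable functions $g$ such that $\mathcal Mg\in L^\wp_*(\mu)$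.
   Formalization: The maximal function and H^℘_* are taken on distributions (sup over smooth compactly supported φ in F(x)); with locally integrable functions only, the claim fails for f=max(0,log 1/|t|), h=sgn t/(|t|log²|t|) on |t|<1/4, Lebesgue measure on the line. Existence of every Q̃ is assumed. *)

theory Defs
  imports "HOL-Analysis.Analysis"
begin

section \<open>Cubes\<close>

text \<open>
  A closed axis-parallel cube is given by its centre and its side length; \<open>Whole\<close> is the
  whole space (side length \<open>\<infinity>\<close>), which counts as a cube only if the measure is finite.
\<close>

datatype 'p cube = Cube 'p real | Whole

fun cube_set :: "(real^'d) cube \<Rightarrow> (real^'d) set" where
  "cube_set (Cube x l) = {y. \<forall>i. \<bar>y $ i - x $ i\<bar> \<le> l / 2}"
| "cube_set Whole = UNIV"

fun side :: "(real^'d) cube \<Rightarrow> ereal" where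
  "side (Cube x l) = ereal l"
| "side Whole = \<infinity>"

fun dilate :: "real \<Rightarrow> (real^'d) cube \<Rightarrow> (real^'d) cube" where
  "dilate \<alpha> (Cube x l) = Cube x (\<alpha> * l)"
| "dilate \<alpha> Whole = Whole"

definition msupp :: "(real^'d) measure \<Rightarrow> (real^'d) set" where
  "msupp M = {x. \<forall>r>0. emeasure M (ball x r) > 0}"

fun is_cube :: "(real^'d) measure \<Rightarrow> (real^'d) cube \<Rightarrow> bool" where
  "is_cube M (Cube x l) \<longleftrightarrow> x \<in> msupp M \<and> l > 0"
| "is_cube M Whole \<longleftrightarrow> emeasure M UNIV < \<infinity>"

text \<open>
  A locally finite Borel measure on Euclidean space is automatically Radon; local finiteness
  follows from the growth bound.
\<close>

definition growth_measure :: "(real^'d) measure \<Rightarrow> nat \<Rightarrow> real \<Rightarrow> bool" where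
  "growth_measure M n C0 \<longleftrightarrow>
     sets M = sets borel \<and>
     (\<forall>x. \<forall>r>0. emeasure M (ball x r) \<le> ennreal (C0 * r ^ n)) \<and>
     (\<forall>x l. is_cube M (Cube x l) \<longrightarrow> emeasure M (cube_set (Cube x l)) \<le> ennreal (C0 * l ^ n))"

fun cube_density :: "(real^'d) measure \<Rightarrow> nat \<Rightarrow> (real^'d) cube \<Rightarrow> real" where
  "cube_density M n (Cube x l) = measure M (cube_set (Cube x l)) / l ^ n"
| "cube_density M n Whole = 0"

definition N_coeff :: "(real^'d) cube \<Rightarrow> (real^'d) cube \<Rightarrow> enat" where
  "N_coeff Q R =
     (if \<exists>k\<ge>1. side (dilate (2 ^ k) Q) \<ge> side R
      then enat (LEAST k. k \<ge> 1 \<and> side (dilate (2 ^ k) Q) \<ge> side R)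
      else \<infinity>)"

definition S_coeff :: "(real^'d) measure \<Rightarrow> nat \<Rightarrow> (real^'d) cube \<Rightarrow> (real^'d) cube \<Rightarrow> real" where
  "S_coeff M n Q R =
     1 + (\<Sum>\<^sub>\<infinity>k\<in>{k. 1 \<le> k \<and> enat k \<le> N_coeff Q R}. cube_density M n (dilate (2 ^ k) Q))"


section \<open>Doubling cubes\<close>

definition doubling :: "(real^'d) measure \<Rightarrow> real \<Rightarrow> real \<Rightarrow> (real^'d) cube \<Rightarrow> bool" where
  "doubling M \<alpha> \<beta> Q \<longleftrightarrow> measure M (cube_set (dilate \<alpha> Q)) \<le> \<beta> * measure M (cube_set Q)"

text \<open>
  The constants \<open>\<beta>\<close> that may serve as \<open>\<beta>\<^sub>\<rho>\<close>.  The set of such \<open>\<beta>\<close> is upward closed, so twice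
  its infimum is one of them.  The last clause says that the first doubling cube among
  \<open>Q, 2Q, 4Q, \<dots>\<close> exists; it is automatic for large \<open>\<beta>\<close> (for instance \<open>\<beta> > 2^(m n)\<close> with
  \<open>\<rho> \<le> 2^m\<close>), but for \<open>\<rho>\<close> not a power of two it is not implied by the other clauses.
\<close>

definition doubling_constant :: "(real^'d) measure \<Rightarrow> nat \<Rightarrow> real \<Rightarrow> real \<Rightarrow> bool" where
  "doubling_constant M n \<rho> \<beta> \<longleftrightarrow>
     \<beta> > \<rho> ^ n \<and>
     (\<forall>x\<in>msupp M. \<forall>c>0. \<exists>l\<ge>c. doubling M \<rho> \<beta> (Cube x l)) \<and>
     (AE x in M. \<exists>l :: nat \<Rightarrow> real. (\<forall>k. l k > 0 \<and> doubling M \<rho> \<beta> (Cube x (l k))) \<and>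
        l \<longlonglongrightarrow> 0) \<and>
     (\<forall>Q. is_cube M Q \<longrightarrow> (\<exists>N::nat. doubling M \<rho> \<beta> (dilate (2 ^ N) Q)))"

definition tilde :: "(real^'d) measure \<Rightarrow> real \<Rightarrow> real \<Rightarrow> (real^'d) cube \<Rightarrow> (real^'d) cube" where
  "tilde M \<rho> \<beta> Q = dilate (2 ^ (LEAST N::nat. doubling M \<rho> \<beta> (dilate (2 ^ N) Q))) Q"


section \<open>The space rbmo\<close>

definition L1loc :: "(real^'d) measure \<Rightarrow> (real^'d \<Rightarrow> real) set" where
  "L1loc M = {f \<in> borel_measurable M. \<forall>K. compact K \<longrightarrow> set_integrable M K f}"

definition avg :: "(real^'d) measure \<Rightarrow> (real^'d \<Rightarrow> real) \<Rightarrow> (real^'d) cube \<Rightarrow> real" where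
  "avg M f Q = (LINT y:cube_set Q|M. f y) / measure M (cube_set Q)"

text \<open>
  The integrals of absolute values are taken in \<open>[0,\<infinity>]\<close>, so that the third condition for
  \<open>Q = Whole\<close> forces \<open>f\<close> to be integrable when the measure is finite.
\<close>

definition rbmo ::
    "(real^'d) measure \<Rightarrow> nat \<Rightarrow> real \<Rightarrow> real \<Rightarrow> real \<Rightarrow> (real^'d \<Rightarrow> real) set" where
  "rbmo M n \<eta> \<rho> \<beta> = {f \<in> L1loc M. \<exists>C3\<ge>0.
     (\<forall>Q. is_cube M Q \<and> side Q \<le> 1 \<longrightarrow>
        (\<integral>\<^sup>+y\<in>cube_set Q. ennreal \<bar>f y - avg M f (tilde M \<rho> \<beta> Q)\<bar> \<partial>M)
          / emeasure M (cube_set (dilate \<eta> Q)) \<le> ennreal C3) \<and>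
     (\<forall>Q R. is_cube M Q \<and> is_cube M R \<and> cube_set Q \<subseteq> cube_set R \<and>
        doubling M \<rho> \<beta> Q \<and> doubling M \<rho> \<beta> R \<and> side Q \<le> 1 \<longrightarrow>
        \<bar>avg M f Q - avg M f R\<bar> \<le> C3 * S_coeff M n Q R) \<and>
     (\<forall>Q. is_cube M Q \<and> side Q > 1 \<longrightarrow>
        (\<integral>\<^sup>+y\<in>cube_set Q. ennreal \<bar>f y\<bar> \<partial>M)
          / emeasure M (cube_set (dilate \<eta> Q)) \<le> ennreal C3)}"


section \<open>The atomic Hardy space\<close>

text \<open>
  \<open>atomic_block M n R b \<lambda>\<close>: the function \<open>b\<close> is an atomic block supported in \<open>R\<close> with
  coefficient sequence \<open>\<lambda>\<close> (finite sums are padded with \<open>\<lambda> i = 0\<close>).  The size of a block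
  is that of its given coefficient sequence.
\<close>

definition atomic_block ::
    "(real^'d) measure \<Rightarrow> nat \<Rightarrow> (real^'d) cube \<Rightarrow> (real^'d \<Rightarrow> real) \<Rightarrow> (nat \<Rightarrow> real) \<Rightarrow> bool" where
  "atomic_block M n R b lam \<longleftrightarrow>
     is_cube M R \<and> b \<in> L1loc M \<and>
     (AE y in M. y \<notin> cube_set R \<longrightarrow> b y = 0) \<and>
     has_bochner_integral M b 0 \<and>
     (\<exists>(a :: nat \<Rightarrow> real^'d \<Rightarrow> real) Q.
        (\<forall>i. is_cube M (Q i) \<and> cube_set (Q i) \<subseteq> cube_set R \<and>
           a i \<in> borel_measurable M \<and>
           (AE y in M. y \<notin> cube_set (Q i) \<longrightarrow> a i y = 0) \<and>
           (AE y in M. \<bar>a i y\<bar> \<le>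
              inverse (measure M (cube_set (dilate 2 (Q i)))) * inverse (S_coeff M n (Q i) R))) \<and>
        (AE y in M. (\<lambda>i. lam i * a i y) sums b y))"

definition block_size :: "(nat \<Rightarrow> real) \<Rightarrow> ennreal" where
  "block_size lam = (\<Sum>i. ennreal \<bar>lam i\<bar>)"

text \<open>
  Under the finiteness condition on the sizes the series of the blocks converges absolutely
  both almost everywhere and in \<open>L\<^sup>1\<close>, to the same sum.
\<close>

definition atomic_decomposition ::
    "(real^'d) measure \<Rightarrow> nat \<Rightarrow> (real^'d \<Rightarrow> real) \<Rightarrow> (nat \<Rightarrow> (real^'d) cube) \<Rightarrow>
     (nat \<Rightarrow> real^'d \<Rightarrow> real) \<Rightarrow> (nat \<Rightarrow> nat \<Rightarrow> real) \<Rightarrow> bool" where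
  "atomic_decomposition M n h R b lam \<longleftrightarrow>
     (\<forall>j. atomic_block M n (R j) (b j) (lam j)) \<and>
     (\<Sum>j. block_size (lam j)) < \<infinity> \<and>
     (AE y in M. (\<lambda>j. b j y) sums h y)"

definition H1 :: "(real^'d) measure \<Rightarrow> nat \<Rightarrow> (real^'d \<Rightarrow> real) set" where
  "H1 M n = {h \<in> borel_measurable M. \<exists>R b lam. atomic_decomposition M n h R b lam}"


section \<open>Test functions and distributions\<close>

definition partial :: "'d \<Rightarrow> (real^'d \<Rightarrow> real) \<Rightarrow> real^'d \<Rightarrow> real" where
  "partial i \<phi> y = frechet_derivative \<phi> (at y) (axis i 1)"

definition grad :: "(real^'d \<Rightarrow> real) \<Rightarrow> real^'d \<Rightarrow> real^'d" where
  "grad \<phi> y = (\<chi> i. partial i \<phi> y)"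

definition C1 :: "(real^'d \<Rightarrow> real) set" where
  "C1 = {\<phi>. (\<forall>y. \<phi> differentiable (at y)) \<and> continuous_on UNIV (grad \<phi>)}"

definition partials :: "'d list \<Rightarrow> (real^'d \<Rightarrow> real) \<Rightarrow> real^'d \<Rightarrow> real" where
  "partials is \<phi> = foldr partial is \<phi>"

definition test_fun :: "(real^'d \<Rightarrow> real) set" where
  "test_fun = {\<psi>. (\<forall>is y. partials is \<psi> differentiable (at y)) \<and> compact (closure {y. \<psi> y \<noteq> 0})}"

text \<open>
  Distributions are functionals on test functions; their values elsewhere are irrelevant.
\<close>

definition distribution :: "((real^'d \<Rightarrow> real) \<Rightarrow> real) \<Rightarrow> bool" where
  "distribution T \<longleftrightarrow>
     (\<forall>\<phi>\<in>test_fun. \<forall>\<psi>\<in>test_fun. T (\<lambda>y. \<phi> y + \<psi> y) = T \<phi> + T \<psi>) \<and>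
     (\<forall>c. \<forall>\<psi>\<in>test_fun. T (\<lambda>y. c * \<psi> y) = c * T \<psi>) \<and>
     (\<forall>\<psi> K. (\<forall>k. \<psi> k \<in> test_fun \<and> {y. \<psi> k y \<noteq> 0} \<subseteq> K) \<and> compact K \<and>
        (\<forall>is. uniform_limit UNIV (\<lambda>k. partials is (\<psi> k)) (\<lambda>_. 0) sequentially) \<longrightarrow>
        (\<lambda>k::nat. T (\<psi> k)) \<longlonglongrightarrow> 0)"

definition dist_of :: "(real^'d) measure \<Rightarrow> (real^'d \<Rightarrow> real) \<Rightarrow> (real^'d \<Rightarrow> real) \<Rightarrow> real" where
  "dist_of M g \<psi> = (\<integral>y. g y * \<psi> y \<partial>M)"

definition dist_sums ::
    "(real^'d) measure \<Rightarrow> (nat \<Rightarrow> real^'d \<Rightarrow> real) \<Rightarrow> ((real^'d \<Rightarrow> real) \<Rightarrow> real) \<Rightarrow> bool" where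
  "dist_sums M u T \<longleftrightarrow>
     (\<forall>j. u j \<in> L1loc M) \<and> distribution T \<and>
     (\<forall>\<psi>\<in>test_fun. (\<lambda>j. dist_of M (u j) \<psi>) sums T \<psi>)"


section \<open>Amalgam Orlicz and Hardy--Orlicz spaces\<close>

definition wp :: "real \<Rightarrow> real" where
  "wp t = t / ln (exp 1 + t)"

definition wp_ext :: "ennreal \<Rightarrow> ennreal" where
  "wp_ext t = (if t = \<infinity> then \<infinity> else ennreal (wp (enn2real t)))"

definition wp_norm :: "(real^'d) measure \<Rightarrow> (real^'d) set \<Rightarrow> (real^'d \<Rightarrow> ennreal) \<Rightarrow> ennreal" where
  "wp_norm M E g =
     Inf {ennreal k | k. k > 0 \<and> (\<integral>\<^sup>+y\<in>E. wp_ext (g y / ennreal k) \<partial>M) \<le> 1}"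

text \<open>
  The space is only needed for nonnegative functions with values in \<open>[0,\<infinity>]\<close> (maximal functions).
\<close>

definition wp_star_norm :: "(real^'d) measure \<Rightarrow> (real^'d \<Rightarrow> ennreal) \<Rightarrow> ennreal" where
  "wp_star_norm M g = (\<Sum>\<^sub>\<infinity>j\<in>{j. \<forall>i. j $ i \<in> \<int>}. wp_norm M (cube_set (Cube j 1)) g)"

definition L_wp_star :: "(real^'d) measure \<Rightarrow> (real^'d \<Rightarrow> ennreal) set" where
  "L_wp_star M = {g \<in> borel_measurable M. wp_star_norm M g < \<infinity>}"

text \<open>
  The pointwise bounds are void at \<open>y = x\<close>, where \<open>|y - x|\<close> to a negative power is \<open>\<infinity>\<close>.
\<close>

definition F_class :: "(real^'d) measure \<Rightarrow> nat \<Rightarrow> real^'d \<Rightarrow> (real^'d \<Rightarrow> real) set" where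
  "F_class M n x = {\<phi> \<in> C1. integrable M \<phi> \<and> (\<integral>y. \<bar>\<phi> y\<bar> \<partial>M) \<le> 1 \<and> (\<forall>y. 0 \<le> \<phi> y) \<and>
     (\<forall>y. y \<noteq> x \<longrightarrow> \<phi> y \<le> 1 / norm (y - x) ^ n \<and> norm (grad \<phi> y) \<le> 1 / norm (y - x) ^ (n + 1))}"

text \<open>
  The maximal function is defined on distributions, a locally integrable function \<open>g\<close> being
  identified with \<open>dist_of M g\<close>; accordingly the supremum runs over those members of the class
  \<open>F_class M n x\<close> on which a distribution acts.  For integrable \<open>g\<close> this is the supremum over
  all of \<open>F_class M n x\<close>, by truncation and mollification.  Restricting \<open>H_wp_star\<close> to
  distributions given by locally integrable functions would exclude products \<open>f \<times> h\<close>: on the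
  real line with Lebesgue measure, \<open>f(t) = max 0 (ln (1/|t|))\<close> and the odd function
  \<open>h(t) = sgn t / (|t| (ln |t|)\<^sup>2)\<close> for \<open>|t| < 1/4\<close> (zero elsewhere) have as product the
  principal value of \<open>f h\<close>, and \<open>f h\<close> is not integrable near \<open>0\<close>.
\<close>

definition maximal ::
    "(real^'d) measure \<Rightarrow> nat \<Rightarrow> ((real^'d \<Rightarrow> real) \<Rightarrow> real) \<Rightarrow> real^'d \<Rightarrow> ennreal" where
  "maximal M n T x = (SUP \<phi>\<in>F_class M n x \<inter> test_fun. ennreal \<bar>T \<phi>\<bar>)"

definition H_wp_star :: "(real^'d) measure \<Rightarrow> nat \<Rightarrow> ((real^'d \<Rightarrow> real) \<Rightarrow> real) set" where
  "H_wp_star M n = {T. distribution T \<and> maximal M n T \<in> L_wp_star M}"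

definition L1_plus_H_wp_star ::
    "(real^'d) measure \<Rightarrow> nat \<Rightarrow> ((real^'d \<Rightarrow> real) \<Rightarrow> real) set" where
  "L1_plus_H_wp_star M n = {T. \<exists>g T'. integrable M g \<and> T' \<in> H_wp_star M n \<and>
     (\<forall>\<psi>\<in>test_fun. T \<psi> = dist_of M g \<psi> + T' \<psi>)}"

end

theory Submission
  imports Defs
begin

text \<open>
  All that is used of \<open>f\<close> is that the numbers \<open>c(Q) = f\<^bsub>Q~\<^esub>\<close> satisfy
  \<open>\<integral>\<^bsub>Q\<^esub> |f - c(Q)| \<le> C \<mu>(\<eta> Q)\<close> and \<open>|c(Q) - c(R)| \<le> C S(Q,R)\<close> for all cubes \<open>Q \<subseteq> R\<close>, and
  \<open>|c(Q)| \<le> C\<close> for large \<open>Q\<close>.  The first series then converges in \<open>L\<^sup>1\<close>, block by block.  For the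
  second one, let \<open>\<Phi>(x)\<close> be the supremum of \<open>|c(Q)|\<close> over the cubes \<open>Q\<close> containing \<open>x\<close>.  Off a
  fixed dilate of \<open>R\<close> the gradient bound gains a geometric factor which absorbs the growth of
  \<open>|c(R)| - |c(2\<^sup>k R)|\<close>, so the maximal function of \<open>\<Sum> c(R\<^sub>j) b\<^sub>j\<close> is at most \<open>C (1 + \<Phi>) G\<close> with an
  integrable \<open>G\<close>.  (Passing through \<open>|f - c(R)|\<close> instead would cost a second factor \<open>S(Q,R)\<close>.)
  A John--Nirenberg argument makes \<open>\<Phi>\<close> exponentially integrable, uniformly over unit cubes, and
  \<open>\<wp>(s t) \<le> s + e\<^sup>t\<close> puts the product into \<open>L\<^sup>\<wp>\<^sub>*\<close>.
\<close>


section \<open>Cubes and densities\<close>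

text \<open>The obstacle is the absence of doubling: \<mu>(2Q) is not controlled by \<mu>(Q), and
  averages over neighbouring cubes need not be comparable. Comparisons therefore go through cubes
  around the same centre whose side nearly maximizes a weighted density. Such a cube has all fixed
  dilates of comparable measure and is reached at a bounded density sum. These cubes are needed
  already for the properties of c(Q): if \<rho> < 2, a dilate that is not doubling only forces
  growth by \<beta>, which may be less than 2^n, so the densities between Q and its first doubling
  dilate need not decay geometrically and their sum is not directly bounded. The bound on c(Q) for
  large Q limits |c(Q)| to logarithmic growth in 1/l(Q). Against a test function a block gains the
  factor l(R) from its vanishing integral, and l log(1/l) is bounded for small l. This is why the
  second series converges as a distribution although the norms of its terms need not be summable.
  The same logarithmic growth drives the iteration in the John-Nirenberg argument: high means occur
  only on cubes of geometrically small side.\<close>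

definition qc :: "real^'d \<Rightarrow> real \<Rightarrow> (real^'d) set" where
  "qc x l = {y. \<forall>i. \<bar>y $ i - x $ i\<bar> \<le> l / 2}"

lemma cube_set_Cube [simp]: "cube_set (Cube x l) = qc x l"
  by (simp add: qc_def)

declare cube_set.simps(1) [simp del]

lemma qc_sym: "y \<in> qc x l \<longleftrightarrow> x \<in> qc y l"
  by (simp add: qc_def abs_minus_commute)

lemma center_in_qc [simp]: "0 \<le> l \<Longrightarrow> x \<in> qc x l"
  by (simp add: qc_def)

lemma qc_mono: "l \<le> l' \<Longrightarrow> qc x l \<subseteq> qc x l'"
  unfolding qc_def by (intro Collect_mono impI allI) (meson divide_right_mono order_trans zero_le_numeral)

lemma qc_subset_add:
  assumes "z \<in> qc x a" "a + b \<le> c" shows "qc z b \<subseteq> qc x c"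
proof
  fix y assume y: "y \<in> qc z b"
  show "y \<in> qc x c" unfolding qc_def
  proof (clarify)
    fix i
    have "\<bar>y $ i - z $ i\<bar> \<le> b/2" "\<bar>z $ i - x $ i\<bar> \<le> a/2" using y assms by (auto simp: qc_def)
    then show "\<bar>y $ i - x $ i\<bar> \<le> c/2" using assms by linarith
  qed
qed

lemma qc_subset_imp_le:
  fixes x y :: "real^'d"
  assumes "qc x l \<subseteq> qc y r" "l > 0" shows "l \<le> r"
proof -
  have "x + (\<chi> i. l/2) \<in> qc x l" "x - (\<chi> i. l/2) \<in> qc x l" using assms(2) by (auto simp: qc_def)
  then have "x + (\<chi> i. l/2) \<in> qc y r" "x - (\<chi> i. l/2) \<in> qc y r" using assms(1) by auto
  then have "\<bar>x $ i + l/2 - y $ i\<bar> \<le> r/2" "\<bar>x $ i - l/2 - y $ i\<bar> \<le> r/2" for i by (auto simp: qc_def)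
  from this[of undefined] show ?thesis by linarith
qed

lemma norm_le_qc:
  fixes x y :: "real^'d"
  assumes "y \<in> qc x l" shows "norm (y - x) \<le> real CARD('d) * l / 2"
proof -
  have "norm (y - x) \<le> (\<Sum>i\<in>UNIV. \<bar>(y - x) $ i\<bar>)" by (rule norm_le_l1_cart)
  also have "\<dots> \<le> (\<Sum>i\<in>(UNIV::'d set). l/2)" using assms by (intro sum_mono) (auto simp: qc_def)
  finally show ?thesis by simp
qed

lemma cball_subset_qc: "cball x r \<subseteq> qc x (2 * r)"
proof
  fix y assume "y \<in> cball x r"
  then have "norm (y - x) \<le> r" by (simp add: dist_norm norm_minus_commute)
  then show "y \<in> qc x (2 * r)"
    unfolding qc_def using component_le_norm_cart[of "y - x"] by (auto intro: order_trans)
qed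

lemma qc_subset_cball: "qc (x::real^'d) l \<subseteq> cball x (real CARD('d) * l / 2)"
  using norm_le_qc[of _ x l] by (auto simp: dist_norm norm_minus_commute)

lemma dist_outside_qc:
  assumes "w \<in> qc z a" "x \<notin> qc z b" shows "(b - a) / 2 \<le> norm (w - x)"
proof -
  obtain i where i: "\<bar>x $ i - z $ i\<bar> > b/2" using assms(2) by (auto simp: qc_def not_le)
  have "\<bar>w $ i - z $ i\<bar> \<le> a/2" using assms(1) by (auto simp: qc_def)
  then have "(b - a)/2 \<le> \<bar>(w - x) $ i\<bar>" using i unfolding vector_minus_component by (simp add: abs_if split: if_splits)
  then show ?thesis using component_le_norm_cart[of "w - x" i] by linarith
qed

lemma closed_qc [measurable, simp]: "closed (qc x l)"
proof -
  have "qc x l = (\<Inter>i. {y. \<bar>y $ i - x $ i\<bar> \<le> l/2})" by (auto simp: qc_def)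
  moreover have "closed {y. \<bar>y $ i - x $ i\<bar> \<le> l/2}" for i
    by (intro closed_Collect_le continuous_intros)
  ultimately show ?thesis by auto
qed

lemma compact_qc [simp]: "compact (qc (x::real^'d) l)"
  using qc_subset_cball[of x l] bounded_subset[OF bounded_cball] by (simp add: compact_eq_bounded_closed)

lemma convex_qc: "convex (qc x l)"
proof -
  have "\<bar>s - t\<bar> \<le> l/2 \<longleftrightarrow> s \<le> t + l/2 \<and> s \<ge> t - l/2" for s t :: real by linarith
  then have "qc x l = {y. \<forall>i. y $ i \<in> {x $ i - l/2..x $ i + l/2}}"
    unfolding qc_def atLeastAtMost_iff by blast
  then show ?thesis using convex_box_cart[of "\<lambda>i t. t \<in> {x $ i - l/2..x $ i + l/2}"]
    by (simp only: Collect_mem_eq convex_real_interval simp_thms)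
qed

lemma msupp_closed: "closed (msupp M)" if "sets M = sets borel"
proof -
  have "open (- msupp M)"
  proof (subst open_contains_ball, clarify)
    fix x assume "x \<notin> msupp M"
    then obtain r where r: "r > 0" "emeasure M (ball x r) = 0" by (auto simp: msupp_def zero_less_iff_neq_zero)
    have "ball x r \<subseteq> - msupp M"
    proof
      fix y assume y: "y \<in> ball x r"
      have "emeasure M (ball y (r - dist x y)) \<le> emeasure M (ball x r)"
      proof (rule emeasure_mono)
        show "ball y (r - dist x y) \<subseteq> ball x r"
          by (rule ball_subset_ball_iff[THEN iffD2]) (simp add: dist_commute)
      qed (simp add: that)
      then have "emeasure M (ball y (r - dist x y)) = 0" using r by simp
      moreover have "r - dist x y > 0" using y by simp
      ultimately show "y \<in> - msupp M" unfolding msupp_def by (metis (no_types, lifting) ComplI less_irrefl mem_Collect_eq)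
    qed
    then show "\<exists>e>0. ball x e \<subseteq> - msupp M" using r by blast
  qed
  then show ?thesis by (simp add: closed_def)
qed

text \<open>The complement of the support is a union of open balls of measure zero, and by Lindelof
  countably many of them suffice. The cubes of the theory have centres in the support, so the
  estimates of the maximal function are made at such points and then hold almost everywhere.\<close>

lemma AE_msupp:
  fixes M :: "(real^'d) measure"
  assumes "sets M = sets borel" shows "AE x in M. x \<in> msupp M"
proof -
  have sp: "space M = UNIV" using sets_eq_imp_space_eq[OF assms] by simp
  let ?F = "{ball x r |x r. r > 0 \<and> emeasure M (ball x r) = 0}"
  have "open S" if "S \<in> ?F" for S using that by auto
  then obtain F' where F': "F' \<subseteq> ?F" "countable F'" "\<Union>F' = \<Union>?F" by (rule Lindelof)
  have "(\<Union>S\<in>F'. S) \<in> null_sets M"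
    using F'(1) assms by (intro null_sets_UN' F') (auto simp: null_sets_def)
  moreover have "- msupp M \<subseteq> \<Union>?F"
  proof
    fix x assume "x \<in> - msupp M"
    then obtain r where "r > 0" "emeasure M (ball x r) = 0" by (auto simp: msupp_def zero_less_iff_neq_zero)
    then show "x \<in> \<Union>?F" using centre_in_ball by blast
  qed
  ultimately show ?thesis using F'(3) sp by (intro AE_I[where N="\<Union>F'"]) (auto simp: null_sets_def)
qed

text \<open>The least integer m with l \<le> 2^m. It places a side on the dyadic grid of scales
  along which \<open>dens_sum\<close> samples the densities.\<close>

definition sc :: "real \<Rightarrow> int" where "sc l = \<lceil>log 2 l\<rceil>"

lemma sc_bounds:
  assumes "l > 0" shows "l \<le> 2 powr sc l" "2 powr sc l < 2 * l"
proof -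
  have "log 2 l \<le> sc l" "sc l < log 2 l + 1" unfolding sc_def by linarith+
  then have "2 powr log 2 l \<le> 2 powr sc l" "2 powr sc l < 2 powr (log 2 l + 1)"
    by (simp_all only: powr_le_cancel_iff powr_less_cancel_iff one_less_numeral_iff semiring_norm)
  moreover have "2 powr log 2 l = l" "2 powr (log 2 l + 1) = 2 * l" using assms by (simp_all add: powr_add)
  ultimately show "l \<le> 2 powr sc l" "2 powr sc l < 2 * l" by (simp_all only:)
qed

lemma sc_mono: "0 < l \<Longrightarrow> l \<le> l' \<Longrightarrow> sc l \<le> sc l'"
  unfolding sc_def by (intro ceiling_mono) simp

lemma sc_mult_power: "0 < l \<Longrightarrow> sc (2 ^ k * l) = sc l + int k"
proof -
  assume "0 < l"
  then have "log 2 (2 ^ k * l) = log 2 l + of_int (int k)" by (simp add: log_mult log_nat_power)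
  then show ?thesis unfolding sc_def by (simp only: ceiling_add_of_int)
qed

lemma sc_double: "0 < l \<Longrightarrow> sc (2 * l) = sc l + 1"
  using sc_mult_power[of l 1] unfolding power_one_right of_nat_1 .

lemma powr_int_add1: "2 powr (of_int (m + 1)) = 2 * 2 powr (of_int m :: real)"
  by (simp add: powr_add)

definition qc_density :: "(real^'d) measure \<Rightarrow> nat \<Rightarrow> real^'d \<Rightarrow> real \<Rightarrow> real" where
  "qc_density M n x l = measure M (qc x l) / l ^ n"

text \<open>
  Sampling the densities on the fixed grid of scales \<open>2\<^sup>m\<close>, \<open>m\<close> an integer, makes these sums
  additive, in contrast to \<open>S_coeff\<close>, whose scales are tied to the smaller cube.
\<close>

definition dens_sum :: "(real^'d) measure \<Rightarrow> nat \<Rightarrow> real^'d \<Rightarrow> int \<Rightarrow> int \<Rightarrow> real" where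
  "dens_sum M n x i j = (\<Sum>m\<in>{i..j}. qc_density M n x (2 powr of_int m))"

locale growth_space =
  fixes M :: "(real^'d) measure" and n :: nat and C0 :: real
  assumes growth: "growth_measure M n C0" and n_pos: "0 < n" and C0_pos: "0 < C0"
begin

lemma sets_M [measurable_cong, simp]: "sets M = sets borel"
  using growth by (simp add: growth_measure_def)

lemma space_M [simp]: "space M = UNIV"
  using sets_eq_imp_space_eq[OF sets_M] by simp

lemma qc_sets [measurable, simp]: "qc x l \<in> sets M"
  by (simp add: borel_closed)

lemma msupp_sets [measurable, simp]: "msupp M \<in> sets M"
  by (simp add: borel_closed msupp_closed)

abbreviation mq where "mq x l \<equiv> measure M (qc x l)"
abbreviation th where "th \<equiv> qc_density M n"
abbreviation TT where "TT \<equiv> dens_sum M n"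
abbreviation osc where "osc f x l v \<equiv> \<integral>\<^sup>+y\<in>qc x l. ennreal \<bar>f y - v\<bar> \<partial>M"

text \<open>The centre is arbitrary here, so the bound comes from a ball containing the cube and
  carries a dimensional factor. For centres in the support \<open>mq_supp_le\<close> does without
  it.\<close>

lemma qc_growth: "0 < l \<Longrightarrow> emeasure M (qc u l) \<le> ennreal (C0 * (real CARD('d) * l) ^ n)"
proof -
  assume l: "0 < l"
  have "real CARD('d) * l / 2 < real CARD('d) * l" using l by simp
  then have "cball u (real CARD('d) * l / 2) \<subseteq> ball u (real CARD('d) * l)" by (simp add: cball_subset_ball_iff)
  then have "qc u l \<subseteq> ball u (real CARD('d) * l)" using qc_subset_cball[of u l] by blast
  then have "emeasure M (qc u l) \<le> emeasure M (ball u (real CARD('d) * l))" by (intro emeasure_mono) auto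
  also have "\<dots> \<le> ennreal (C0 * (real CARD('d) * l) ^ n)"
    using growth l unfolding growth_measure_def by simp
  finally show ?thesis .
qed

lemma qc_finite [simp]: "emeasure M (qc u l) < \<infinity>" "emeasure M (qc u l) \<noteq> \<infinity>" "emeasure M (qc u l) \<noteq> top"
proof -
  have "emeasure M (qc u l) \<le> emeasure M (qc u (max 1 l))" by (intro emeasure_mono qc_mono) auto
  also have "\<dots> < \<infinity>" using order_le_less_trans[OF qc_growth[of "max 1 l" u] ennreal_less_top] by simp
  finally show "emeasure M (qc u l) < \<infinity>" "emeasure M (qc u l) \<noteq> \<infinity>" "emeasure M (qc u l) \<noteq> top" by auto
qed

lemma qc_fmeasurable [simp]: "qc u l \<in> fmeasurable M"
  using qc_finite(1) by (intro fmeasurableI) auto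

lemma emeasure_qc: "emeasure M (qc u l) = ennreal (mq u l)"
  by (simp add: emeasure_eq_ennreal_measure)

lemma mq_mono: "qc x l \<subseteq> qc y r \<Longrightarrow> mq x l \<le> mq y r"
  by (rule measure_mono_fmeasurable) auto

lemma mq_supp_le: "x \<in> msupp M \<Longrightarrow> 0 < l \<Longrightarrow> mq x l \<le> C0 * l ^ n"
  using growth C0_pos unfolding growth_measure_def by (auto simp: emeasure_qc)

lemma mq_pos: "x \<in> msupp M \<Longrightarrow> 0 < l \<Longrightarrow> 0 < mq x l"
proof -
  assume x: "x \<in> msupp M" and l: "0 < l"
  have "0 < emeasure M (ball x (l/2))" using x l unfolding msupp_def by simp
  also have "\<dots> \<le> emeasure M (qc x l)"
    using cball_subset_qc[of x "l/2"] ball_subset_cball[of x "l/2"] by (intro emeasure_mono) auto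
  finally show ?thesis by (simp add: emeasure_qc)
qed

lemma th_nonneg [simp]: "0 \<le> l \<Longrightarrow> 0 \<le> th x l"
  by (simp add: qc_density_def)

lemma th_le: "x \<in> msupp M \<Longrightarrow> 0 < l \<Longrightarrow> th x l \<le> C0"
  by (simp add: qc_density_def divide_le_eq mq_supp_le)

lemma th_compare:
  assumes "qc x a \<subseteq> qc y b" "0 < a" "0 < b" "b \<le> 2 * a" shows "th x a \<le> 2 ^ n * th y b"
proof -
  have "th x a \<le> mq y b / a ^ n" using assms mq_mono by (auto simp: qc_density_def intro!: divide_right_mono)
  also have "\<dots> \<le> mq y b / (b/2) ^ n" using assms by (intro divide_left_mono power_mono) auto
  also have "\<dots> = 2 ^ n * th y b" by (simp add: qc_density_def power_divide)
  finally show ?thesis .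
qed

lemma TT_nonneg [simp]: "0 \<le> TT x i j"
  by (simp add: dens_sum_def sum_nonneg)

lemma TT_mono: "i' \<le> i \<Longrightarrow> j \<le> j' \<Longrightarrow> TT x i j \<le> TT x i' j'"
  unfolding dens_sum_def by (intro sum_mono2) auto

lemma TT_split: "TT x i j \<le> TT x i k + TT x (k + 1) j"
proof -
  have "TT x i j \<le> (\<Sum>m\<in>{i..k} \<union> {k+1..j}. th x (2 powr of_int m))"
    unfolding dens_sum_def by (intro sum_mono2) auto
  also have "\<dots> = TT x i k + TT x (k + 1) j" unfolding dens_sum_def by (intro sum.union_disjoint) auto
  finally show ?thesis .
qed

lemma TT_le_card: "x \<in> msupp M \<Longrightarrow> TT x i j \<le> C0 * real (nat (j - i + 1))"
proof -
  assume "x \<in> msupp M"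
  then have "TT x i j \<le> (\<Sum>m\<in>{i..j}. C0)" unfolding dens_sum_def by (intro sum_mono th_le) auto
  then show ?thesis by (simp add: mult.commute)
qed

text \<open>At every scale 2^m \<ge> 2^i the cube around x lies in the cube of twice the side around
  y. Changing the centre thus costs a factor 2^n and moves the range of scales up by one.\<close>

lemma TT_shift:
  assumes "y \<in> qc x l" "l \<le> 2 powr i" shows "TT x i j \<le> 2 ^ n * TT y (i + 1) (j + 1)"
proof -
  have "TT x i j \<le> (\<Sum>m\<in>{i..j}. 2 ^ n * th y (2 powr of_int (m + 1)))"
    unfolding dens_sum_def
  proof (intro sum_mono th_compare)
    fix m assume "m \<in> {i..j}"
    then have "(2::real) powr of_int i \<le> 2 powr of_int m" by (intro powr_mono) auto
    then have "l \<le> 2 powr of_int m" using assms by linarith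
    then have "x \<in> qc y (2 powr of_int m)" using assms(1) qc_mono qc_sym by blast
    then show "qc x (2 powr of_int m) \<subseteq> qc y (2 powr of_int (m + 1))"
      by (rule qc_subset_add) (simp add: powr_int_add1 del: of_int_add)
  qed (auto simp: powr_int_add1 simp del: of_int_add)
  also have "\<dots> = 2 ^ n * (\<Sum>m\<in>{i..j}. th y (2 powr of_int (m + 1)))" by (simp add: sum_distrib_left)
  also have "(\<Sum>m\<in>{i..j}. th y (2 powr of_int (m + 1))) = TT y (i + 1) (j + 1)"
    unfolding dens_sum_def by (rule sum.reindex_bij_witness[of _ "\<lambda>m. m - 1" "\<lambda>m. m + 1"]) auto
  finally show ?thesis .
qed

end


lemma sum_geometric_int_le:
  fixes q :: real assumes "0 \<le> q" "q < 1"
  shows "(\<Sum>m\<in>{i..j::int}. q ^ nat (j - m)) \<le> 1 / (1 - q)"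
proof -
  have "(\<Sum>m\<in>{i..j}. q ^ nat (j - m)) = sum ((^) q) ((\<lambda>m. nat (j - m)) ` {i..j})"
    by (subst sum.reindex) (auto simp: inj_on_def)
  also have "\<dots> \<le> suminf ((^) q)"
    using assms by (intro sum_le_suminf summable_geometric) auto
  also have "\<dots> = 1 / (1 - q)" using assms by (intro suminf_geometric) auto
  finally show ?thesis .
qed

text \<open>The alternative \<open>N = 1\<close> reflects that \<open>N_coeff\<close> counts from
  one: minimality yields 2^N l < 2r only when the predecessor of N is itself an admissible
  index.\<close>

lemma N_coeff_Cube:
  assumes "0 < l" "0 < r"
  obtains N where "N_coeff (Cube x l) (Cube y r) = enat N" "1 \<le> N" "r \<le> 2 ^ N * l"
    "N = 1 \<or> 2 ^ N * l < 2 * r"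
proof -
  let ?P = "\<lambda>k. 1 \<le> k \<and> r \<le> 2 ^ k * l"
  define N where "N = (LEAST k. ?P k)"
  obtain k where "r / l < 2 ^ k" using real_arch_pow[of 2 "r/l"] by auto
  then have "r \<le> 2 ^ k * l" using assms by (simp add: divide_less_eq)
  also have "2 ^ k * l \<le> 2 ^ max 1 k * l" using assms by (intro mult_right_mono power_increasing) auto
  finally have ex: "?P (max 1 k)" by simp
  then have N: "?P N" unfolding N_def by (rule LeastI)
  have "N = 1 \<or> 2 ^ N * l < 2 * r"
  proof (cases "N = 1")
    case False
    then have "\<not> ?P (N - 1)" "1 \<le> N - 1" using N not_less_Least[of "N - 1" ?P] unfolding N_def[symmetric] by auto
    then have "2 ^ (N - 1) * l < r" by simp
    then have "2 ^ Suc (N - 1) * l < 2 * r" by simp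
    then show ?thesis using \<open>1 \<le> N - 1\<close> by simp
  qed simp
  moreover have "N_coeff (Cube x l) (Cube y r) = enat N"
  proof -
    have "\<exists>k. 1 \<le> k \<and> r \<le> 2 ^ k * l" using ex by blast
    then show ?thesis by (simp add: N_coeff_def N_def)
  qed
  ultimately show ?thesis using N that by blast
qed

context growth_space
begin

text \<open>
  The side \<open>L\<close> nearly maximizes \<open>s\<^sup>-\<^sup>\<gamma> \<mu>(Q(x,s))/s\<^sup>n\<close> over \<open>s \<ge> l\<close>.  For \<open>s \<ge> L\<close> this is doubling
  at all scales at once, for \<open>s \<le> L\<close> it is geometric decay of the densities.
\<close>

lemma stopping_side:
  assumes "\<gamma> > 0" "\<kappa> > 1"
  obtains L K where "\<And>x l. x \<in> msupp M \<Longrightarrow> 0 < l \<Longrightarrow> l \<le> L x l \<and>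
    (\<forall>t\<ge>1. mq x (t * L x l) \<le> \<kappa> * t powr (real n + \<gamma>) * mq x (L x l)) \<and> TT x (sc l) (sc (L x l) + 2) \<le> K"
proof -
  define q where "q = 2 powr (- \<gamma>)"
  have q: "0 \<le> q" "q < 1" using assms by (auto simp: q_def powr_less_one)
  have "\<exists>L\<ge>l. (\<forall>t\<ge>1. mq x (t * L) \<le> \<kappa> * t powr (real n + \<gamma>) * mq x L) \<and>
      TT x (sc l) (sc L + 2) \<le> \<kappa> * C0 * (1 / (1 - q)) + C0 * 3"
    if x: "x \<in> msupp M" and l: "0 < l" for x l
  proof -
    define g where "g s = th x s * s powr (- \<gamma>)" for s
    have gb: "g s \<le> C0 * l powr (- \<gamma>)" if "l \<le> s" for s
      unfolding g_def using that l x assms C0_pos by (intro mult_mono th_le powr_mono2') auto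
    then have bdd: "bdd_above (g ` {l..})" by (auto intro!: bdd_aboveI2)
    have "0 < g l" using mq_pos[OF x l] l by (auto simp: g_def qc_density_def)
    also have "g l \<le> Sup (g ` {l..})" using bdd by (intro cSup_upper) auto
    finally have S0: "0 < Sup (g ` {l..})" .
    then have "Sup (g ` {l..}) / \<kappa> < Sup (g ` {l..})" using assms by (simp add: divide_less_eq)
    \<comment> \<open>The supremum need not be attained; \<kappa> > 1 leaves room for a side that
      exceeds the fraction 1/\<kappa> of it.\<close>
    then obtain L where L: "L \<ge> l" "Sup (g ` {l..}) / \<kappa> < g L"
      using less_cSup_iff[OF _ bdd] by auto
    have L0: "0 < L" using L l by simp
    have key: "th x s \<le> \<kappa> * th x L * (s / L) powr \<gamma>" if s: "l \<le> s" for s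
    proof -
      have "g s \<le> Sup (g ` {l..})" using bdd s by (intro cSup_upper) auto
      also have "\<dots> \<le> \<kappa> * g L" using L(2) assms by (simp add: divide_less_eq mult.commute)
      finally have "g s * s powr \<gamma> \<le> \<kappa> * g L * s powr \<gamma>" by (intro mult_right_mono) auto
      then show ?thesis using s l L0 by (simp add: g_def powr_divide powr_minus field_simps)
    qed
    have "mq x (t * L) \<le> \<kappa> * t powr (real n + \<gamma>) * mq x L" if t: "t \<ge> 1" for t
    proof -
      have "l \<le> t * L" using L t l mult_right_mono[of 1 t L] by linarith
      then have "th x (t * L) * (t * L) ^ n \<le> \<kappa> * th x L * t powr \<gamma> * (t * L) ^ n"
        using key[of "t * L"] L0 t by (intro mult_right_mono) auto
      moreover have "th x (t * L) * (t * L) ^ n = mq x (t * L)" using L0 t by (simp add: qc_density_def)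
      moreover have "th x L * L ^ n = mq x L" using L0 by (simp add: qc_density_def)
      moreover have "t powr (real n + \<gamma>) = t ^ n * t powr \<gamma>" using t by (simp add: powr_add powr_realpow)
      ultimately show ?thesis by (simp add: power_mult_distrib mult.assoc mult.left_commute)
    qed
    moreover have "TT x (sc l) (sc L + 2) \<le> \<kappa> * C0 * (1 / (1 - q)) + C0 * 3"
    proof -
      \<comment> \<open>Below L the densities decay by the factor q = 2^(-\<gamma>) per scale. The
        three scales from \<open>sc L\<close> to \<open>sc L + 2\<close> are bounded by
        \<open>C0\<close> each; the margin of two absorbs the scale lost in
        \<open>S_coeff_le\<close> and the one lost in \<open>TT_shift\<close>.\<close>
      have "TT x (sc l) (sc L - 1) \<le> (\<Sum>m\<in>{sc l..sc L - 1}. \<kappa> * C0 * q ^ nat (sc L - 1 - m))"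
        unfolding dens_sum_def
      proof (rule sum_mono)
        fix m assume m: "m \<in> {sc l..sc L - 1}"
        have "(2::real) powr sc l \<le> 2 powr m" using m by (intro powr_mono) auto
        then have "l \<le> 2 powr m" using sc_bounds[OF l] by linarith
        then have "th x (2 powr m) \<le> \<kappa> * th x L * (2 powr m / L) powr \<gamma>" by (rule key)
        also have "\<dots> \<le> \<kappa> * C0 * (2 powr m / L) powr \<gamma>"
          using th_le[OF x L0] assms by (intro mult_right_mono mult_left_mono) auto
        also have "(2 powr m / L) powr \<gamma> \<le> (2 powr (m - (sc L - 1))) powr \<gamma>"
        proof (rule powr_mono2)
          have "2 powr (sc L - 1) \<le> L" using sc_bounds(2)[OF L0] powr_int_add1[of "sc L - 1"] by simp
          then have "2 powr m / L \<le> 2 powr m / 2 powr (sc L - 1)" using L0 by (intro divide_left_mono) auto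
          then show "2 powr m / L \<le> 2 powr (m - (sc L - 1))" by (simp add: powr_diff)
        qed (use L0 assms in auto)
        also have "\<dots> = q ^ nat (sc L - 1 - m)"
          using m by (simp add: q_def powr_powr flip: powr_realpow) (simp add: algebra_simps)
        finally show "th x (2 powr real_of_int m) \<le> \<kappa> * C0 * q ^ nat (sc L - 1 - m)"
          using assms C0_pos by simp
      qed
      also have "\<dots> = \<kappa> * C0 * (\<Sum>m\<in>{sc l..sc L - 1}. q ^ nat (sc L - 1 - m))"
        by (simp add: sum_distrib_left)
      also have "\<dots> \<le> \<kappa> * C0 * (1 / (1 - q))"
        using assms C0_pos q by (intro mult_left_mono sum_geometric_int_le) auto
      finally show ?thesis using TT_split[of x "sc l" "sc L + 2" "sc L - 1"] TT_le_card[OF x, of "sc L" "sc L + 2"]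
        by simp
    qed
    ultimately show ?thesis using L by blast
  qed
  then show ?thesis using that by metis
qed

section \<open>Comparison of \<open>S_coeff\<close> with the density sums on the dyadic grid\<close>

abbreviation SS where "SS \<equiv> S_coeff M n"

lemma cube_density_dilate: "cube_density M n (dilate (2 ^ k) (Cube x l)) = th x (2 ^ k * l)"
  by (simp add: qc_density_def)

lemma S_coeff_finite:
  assumes "N_coeff (Cube x l) R = enat N"
  shows "SS (Cube x l) R = 1 + (\<Sum>k=1..N. th x (2 ^ k * l))"
proof -
  have "{k. 1 \<le> k \<and> enat k \<le> enat N} = {1..N}" by auto
  then show ?thesis unfolding S_coeff_def assms cube_density_dilate by simp
qed

lemma S_coeff_ge1: "is_cube M Q \<Longrightarrow> 1 \<le> SS Q R"
proof (cases Q)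
  case (Cube x l)
  assume "is_cube M Q"
  then show ?thesis using Cube
    unfolding S_coeff_def by (auto intro!: infsum_nonneg simp: qc_density_def simp flip: cube_density_dilate)
next
  case Whole
  then show ?thesis by (simp add: S_coeff_def)
qed

lemma th_power_compare:
  assumes "0 < l" shows "th x (2 ^ k * l) \<le> 2 ^ n * th x (2 powr (sc l + int k))"
proof -
  have p: "0 < 2 ^ k * l" using assms by simp
  have "2 ^ k * l \<le> 2 powr (sc l + int k)" "2 powr (sc l + int k) < 2 * (2 ^ k * l)"
    using sc_bounds[OF p] sc_mult_power[OF assms, of k] by simp_all
  then show ?thesis using assms by (intro th_compare qc_mono) auto
qed

lemma S_coeff_le:
  assumes "0 < l" "l \<le> r"
  shows "SS (Cube x l) (Cube y r) \<le> 1 + 2 ^ n * TT x (sc l + 1) (sc r + 1)"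
proof -
  have r: "0 < r" using assms by simp
  obtain N where N: "N_coeff (Cube x l) (Cube y r) = enat N" "1 \<le> N" "r \<le> 2 ^ N * l" "N = 1 \<or> 2 ^ N * l < 2 * r"
    using N_coeff_Cube[OF assms(1) r] .
  have "sc (2 ^ N * l) \<le> sc (2 * r)" using N assms by (intro sc_mono) auto
  then have le: "sc l + int N \<le> sc r + 1" using sc_mult_power[OF assms(1)] sc_double[OF r] by simp
  have "(\<Sum>k=1..N. th x (2 ^ k * l)) \<le> (\<Sum>k=1..N. 2 ^ n * th x (2 powr (sc l + int k)))"
    using assms by (intro sum_mono th_power_compare) auto
  also have "\<dots> = 2 ^ n * (\<Sum>m\<in>(\<lambda>k. sc l + int k) ` {1..N}. th x (2 powr m))"
    by (subst sum.reindex) (auto simp: inj_on_def sum_distrib_left)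
  also have "\<dots> \<le> 2 ^ n * TT x (sc l + 1) (sc r + 1)"
    unfolding dens_sum_def using le by (intro mult_left_mono sum_mono2) auto
  finally show ?thesis using S_coeff_finite[OF N(1)] by simp
qed

text \<open>The grid scale 2^(sc l + k - 1) lies between 2^(k-1) l and 2^k l, so the k-th summand of
  \<open>S_coeff\<close> dominates its density up to 2^n. Since \<open>sc r\<close> is at most
  \<open>sc l + N\<close>, one grid scale can remain at the top and costs \<open>C0\<close>.\<close>

lemma S_coeff_ge:
  assumes "x \<in> msupp M" "0 < l" "0 < r"
  shows "1 + TT x (sc l) (sc r) \<le> (2 ^ n + C0 + 1) * SS (Cube x l) (Cube y r)"
proof -
  obtain N where N: "N_coeff (Cube x l) (Cube y r) = enat N" "1 \<le> N" "r \<le> 2 ^ N * l" "N = 1 \<or> 2 ^ N * l < 2 * r"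
    using N_coeff_Cube[OF assms(2,3)] .
  have "sc r \<le> sc (2 ^ N * l)" using N assms by (intro sc_mono) auto
  then have le: "sc r \<le> sc l + int N" using sc_mult_power[OF assms(2)] by simp
  have "TT x (sc l) (sc r) \<le> TT x (sc l) (sc l + int N - 1) + TT x (sc l + int N) (sc r)"
    using TT_split[of x "sc l" "sc r" "sc l + int N - 1"] by simp
  also have "TT x (sc l + int N) (sc r) \<le> C0 * real (nat (sc r - (sc l + int N) + 1))"
    by (rule TT_le_card[OF assms(1)])
  also have "\<dots> \<le> C0 * 1" using C0_pos le by (intro mult_left_mono) auto
  also have "TT x (sc l) (sc l + int N - 1) = (\<Sum>k=1..N. th x (2 powr (sc l + int k - 1)))"
    unfolding dens_sum_def
    by (rule sum.reindex_bij_witness[of _ "\<lambda>k. sc l + int k - 1" "\<lambda>m. nat (m - sc l + 1)"]) auto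
  also have "\<dots> \<le> (\<Sum>k=1..N. 2 ^ n * th x (2 ^ k * l))"
  proof (rule sum_mono)
    fix k assume k: "k \<in> {1..N}"
    have e: "2 powr (sc l + int k - 1) = 2 ^ (k - 1) * 2 powr sc l"
      using k by (simp add: of_nat_diff powr_add powr_diff flip: powr_realpow)
    have kk: "(2::real) ^ k = 2 * 2 ^ (k - 1)" using k by (cases k) auto
    have "2 ^ (k - 1) * 2 powr sc l \<le> 2 ^ (k - 1) * (2 * l)"  "2 ^ (k - 1) * l \<le> 2 ^ (k - 1) * 2 powr sc l"
      using sc_bounds[OF assms(2)] by (intro mult_left_mono; simp)+
    then show "th x (2 powr (sc l + int k - 1)) \<le> 2 ^ n * th x (2 ^ k * l)"
      unfolding e kk using assms(2) by (intro th_compare qc_mono) auto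
  qed
  also have "\<dots> = 2 ^ n * (SS (Cube x l) (Cube y r) - 1)"
    using S_coeff_finite[OF N(1)] by (simp add: sum_distrib_left)
  finally have *: "TT x (sc l) (sc r) \<le> 2 ^ n * (SS (Cube x l) (Cube y r) - 1) + C0" by simp
  have 1: "1 \<le> SS (Cube x l) (Cube y r)" using assms by (intro S_coeff_ge1) auto
  have "C0 * 1 \<le> C0 * SS (Cube x l) (Cube y r)" using 1 C0_pos by (intro mult_left_mono) auto
  moreover have "0 \<le> (2::real) ^ n" by simp
  ultimately show ?thesis using * 1 unfolding right_diff_distrib distrib_right by linarith
qed

text \<open>The masses are bounded by the total mass while the denominators grow at least like 2^k,
  because n \<ge> 1. Convergence matters: on a family that is not summable, \<open>infsum\<close> in
  \<open>S_coeff\<close> would return 0.\<close>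

lemma summable_th_whole:
  assumes "emeasure M UNIV < \<infinity>" "0 < l"
  shows "summable (\<lambda>k. th x (2 ^ k * l))"
proof (rule summable_comparison_test')
  show "summable (\<lambda>k. measure M UNIV / l ^ n * (1/2) ^ k)" by (intro summable_mult summable_geometric) auto
  fix k :: nat
  have "(2::real) ^ k * 1 \<le> 2 ^ k * (2 ^ k) ^ (n - 1)" by (intro mult_left_mono one_le_power) auto
  also have "\<dots> = (2 ^ k) ^ n" using n_pos by (cases n) auto
  finally have *: "(2::real) ^ k \<le> (2 ^ k) ^ n" by simp
  have "mq x (2 ^ k * l) \<le> measure M UNIV"
    using assms by (intro measure_mono_fmeasurable fmeasurableI) auto
  then have "th x (2 ^ k * l) \<le> measure M UNIV / (2 ^ k * l) ^ n"
    using assms by (simp add: qc_density_def divide_right_mono)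
  also have "\<dots> \<le> measure M UNIV / (2 ^ k * l ^ n)"
    using * assms by (intro divide_left_mono) (auto simp: power_mult_distrib)
  finally show "norm (th x (2 ^ k * l)) \<le> measure M UNIV / l ^ n * (1/2) ^ k"
    using assms by (simp add: power_divide field_simps)
qed

lemma N_coeff_Whole: "0 < l \<Longrightarrow> N_coeff (Cube x l) Whole = \<infinity>"
  by (simp add: N_coeff_def)

lemma S_coeff_Whole:
  assumes "emeasure M UNIV < \<infinity>" "0 < l"
  shows "SS (Cube x l) Whole = 1 + (\<Sum>k. th x (2 ^ Suc k * l))"
proof -
  have s: "summable (\<lambda>k. th x (2 ^ Suc k * l))" using summable_th_whole[OF assms, of x] by (subst summable_Suc_iff)
  have "(\<Sum>\<^sub>\<infinity>k\<in>{k. 1 \<le> k}. th x (2 ^ k * l)) = (\<Sum>\<^sub>\<infinity>k\<in>UNIV. th x (2 ^ Suc k * l))"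
    by (rule infsum_reindex_bij_witness[of _ Suc "\<lambda>k. k - 1"]) auto
  also have "\<dots> = (\<Sum>k. th x (2 ^ Suc k * l))"
    using s assms by (intro infsumI norm_summable_imp_has_sum summable_sums) auto
  finally show ?thesis unfolding S_coeff_def N_coeff_Whole[OF assms(2)] cube_density_dilate by simp
qed

lemma S_coeff_Whole_ge:
  assumes "emeasure M UNIV < \<infinity>" "0 < l" "0 < r"
  shows "SS (Cube x l) (Cube y r) \<le> SS (Cube x l) Whole"
proof -
  obtain N where N: "N_coeff (Cube x l) (Cube y r) = enat N" using N_coeff_Cube[OF assms(2,3)] .
  have "(\<Sum>k=1..N. th x (2 ^ k * l)) = (\<Sum>k<N. th x (2 ^ Suc k * l))"
    by (rule sum.reindex_bij_witness[of _ Suc "\<lambda>k. k - 1"]) auto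
  also have "\<dots> \<le> (\<Sum>k. th x (2 ^ Suc k * l))"
  proof (rule sum_le_suminf)
    show "summable (\<lambda>k. th x (2 ^ Suc k * l))"
      using summable_th_whole[OF assms(1,2), of x] by (subst summable_Suc_iff)
  qed (use assms in auto)
  finally show ?thesis using S_coeff_finite[OF N] S_coeff_Whole[OF assms(1,2)] by simp
qed

end


section \<open>From the definition of \<open>rbmo\<close> to a family of comparable means\<close>

lemma ennreal_divide_leD:
  assumes "a / b \<le> ennreal c" "b = ennreal d" "0 < d" "0 \<le> c"
  shows "a \<le> ennreal (c * d)"
proof -
  have "a = a / b * b" using assms by (simp add: ennreal_divide_times mult_divide_eq_ennreal)
  also have "\<dots> \<le> ennreal c * b" using assms by (intro mult_right_mono) auto
  finally show ?thesis using assms by (simp add: ennreal_mult)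
qed

lemma ennreal_add_mult:
  assumes "0 \<le> a" "0 \<le> b" "0 \<le> m"
  shows "ennreal (a * m) + ennreal b * ennreal m = ennreal ((a + b) * m)"
  using assms by (simp add: distrib_right flip: ennreal_mult ennreal_plus)

text \<open>The interface for the rest of the proof; doubling cubes and averages no longer occur in
  it. \<open>mean_diff\<close> asks only that the centre x lie in the larger cube, so it also
  compares cubes of equal side with different centres. It is stated with \<open>dens_sum\<close>
  because those sums can be split and shifted. \<open>cW\<close> is the number attached to
  \<open>Whole\<close>.\<close>

locale mean_family = growth_space M n C0 for M :: "(real^'d) measure" and n :: nat and C0 :: real +
  fixes f :: "real^'d \<Rightarrow> real" and c :: "real^'d \<Rightarrow> real \<Rightarrow> real" and cW \<eta> C1 :: real
  assumes f_L1loc: "f \<in> L1loc M" and eta_ge: "1 \<le> \<eta>" and C1_nonneg: "0 \<le> C1"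
    and mean_osc: "\<And>x l. x \<in> msupp M \<Longrightarrow> 0 < l \<Longrightarrow>
      osc f x l (c x l) \<le> ennreal (C1 * mq x (\<eta> * l))"
    and mean_diff: "\<And>x y l r. x \<in> msupp M \<Longrightarrow> y \<in> msupp M \<Longrightarrow> 0 < l \<Longrightarrow> l \<le> r \<Longrightarrow> x \<in> qc y r \<Longrightarrow>
      \<bar>c x l - c y r\<bar> \<le> C1 * (1 + TT x (sc l) (sc r))"
    and mean_large: "\<And>x l. x \<in> msupp M \<Longrightarrow> 1 < l \<Longrightarrow> \<bar>c x l\<bar> \<le> C1"
    and mean_whole: "emeasure M UNIV < \<infinity> \<Longrightarrow> \<bar>cW\<bar> \<le> C1"
    and mean_osc_whole: "emeasure M UNIV < \<infinity> \<Longrightarrow>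
      (\<integral>\<^sup>+y. ennreal \<bar>f y - cW\<bar> \<partial>M) \<le> ennreal (C1 * measure M UNIV)"

locale rbmo_space = growth_space M n C0 for M :: "(real^'d) measure" and n :: nat and C0 :: real +
  fixes f :: "real^'d \<Rightarrow> real" and \<eta> \<rho> \<beta> C3 :: real
  assumes eta: "1 < \<eta>" "\<eta> \<le> \<rho>" and beta: "\<rho> ^ n < \<beta>"
    and tilde_ex: "\<And>Q. is_cube M Q \<Longrightarrow> \<exists>N::nat. doubling M \<rho> \<beta> (dilate (2 ^ N) Q)"
    and f_L1loc: "f \<in> L1loc M" and C3_nonneg: "0 \<le> C3"
    and cond1: "\<And>Q. is_cube M Q \<Longrightarrow> side Q \<le> 1 \<Longrightarrow>
        (\<integral>\<^sup>+y\<in>cube_set Q. ennreal \<bar>f y - avg M f (tilde M \<rho> \<beta> Q)\<bar> \<partial>M)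
          / emeasure M (cube_set (dilate \<eta> Q)) \<le> ennreal C3"
    and cond2: "\<And>Q R. is_cube M Q \<Longrightarrow> is_cube M R \<Longrightarrow> cube_set Q \<subseteq> cube_set R \<Longrightarrow>
        doubling M \<rho> \<beta> Q \<Longrightarrow> doubling M \<rho> \<beta> R \<Longrightarrow> side Q \<le> 1 \<Longrightarrow>
        \<bar>avg M f Q - avg M f R\<bar> \<le> C3 * S_coeff M n Q R"
    and cond3: "\<And>Q. is_cube M Q \<Longrightarrow> side Q > 1 \<Longrightarrow>
        (\<integral>\<^sup>+y\<in>cube_set Q. ennreal \<bar>f y\<bar> \<partial>M)
          / emeasure M (cube_set (dilate \<eta> Q)) \<le> ennreal C3"
begin

abbreviation dbl where "dbl x l \<equiv> doubling M \<rho> \<beta> (Cube x l)"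
abbreviation av where "av x l \<equiv> avg M f (Cube x l)"
abbreviation cm where "cm x l \<equiv> avg M f (tilde M \<rho> \<beta> (Cube x l))"

definition tn :: "real^'d \<Rightarrow> real \<Rightarrow> nat" where "tn x l = (LEAST N. dbl x (2 ^ N * l))"

lemma dbl_iff: "dbl x l \<longleftrightarrow> mq x (\<rho> * l) \<le> \<beta> * mq x l"
  by (simp add: doubling_def)

lemma beta_ge1: "1 < \<beta>"
proof -
  have "1 \<le> \<rho> ^ n" using eta by (intro one_le_power) auto
  then show ?thesis using beta by simp
qed

lemma tilde_Cube: "tilde M \<rho> \<beta> (Cube x l) = Cube x (2 ^ tn x l * l)"
  by (simp add: tilde_def tn_def)

lemma cm_eq: "cm x l = av x (2 ^ tn x l * l)"
  by (simp add: tilde_Cube)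

lemma dbl_tn: "x \<in> msupp M \<Longrightarrow> 0 < l \<Longrightarrow> dbl x (2 ^ tn x l * l)"
  using tilde_ex[of "Cube x l"] unfolding tn_def by (auto intro: LeastI)

text \<open>No dilate before the one with index \<open>tn x l\<close> is doubling, so a search that
  starts at the side 2^j l ends at the same cube.\<close>

lemma cm_shift:
  assumes "x \<in> msupp M" "0 < l" "j \<le> tn x l" shows "cm x (2 ^ j * l) = cm x l"
proof -
  have e: "2 ^ N * (2 ^ j * l) = 2 ^ (N + j) * l" for N by (simp add: power_add)
  have "tn x (2 ^ j * l) = tn x l - j"
    unfolding tn_def[of x "2 ^ j * l"]
  proof (rule Least_equality)
    show "dbl x (2 ^ (tn x l - j) * (2 ^ j * l))"
      unfolding e using dbl_tn[OF assms(1,2)] assms(3) by simp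
    fix N assume "dbl x (2 ^ N * (2 ^ j * l))"
    then have "tn x l \<le> N + j" unfolding e tn_def by (rule Least_le)
    then show "tn x l - j \<le> N" by simp
  qed
  then have "2 ^ tn x (2 ^ j * l) * (2 ^ j * l) = 2 ^ tn x l * l" unfolding e using assms(3) by simp
  then show ?thesis unfolding cm_eq by (simp only:)
qed

lemma f_meas [measurable]: "f \<in> borel_measurable M"
  using f_L1loc by (simp add: L1loc_def)

lemma f_int: "set_integrable M (qc x l) f"
  using f_L1loc by (simp add: L1loc_def)

lemma avg_diff:
  assumes "x \<in> msupp M" "0 < l" "osc f x l v \<le> ennreal (B * mq x l)" "0 \<le> B"
  shows "\<bar>av x l - v\<bar> \<le> B"
proof -
  have m: "0 < mq x l" by (rule mq_pos[OF assms(1,2)])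
  have iv: "set_integrable M (qc x l) (\<lambda>_. v)" unfolding set_integrable_def
    using qc_finite(1) by (intro integrable_scaleR_left integrable_real_indicator) auto
  have i: "set_integrable M (qc x l) (\<lambda>y. f y - v)"
    by (rule set_integral_diff(1)[OF f_int iv])
  have "(LINT y:qc x l|M. f y - v) = (LINT y:qc x l|M. f y) - mq x l * v"
    by (subst set_integral_diff(2)[OF f_int iv]) (simp add: set_lebesgue_integral_def)
  then have "\<bar>av x l - v\<bar> * mq x l = \<bar>LINT y:qc x l|M. f y - v\<bar>"
    using m by (simp add: avg_def abs_mult_pos field_simps flip: abs_mult_pos)
  also have "ennreal \<dots> \<le> (\<integral>\<^sup>+y. ennreal (norm (indicator (qc x l) y *\<^sub>R (f y - v))) \<partial>M)"
    using integral_norm_bound_ennreal[OF i[unfolded set_integrable_def]] by (simp add: set_lebesgue_integral_def)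
  also have "\<dots> = osc f x l v"
    by (intro nn_integral_cong) (auto simp: indicator_def)
  also note assms(3)
  finally have "\<bar>av x l - v\<bar> * mq x l \<le> B * mq x l" using assms m by (simp add: ennreal_le_iff)
  then show ?thesis using m by simp
qed

lemma c1: "x \<in> msupp M \<Longrightarrow> 0 < l \<Longrightarrow> l \<le> 1 \<Longrightarrow>
    osc f x l (cm x l) \<le> ennreal (C3 * mq x (\<eta> * l))"
  using cond1[of "Cube x l"] eta C3_nonneg mq_pos[of x "\<eta> * l"]
  by (intro ennreal_divide_leD[where b = "emeasure M (qc x (\<eta> * l))"]) (auto simp: emeasure_qc)

lemma c3: "x \<in> msupp M \<Longrightarrow> 1 < l \<Longrightarrow>
    (\<integral>\<^sup>+y\<in>qc x l. ennreal \<bar>f y\<bar> \<partial>M) \<le> ennreal (C3 * mq x (\<eta> * l))"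
  using cond3[of "Cube x l"] eta C3_nonneg mq_pos[of x "\<eta> * l"]
  by (intro ennreal_divide_leD[where b = "emeasure M (qc x (\<eta> * l))"]) (auto simp: emeasure_qc one_ereal_def)

text \<open>Because \<eta> \<le> \<rho>, doubling turns the enlarged cube in the third condition of
  \<open>rbmo\<close> back into the cube itself, at the price \<beta>.\<close>

lemma av_large:
  assumes "x \<in> msupp M" "1 < l" "dbl x l" shows "\<bar>av x l\<bar> \<le> C3 * \<beta>"
proof -
  have "mq x (\<eta> * l) \<le> mq x (\<rho> * l)" using assms eta by (intro mq_mono qc_mono mult_right_mono) auto
  also have "\<dots> \<le> \<beta> * mq x l" using assms(3) by (simp add: dbl_iff)
  finally have "C3 * mq x (\<eta> * l) \<le> (C3 * \<beta>) * mq x l"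
    using C3_nonneg by (simp add: mult_left_mono mult.assoc)
  then have "osc f x l 0 \<le> ennreal (C3 * \<beta> * mq x l)"
    using c3[OF assms(1,2)] by (auto intro: order_trans ennreal_leI)
  then have "\<bar>av x l - 0\<bar> \<le> C3 * \<beta>" using assms C3_nonneg beta_ge1 by (intro avg_diff) auto
  then show ?thesis by simp
qed

text \<open>The second condition of \<open>rbmo\<close> speaks only of inner cubes with side at most
  1. If the inner cube is larger, both averages are bounded by \<open>av_large\<close>, which is the
  source of the term 2 C3 \<beta>.\<close>

lemma av_diff_doubling:
  assumes "x \<in> msupp M" "y \<in> msupp M" "0 < s" "0 < r" "qc x s \<subseteq> qc y r" "dbl x s" "dbl y r"
  shows "\<bar>av x s - av y r\<bar> \<le> C3 * (1 + 2 ^ n * TT x (sc s + 1) (sc r + 1)) + 2 * C3 * \<beta>"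
proof (cases "s \<le> 1")
  case True
  have "s \<le> r" using qc_subset_imp_le assms by blast
  have "\<bar>av x s - av y r\<bar> \<le> C3 * SS (Cube x s) (Cube y r)"
    using assms True by (intro cond2) auto
  also have "\<dots> \<le> C3 * (1 + 2 ^ n * TT x (sc s + 1) (sc r + 1))"
    using C3_nonneg S_coeff_le[OF assms(3) \<open>s \<le> r\<close>] by (intro mult_left_mono)
  finally show ?thesis using C3_nonneg beta_ge1 by (auto intro: add_increasing2)
next
  case False
  have "s \<le> r" using qc_subset_imp_le assms by blast
  have "\<bar>av x s\<bar> \<le> C3 * \<beta>" "\<bar>av y r\<bar> \<le> C3 * \<beta>" using False assms \<open>s \<le> r\<close> by (auto intro!: av_large)
  moreover have "0 \<le> C3 * (1 + 2 ^ n * TT x (sc s + 1) (sc r + 1))"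
    using C3_nonneg by (intro mult_nonneg_nonneg) auto
  ultimately show ?thesis by linarith
qed

text \<open>By hypothesis \<beta> / \<rho>^n exceeds 1. Its square root \<kappa> is spent twice:
  once as the defect of the near-maximal side, once as \<rho>^\<gamma>. Then \<kappa> \<rho>^(n +
  \<gamma>) = \<beta>, so the stopping cube is doubling for exactly the prescribed constants, and it
  comes with a bounded density sum.\<close>

lemma good_side:
  obtains L D K where "\<And>x l. x \<in> msupp M \<Longrightarrow> 0 < l \<Longrightarrow> l \<le> L x l"
    "\<And>x l. x \<in> msupp M \<Longrightarrow> 0 < l \<Longrightarrow> dbl x (L x l)"
    "\<And>x l t. x \<in> msupp M \<Longrightarrow> 0 < l \<Longrightarrow> 1 \<le> t \<Longrightarrow> mq x (t * L x l) \<le> D t * mq x (L x l)"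
    "\<And>x l. x \<in> msupp M \<Longrightarrow> 0 < l \<Longrightarrow> TT x (sc l) (sc (L x l) + 2) \<le> K"
    "\<And>t. 0 \<le> D t"
proof -
  define q where "q = \<beta> / \<rho> ^ n"
  have rho: "1 < \<rho>" using eta by simp
  then have rn: "0 < \<rho> ^ n" by simp
  have q: "1 < q" using beta rn by (simp add: q_def)
  define \<kappa> where "\<kappa> = sqrt q"
  define \<gamma> where "\<gamma> = log \<rho> \<kappa>"
  have k: "1 < \<kappa>" using q by (simp add: \<kappa>_def)
  have g: "0 < \<gamma>" using k rho by (simp add: \<gamma>_def)
  have rg: "\<rho> powr \<gamma> = \<kappa>" using k rho by (simp add: \<gamma>_def)
  obtain L K where L: "\<And>x l. x \<in> msupp M \<Longrightarrow> 0 < l \<Longrightarrow> l \<le> L x l \<and>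
    (\<forall>t\<ge>1. mq x (t * L x l) \<le> \<kappa> * t powr (real n + \<gamma>) * mq x (L x l)) \<and> TT x (sc l) (sc (L x l) + 2) \<le> K"
    by (rule stopping_side[OF g k]) blast
  show ?thesis
  proof (rule that[of L "\<lambda>t. \<kappa> * t powr (real n + \<gamma>)" K])
    fix x l assume "x \<in> msupp M" and "(0::real) < l"
    note Lx = L[OF this]
    have "mq x (\<rho> * L x l) \<le> \<kappa> * \<rho> powr (real n + \<gamma>) * mq x (L x l)" using Lx rho by auto
    also have "\<kappa> * \<rho> powr (real n + \<gamma>) = \<beta>"
    proof -
      have "\<kappa> * \<rho> powr (real n + \<gamma>) = \<rho> ^ n * (\<kappa> * \<kappa>)"
        using rho rg by (simp add: powr_add powr_realpow)
      also have "\<kappa> * \<kappa> = q" using q by (simp add: \<kappa>_def)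
      finally show ?thesis using rn rho by (simp add: q_def)
    qed
    finally show "dbl x (L x l)" by (simp add: dbl_iff)
  qed (use L k in auto)
qed

text \<open>The averages over the stopping cubes are the intermediary. They are comparable by the
  second condition of \<open>rbmo\<close>, and \<open>I1\<close> keeps them within bounded distance
  of the numbers \<open>cm\<close>. \<open>alpha\<close> compares concentric cubes of different
  sides, \<open>beta\<close> cubes of equal side with different centres; together they give
  \<open>mean_diff\<close>.\<close>

lemma mean_family: "\<exists>C1. mean_family M n C0 f cm (avg M f (tilde M \<rho> \<beta> Whole)) \<eta> C1"
proof -
  obtain L D K where L: "\<And>x l. x \<in> msupp M \<Longrightarrow> 0 < l \<Longrightarrow> l \<le> L x l"
    and Ld: "\<And>x l. x \<in> msupp M \<Longrightarrow> 0 < l \<Longrightarrow> dbl x (L x l)"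
    and LD: "\<And>x l t. x \<in> msupp M \<Longrightarrow> 0 < l \<Longrightarrow> 1 \<le> t \<Longrightarrow> mq x (t * L x l) \<le> D t * mq x (L x l)"
    and LK: "\<And>x l. x \<in> msupp M \<Longrightarrow> 0 < l \<Longrightarrow> TT x (sc l) (sc (L x l) + 2) \<le> K"
    and D: "\<And>t. 0 \<le> D t"
    using good_side by blast
  have L0: "0 < L x l" if "x \<in> msupp M" "0 < l" for x l using L[OF that] that by simp
  define K' where "K' = max K 0"
  have LK': "TT x i j \<le> K'" if "x \<in> msupp M" "0 < l" "sc l \<le> i" "j \<le> sc (L x l) + 2" for x l i j
    using LK[OF that(1,2)] TT_mono[OF that(3,4), of x] by (simp add: K'_def)
  have K': "0 \<le> K'" by (simp add: K'_def)
  \<comment> \<open>The bound of \<open>av_diff_doubling\<close> for a density sum of at most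
    \<open>K'\<close>.\<close>
  define E where "E = C3 * (1 + 2 ^ n * K') + 2 * C3 * \<beta>"
  have E: "0 \<le> C3 * \<beta>" "0 \<le> C3 * (1 + 2 ^ n * K')" "0 \<le> C3 * D (2 * \<eta>)"
    using C3_nonneg beta_ge1 K' D by auto
  define C4 where "C4 = E + C3 * D (2 * \<eta>)"
  have cm_large: "\<bar>cm x l\<bar> \<le> C3 * \<beta>" if x: "x \<in> msupp M" and l: "1 < l" for x l
  proof -
    have "1 * l \<le> 2 ^ tn x l * l" using l by (intro mult_right_mono) auto
    then have "1 < 2 ^ tn x l * l" using l by linarith
    then show ?thesis unfolding cm_eq using dbl_tn[OF x, of l] l by (intro av_large[OF x]) auto
  qed
  \<comment> \<open>If the first doubling dilate fits into the stopping cube, both are doubling and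
    the scales between them lie in the stopping range, where the density sum is at most
    \<open>K'\<close>. In the other case the doubling dilate may be far away.\<close>
  have I1: "\<bar>cm x l - av x (L x l)\<bar> \<le> C4" if x: "x \<in> msupp M" and l: "0 < l" for x l
  proof (cases "2 ^ tn x l * l \<le> L x l")
    case True
    have "1 * l \<le> 2 ^ tn x l * l" using l by (intro mult_right_mono) auto
    then have le: "sc l \<le> sc (2 ^ tn x l * l)" using l by (intro sc_mono) auto
    have "\<bar>cm x l - av x (L x l)\<bar>
        \<le> C3 * (1 + 2 ^ n * TT x (sc (2 ^ tn x l * l) + 1) (sc (L x l) + 1)) + 2 * C3 * \<beta>"
      unfolding cm_eq using x l L0[OF x l] True dbl_tn[OF x l] Ld[OF x l]
      by (intro av_diff_doubling qc_mono) auto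
    also have "\<dots> \<le> E" unfolding E_def
      using le C3_nonneg x l by (intro add_right_mono mult_left_mono add_left_mono LK'[of x l]) auto
    finally show ?thesis using E by (simp add: C4_def)
  next
    case False
    txt \<open>The dilate \<open>2\<^sup>j Q\<close> is comparable to the stopping cube and has the same first doubling dilate as \<open>Q\<close>.\<close>
    define j where "j = (LEAST j. L x l \<le> 2 ^ j * l)"
    have ex: "L x l \<le> 2 ^ tn x l * l" using False by simp
    then have j1: "L x l \<le> 2 ^ j * l" unfolding j_def by (rule LeastI)
    have j2: "j \<le> tn x l" unfolding j_def using ex by (rule Least_le)
    have j3: "2 ^ j * l \<le> 2 * L x l"
    proof (cases j)
      case 0
      then show ?thesis using L[OF x l] l by simp
    next
      case (Suc i)
      then have "\<not> L x l \<le> 2 ^ i * l" using not_less_Least[of i "\<lambda>j. L x l \<le> 2 ^ j * l"] by (simp add: j_def)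
      then show ?thesis using Suc by simp
    qed
    have jl: "0 < 2 ^ j * l" using l by simp
    \<comment> \<open>The side 2^j l is at most twice the stopping side, hence the factor 2\<eta>,
      at which the dilate of the stopping cube still has comparable measure. The oscillation over
      2^j Q thus controls the one over the stopping cube relative to its own measure.\<close>
    have "mq x (\<eta> * (2 ^ j * l)) \<le> mq x (2 * \<eta> * L x l)"
      using j3 eta by (intro mq_mono qc_mono) (simp add: mult.left_commute)
    also have "\<dots> \<le> D (2 * \<eta>) * mq x (L x l)" using LD[OF x l, of "2 * \<eta>"] eta by simp
    finally have m: "C3 * mq x (\<eta> * (2 ^ j * l)) \<le> C3 * D (2 * \<eta>) * mq x (L x l)"
      using C3_nonneg by (simp add: mult_left_mono mult.assoc)
    have sub: "osc f x (L x l) v \<le> osc f x (2 ^ j * l) v" for v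
      using qc_mono[OF j1, of x] by (intro nn_integral_mono) (auto simp: indicator_def)
    \<comment> \<open>The first condition of \<open>rbmo\<close> covers sides up to 1. Beyond that
      the third one bounds f itself and the mean is bounded too, so the comparison is with
      0.\<close>
    show ?thesis
    proof (cases "2 ^ j * l \<le> 1")
      case True
      have "osc f x (L x l) (cm x l) \<le> ennreal (C3 * D (2 * \<eta>) * mq x (L x l))"
        using sub[of "cm x l"] c1[OF x jl True] m unfolding cm_shift[OF x l j2] by (meson ennreal_leI order_trans)
      then have "\<bar>av x (L x l) - cm x l\<bar> \<le> C3 * D (2 * \<eta>)" using avg_diff x L0[OF x l] E(3) by blast
      then show ?thesis using E by (simp add: C4_def E_def abs_minus_commute)
    next
      case False
      then have "osc f x (L x l) 0 \<le> ennreal (C3 * D (2 * \<eta>) * mq x (L x l))"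
        using sub[of 0] c3[OF x, of "2 ^ j * l"] m by simp (meson ennreal_leI order_trans)
      then have "\<bar>av x (L x l) - 0\<bar> \<le> C3 * D (2 * \<eta>)" using avg_diff x L0[OF x l] E(3) by blast
      moreover have "\<bar>cm x l\<bar> \<le> C3 * \<beta>"
        using cm_large[OF x, of "2 ^ j * l"] False unfolding cm_shift[OF x l j2] by simp
      ultimately show ?thesis using E by (simp add: C4_def E_def abs_minus_commute)
    qed
  qed
  have C4: "0 \<le> C4" using E by (simp add: C4_def E_def)
  define C5 where "C5 = 2 * C4 + E + C3 * 2 ^ n"
  have C5: "0 \<le> C5" using E C4 C3_nonneg by (simp add: C5_def E_def)
  have alpha: "\<bar>cm x l - cm x l'\<bar> \<le> C5 * (1 + TT x (sc l) (sc l'))"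
    if x: "x \<in> msupp M" and l: "0 < l" and l': "l \<le> l'" for x l l'
  proof -
    have l'0: "0 < l'" using l l' by simp
    have "\<bar>av x (L x l) - av x (L x l')\<bar> \<le> C3 * (1 + 2 ^ n * (TT x (sc l) (sc l') + K')) + 2 * C3 * \<beta>"
    proof (cases "L x l \<le> L x l'")
      case True
      have "\<bar>av x (L x l) - av x (L x l')\<bar>
          \<le> C3 * (1 + 2 ^ n * TT x (sc (L x l) + 1) (sc (L x l') + 1)) + 2 * C3 * \<beta>"
        using True x l l'0 L0 Ld by (intro av_diff_doubling qc_mono) auto
      also have "TT x (sc (L x l) + 1) (sc (L x l') + 1) \<le> TT x (sc l) (sc (L x l') + 1)"
        using sc_mono[OF l L[OF x l]] by (intro TT_mono) auto
      also have "\<dots> \<le> TT x (sc l) (sc l') + TT x (sc l' + 1) (sc (L x l') + 1)" by (rule TT_split)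
      also have "TT x (sc l' + 1) (sc (L x l') + 1) \<le> K'" using x l'0 by (intro LK'[of x l']) auto
      finally show ?thesis using C3_nonneg by (simp add: mult_left_mono)
    next
      case False
      \<comment> \<open>With the stopping cubes in reverse order, the scales between them lie in the
        stopping range of the cube of side l, so their density sum is at most
        \<open>K'\<close>.\<close>
      have "\<bar>av x (L x l') - av x (L x l)\<bar>
          \<le> C3 * (1 + 2 ^ n * TT x (sc (L x l') + 1) (sc (L x l) + 1)) + 2 * C3 * \<beta>"
        using False x l l'0 L0 Ld by (intro av_diff_doubling qc_mono) auto
      also have "TT x (sc (L x l') + 1) (sc (L x l) + 1) \<le> K'"
        using x l sc_mono[of l "L x l'"] L[OF x l'0] l' by (intro LK'[of x l]) auto
      also have "K' \<le> TT x (sc l) (sc l') + K'" by simp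
      finally show ?thesis using C3_nonneg by (simp add: mult_left_mono abs_minus_commute)
    qed
    moreover have "C5 * (1 + TT x (sc l) (sc l')) = C5 + C5 * TT x (sc l) (sc l')" by (simp add: algebra_simps)
    moreover have "C3 * 2 ^ n * TT x (sc l) (sc l') \<le> C5 * TT x (sc l) (sc l')"
      using E C4 by (intro mult_right_mono) (auto simp: C5_def E_def)
    moreover have "0 \<le> C3 * 2 ^ n" using C3_nonneg by simp
    ultimately show ?thesis
      using I1[OF x l] I1[OF x l'0] unfolding C5_def E_def by (simp add: distrib_left mult.assoc)
  qed
  define C6 where "C6 = 2 * C4 + E + C3 * (1 + 2 ^ n * (2 ^ n * (K' + K'))) + C4 + C5 * (1 + K')"
  have beta1: "\<bar>cm x l - cm y l\<bar> \<le> C6"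
    if x: "x \<in> msupp M" and y: "y \<in> msupp M" and l: "0 < l" and xy: "x \<in> qc y l" and le: "L x l \<le> L y l" for x y l
  proof -
    let ?Lx = "L x l" and ?Ly = "L y l"
    have Ly: "0 < ?Ly" using L0[OF y l] .
    then have Ly2: "0 < 2 * ?Ly" by simp
    \<comment> \<open>The stopping cube of x need not lie in that of y, only in its double, and the
      double need not be doubling for \<rho> and \<beta>. A second stopping cube is therefore
      started from the double.\<close>
    let ?L' = "L y (2 * ?Ly)"
    have sL: "sc l \<le> sc ?Lx" "sc l \<le> sc ?Ly" using sc_mono[OF l] L[OF x l] L[OF y l] by auto
    have "x \<in> qc y ?Ly" using xy qc_mono[OF L[OF y l]] by auto
    then have "qc x ?Lx \<subseteq> qc y (2 * ?Ly)" using le by (intro qc_subset_add) auto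
    also have "\<dots> \<subseteq> qc y ?L'" using L[OF y Ly2] by (intro qc_mono)
    finally have "\<bar>av x ?Lx - av y ?L'\<bar> \<le> C3 * (1 + 2 ^ n * TT x (sc ?Lx + 1) (sc ?L' + 1)) + 2 * C3 * \<beta>"
      using x y l Ly2 L0 Ld by (intro av_diff_doubling) auto
    also have "TT x (sc ?Lx + 1) (sc ?L' + 1) \<le> TT x (sc l) (sc ?L' + 1)" using sL by (intro TT_mono) auto
    also have "\<dots> \<le> 2 ^ n * TT y (sc l + 1) (sc ?L' + 1 + 1)"
      using xy sc_bounds[OF l] by (intro TT_shift[of y x l]) (auto simp: qc_sym)
    also have "TT y (sc l + 1) (sc ?L' + 1 + 1) \<le> TT y (sc l + 1) (sc ?Ly) + TT y (sc ?Ly + 1) (sc ?L' + 1 + 1)"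
      by (rule TT_split)
    also have "TT y (sc l + 1) (sc ?Ly) \<le> K'" using y l by (intro LK'[of y l]) auto
    also have "TT y (sc ?Ly + 1) (sc ?L' + 1 + 1) \<le> K'"
      using y Ly2 sc_double[OF Ly] by (intro LK'[of y "2 * ?Ly"]) auto
    finally have 1: "\<bar>av x ?Lx - av y ?L'\<bar> \<le> C3 * (1 + 2 ^ n * (2 ^ n * (K' + K'))) + 2 * C3 * \<beta>"
      using C3_nonneg by (simp add: mult_left_mono)
    have "\<bar>cm y l - cm y (2 * ?Ly)\<bar> \<le> C5 * (1 + TT y (sc l) (sc (2 * ?Ly)))"
      using y l L[OF y l] Ly by (intro alpha) auto
    also have "TT y (sc l) (sc (2 * ?Ly)) \<le> K'"
      using y l sc_double[OF Ly] by (intro LK'[of y l]) auto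
    finally have 2: "\<bar>cm y l - cm y (2 * ?Ly)\<bar> \<le> C5 * (1 + K')" using C5 by (simp add: mult_left_mono)
    show ?thesis
      using 1 2 I1[OF x l] I1[OF y Ly2] C4 E unfolding C6_def E_def by (smt (verit))
  qed
  have beta: "\<bar>cm x l - cm y l\<bar> \<le> C6"
    if x: "x \<in> msupp M" and y: "y \<in> msupp M" and l: "0 < l" and xy: "x \<in> qc y l" for x y l
    using beta1[OF x y l xy] beta1[OF y x l] xy by (cases "L x l \<le> L y l") (auto simp: qc_sym abs_minus_commute)
  have C6: "0 \<le> C6" unfolding C6_def using C4 C5 E K' C3_nonneg by (simp add: E_def)
  define CW where "CW = C3 + C3"
  define C1 where "C1 = C5 + C6 + C3 * \<beta> + C3 + C3"
  have C1: "0 \<le> C1" using C5 C6 E C3_nonneg by (simp add: C1_def)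
  show ?thesis
  proof (intro exI[of _ C1], unfold_locales)
    fix x y and l r :: real
    assume x: "x \<in> msupp M" and y: "y \<in> msupp M" and l: "0 < l" "l \<le> r" and xy: "x \<in> qc y r"
    have "\<bar>cm x l - cm y r\<bar> \<le> C5 * (1 + TT x (sc l) (sc r)) + C6"
      using alpha[OF x l] beta[OF x y _ xy] l by fastforce
    also have "\<dots> \<le> C5 * (1 + TT x (sc l) (sc r)) + C6 * (1 + TT x (sc l) (sc r))" using C6 by (simp add: mult_left_mono algebra_simps)
    also have "\<dots> = (C5 + C6) * (1 + TT x (sc l) (sc r))" by (simp add: algebra_simps)
    also have "\<dots> \<le> C1 * (1 + TT x (sc l) (sc r))"
      using E C3_nonneg by (intro mult_right_mono) (auto simp: C1_def)
    finally show "\<bar>cm x l - cm y r\<bar> \<le> C1 * (1 + TT x (sc l) (sc r))" .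
  next
    fix x and l :: real assume x: "x \<in> msupp M" and l: "1 < l"
    show "\<bar>cm x l\<bar> \<le> C1" using cm_large[OF x l] C5 C6 C3_nonneg by (simp add: C1_def)
  next
    fix x and l :: real assume x: "x \<in> msupp M" and l: "0 < l"
    show "osc f x l (cm x l) \<le> ennreal (C1 * mq x (\<eta> * l))"
    proof (cases "l \<le> 1")
      case True
      have "C3 * mq x (\<eta> * l) \<le> C1 * mq x (\<eta> * l)"
        using C5 C6 E C3_nonneg by (intro mult_right_mono) (auto simp: C1_def)
      then show ?thesis using c1[OF x l True] by (meson ennreal_leI order_trans)
    next
      case False
      \<comment> \<open>For sides above 1 the third condition bounds the integral of |f|, and the
        mean is bounded by \<open>cm_large\<close>.\<close>
      have "osc f x l (cm x l)
          \<le> (\<integral>\<^sup>+y. ennreal \<bar>f y\<bar> * indicator (qc x l) y + ennreal (C3 * \<beta>) * indicator (qc x l) y \<partial>M)"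
      proof (intro nn_integral_mono)
        fix y
        have "\<bar>f y - cm x l\<bar> \<le> \<bar>f y\<bar> + C3 * \<beta>" using cm_large[OF x, of l] False by auto
        then have "ennreal \<bar>f y - cm x l\<bar> \<le> ennreal \<bar>f y\<bar> + ennreal (C3 * \<beta>)"
          using E by (simp flip: ennreal_plus)
        then show "ennreal \<bar>f y - cm x l\<bar> * indicator (qc x l) y
            \<le> ennreal \<bar>f y\<bar> * indicator (qc x l) y + ennreal (C3 * \<beta>) * indicator (qc x l) y"
          by (auto simp: indicator_def)
      qed
      also have "\<dots> = (\<integral>\<^sup>+y\<in>qc x l. ennreal \<bar>f y\<bar> \<partial>M) + ennreal (C3 * \<beta>) * ennreal (mq x l)"
        by (simp add: nn_integral_add nn_integral_cmult_indicator emeasure_qc)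
      also have "\<dots> \<le> ennreal (C3 * mq x (\<eta> * l)) + ennreal (C3 * \<beta>) * ennreal (mq x (\<eta> * l))"
        using c3[OF x, of l] False eta l mult_right_mono[of 1 \<eta> l]
        by (intro add_mono mult_left_mono ennreal_leI mq_mono qc_mono) auto
      also have "\<dots> = ennreal ((C3 + C3 * \<beta>) * mq x (\<eta> * l))"
        using E C3_nonneg by (intro ennreal_add_mult) auto
      also have "\<dots> \<le> ennreal (C1 * mq x (\<eta> * l))"
        using C5 C6 E C3_nonneg by (intro ennreal_leI mult_right_mono) (auto simp: C1_def)
      finally show ?thesis .
    qed
  next
    assume fin: "emeasure M UNIV < \<infinity>"
    have W: "tilde M \<rho> \<beta> Whole = Whole" by (simp add: tilde_def)
    have em: "emeasure M UNIV = ennreal (measure M UNIV)" using fin by (simp add: emeasure_eq_ennreal_measure)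
    \<comment> \<open>If the total mass is zero, the division in the third condition cannot be
      undone; but then every integral vanishes.\<close>
    have 3: "(\<integral>\<^sup>+y. ennreal \<bar>f y\<bar> \<partial>M) \<le> ennreal (C3 * measure M UNIV)"
    proof (cases "measure M UNIV = 0")
      case True
      then have "AE x in M. False" using em by (intro AE_I[where N=UNIV]) auto
      then have "(\<integral>\<^sup>+y. ennreal \<bar>f y\<bar> \<partial>M) = (\<integral>\<^sup>+y. 0 \<partial>M)" by (intro nn_integral_cong_AE) auto
      then show ?thesis by simp
    next
      case False
      then have "0 < measure M UNIV" by (simp add: zero_less_measure_iff)
      then show ?thesis using cond3[of Whole] fin em C3_nonneg
        by (intro ennreal_divide_leD[where b="emeasure M UNIV"]) auto
    qed
    have "ennreal \<bar>LINT y|M. f y\<bar> \<le> (\<integral>\<^sup>+y. ennreal \<bar>f y\<bar> \<partial>M)"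
    proof -
      have "integrable M f" using 3 by (intro integrableI_bounded) (auto simp: order_le_less_trans)
      then show ?thesis using integral_norm_bound_ennreal[of M f] by simp
    qed
    also note 3
    finally have "\<bar>LINT y|M. f y\<bar> \<le> C3 * measure M UNIV" using C3_nonneg by (simp add: ennreal_le_iff)
    then have av: "\<bar>avg M f (tilde M \<rho> \<beta> Whole)\<bar> \<le> C3"
      unfolding W avg_def using C3_nonneg
      by (cases "measure M UNIV = 0") (auto simp: set_lebesgue_integral_def divide_le_eq zero_less_measure_iff)
    then show "\<bar>avg M f (tilde M \<rho> \<beta> Whole)\<bar> \<le> C1" using C5 C6 E C3_nonneg by (simp add: C1_def)
    let ?c = "avg M f (tilde M \<rho> \<beta> Whole)"
    have "(\<integral>\<^sup>+y. ennreal \<bar>f y - ?c\<bar> \<partial>M) \<le> (\<integral>\<^sup>+y. ennreal \<bar>f y\<bar> + ennreal C3 \<partial>M)"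
      using av C3_nonneg by (intro nn_integral_mono) (auto simp flip: ennreal_plus intro!: ennreal_leI)
    also have "\<dots> = (\<integral>\<^sup>+y. ennreal \<bar>f y\<bar> \<partial>M) + ennreal C3 * emeasure M UNIV"
      by (simp add: nn_integral_add)
    also have "\<dots> \<le> ennreal (C3 * measure M UNIV) + ennreal C3 * ennreal (measure M UNIV)"
      using 3 em by (intro add_mono) auto
    also have "\<dots> = ennreal ((C3 + C3) * measure M UNIV)"
      using C3_nonneg by (intro ennreal_add_mult) auto
    also have "\<dots> \<le> ennreal (C1 * measure M UNIV)"
      using C5 C6 E C3_nonneg by (intro ennreal_leI mult_right_mono) (auto simp: C1_def)
    finally show "(\<integral>\<^sup>+y. ennreal \<bar>f y - ?c\<bar> \<partial>M) \<le> ennreal (C1 * measure M UNIV)" .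
  qed (use f_L1loc eta C1 in auto)
qed

end


section \<open>Covering lemmas\<close>

lemma finite_cover_by_cubes:
  obtains B :: nat where "\<And>(A :: (real^'d) set) x l s. A \<subseteq> qc x l \<Longrightarrow> 0 < s \<Longrightarrow> l \<le> real N * s \<Longrightarrow>
    \<exists>F\<subseteq>A. finite F \<and> card F \<le> B \<and> A \<subseteq> (\<Union>z\<in>F. qc z (2 * s))"
proof
  define P where "P = PiE (UNIV::'d set) (\<lambda>_. {0..int N})"
  have finP: "finite P" unfolding P_def by (intro finite_PiE) auto
  fix A :: "(real^'d) set" and x l s assume A: "A \<subseteq> qc x l" and s: "(0::real) < s" and l: "l \<le> real N * s"
  \<comment> \<open>\<open>g\<close> sends a point to the index of its grid cell of side s. One
    point of A is kept from every occupied cell, so the centres stay in A and their number is at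
    most (N + 1)^d.\<close>
  define g where "g y = (\<lambda>i. \<lfloor>(y $ i - x $ i + l / 2) / s\<rfloor>)" for y :: "real^'d"
  have gP: "g ` A \<subseteq> P"
  proof
    fix h assume "h \<in> g ` A"
    then obtain y where y: "y \<in> qc x l" "h = g y" using A by auto
    have "0 \<le> h i \<and> h i \<le> int N" for i
    proof -
      have "\<bar>y $ i - x $ i\<bar> \<le> l/2" using y by (auto simp: qc_def)
      then have "0 \<le> y $ i - x $ i + l/2" "y $ i - x $ i + l/2 \<le> N * s" using l by linarith+
      then have "0 \<le> (y $ i - x $ i + l/2) / s" "(y $ i - x $ i + l/2) / s \<le> N"
        using s by (auto simp: divide_le_eq)
      then show ?thesis unfolding y(2) g_def by linarith
    qed
    then show "h \<in> P" by (auto simp: P_def)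
  qed
  define F where "F = inv_into A g ` g ` A"
  have "finite F" using finite_subset[OF gP finP] unfolding F_def by (rule finite_imageI)
  moreover have "card F \<le> card P"
    unfolding F_def using gP finP by (meson card_image_le card_mono finite_subset order_trans)
  moreover have "F \<subseteq> A" unfolding F_def by (intro image_subsetI inv_into_into)
  moreover have "A \<subseteq> (\<Union>z\<in>F. qc z (2 * s))"
  proof
    fix y assume y: "y \<in> A"
    define z where "z = inv_into A g (g y)"
    have z: "z \<in> F" "g z = g y" unfolding z_def F_def using y by (auto intro: f_inv_into_f)
    have "\<bar>y $ i - z $ i\<bar> \<le> s" for i
    proof -
      have "\<lfloor>(y $ i - x $ i + l/2) / s\<rfloor> = \<lfloor>(z $ i - x $ i + l/2) / s\<rfloor>" using z(2) by (metis g_def)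
      then have "\<bar>(y $ i - x $ i + l/2) / s - (z $ i - x $ i + l/2) / s\<bar> \<le> 1" by linarith
      then have "\<bar>(y $ i - z $ i) / s\<bar> \<le> 1" by (simp flip: diff_divide_distrib)
      then show ?thesis using s by (simp add: divide_le_eq)
    qed
    then have "y \<in> qc z (2 * s)" by (simp add: qc_def)
    then show "y \<in> (\<Union>z\<in>F. qc z (2 * s))" using z by blast
  qed
  ultimately show "\<exists>F\<subseteq>A. finite F \<and> card F \<le> card P \<and> A \<subseteq> (\<Union>z\<in>F. qc z (2 * s))" by blast
qed

text \<open>The covering lemma for Euclidean balls is applied with radii \<open>CARD('d)\<close>
  times L, so that the balls contain the cubes. The fivefold balls fit into cubes with side 10
  \<open>CARD('d)\<close> times L, whence the dimensional constant.\<close>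

lemma Vitali_cubes:
  fixes X :: "(real^'d) set" and L :: "real^'d \<Rightarrow> real"
  assumes "\<And>x. x \<in> X \<Longrightarrow> 0 < L x \<and> L x \<le> B"
  obtains I where "countable I" "I \<subseteq> X" "disjoint_family_on (\<lambda>x. qc x (L x)) I"
    "X \<subseteq> (\<Union>x\<in>I. qc x (10 * real CARD('d) * L x))"
proof -
  let ?d = "real CARD('d)"
  have d: "0 < ?d" by simp
  obtain I where I: "countable I" "I \<subseteq> X"
     "pairwise (\<lambda>i j. disjnt (cball i (?d * L i)) (cball j (?d * L j))) I"
     "X \<subseteq> (\<Union>i\<in>I. cball i (5 * (?d * L i)))"
  proof (rule Vitali_covering_lemma_cballs[where S=X and K=X and a="\<lambda>x. x" and r="\<lambda>x. ?d * L x" and B="?d * B"])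
    show "X \<subseteq> (\<Union>i\<in>X. cball i (?d * L i))" using assms by (force intro: less_imp_le)
    show "0 < ?d * L i \<and> ?d * L i \<le> ?d * B" if "i \<in> X" for i using assms[OF that] by simp
  qed blast
  have sub: "qc x (L x) \<subseteq> cball x (?d * L x)" if "x \<in> I" for x
  proof -
    have "?d * L x / 2 \<le> ?d * L x" using assms[of x] I(2) that by auto
    then show ?thesis using qc_subset_cball[of x "L x"] by (meson subset_cball subset_trans)
  qed
  have "disjoint_family_on (\<lambda>x. qc x (L x)) I"
    unfolding disjoint_family_on_def
  proof (intro ballI impI)
    fix x y assume xy: "x \<in> I" "y \<in> I" "x \<noteq> y"
    then have "disjnt (cball x (?d * L x)) (cball y (?d * L y))" using I(3) by (auto simp: pairwise_def)
    then show "qc x (L x) \<inter> qc y (L y) = {}" using sub[OF xy(1)] sub[OF xy(2)] by (auto simp: disjnt_def)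
  qed
  moreover have "X \<subseteq> (\<Union>x\<in>I. qc x (10 * real CARD('d) * L x))"
  proof -
    have "cball x (5 * (?d * L x)) \<subseteq> qc x (10 * real CARD('d) * L x)" for x
      using cball_subset_qc[of x "5 * (?d * L x)"] by (simp add: mult.assoc)
    then show ?thesis using I(4) by blast
  qed
  ultimately show ?thesis using I that by blast
qed

text \<open>This is the form in which a covering by dilates A is paid for by disjoint cubes B. Sums
  over \<open>I\<close> are written as integrals against counting measure, so that Tonelli
  interchanges them with the integral over M.\<close>

lemma emeasure_le_disjoint_family:
  fixes g :: "'a \<Rightarrow> ennreal"
  assumes I: "countable I" and X: "X \<in> sets M" "X \<subseteq> (\<Union>i\<in>I. A i)" and A: "\<And>i. i \<in> I \<Longrightarrow> A i \<in> sets M"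
    and B: "\<And>i. i \<in> I \<Longrightarrow> B i \<in> sets M" "\<And>i. i \<in> I \<Longrightarrow> B i \<subseteq> S" "disjoint_family_on B I"
    and g [measurable]: "g \<in> borel_measurable M"
    and le: "\<And>i. i \<in> I \<Longrightarrow> emeasure M (A i) \<le> k * (\<integral>\<^sup>+x\<in>B i. g x \<partial>M)"
  shows "emeasure M X \<le> k * (\<integral>\<^sup>+x\<in>S. g x \<partial>M)"
proof -
  have "emeasure M X = (\<integral>\<^sup>+x. indicator X x \<partial>M)" using X by simp
  also have "\<dots> \<le> (\<integral>\<^sup>+x. (\<integral>\<^sup>+i. indicator (A i) x \<partial>count_space I) \<partial>M)"
  proof (intro nn_integral_mono)
    fix x
    show "indicator X x \<le> (\<integral>\<^sup>+i. indicator (A i) x \<partial>count_space I)"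
    proof (cases "x \<in> X")
      case True
      then obtain i where i: "i \<in> I" "x \<in> A i" using X by blast
      have "1 = (\<integral>\<^sup>+j. indicator {i} j \<partial>count_space I)" using i by simp
      also have "\<dots> \<le> (\<integral>\<^sup>+j. indicator (A j) x \<partial>count_space I)"
        using i by (intro nn_integral_mono) (auto simp: indicator_def)
      finally show ?thesis by (simp add: indicator_def)
    qed simp
  qed
  also have "\<dots> = (\<integral>\<^sup>+i. (\<integral>\<^sup>+x. indicator (A i) x \<partial>M) \<partial>count_space I)"
    using I A by (intro nn_integral_count_space_nn_integral) auto
  also have "\<dots> = (\<integral>\<^sup>+i. emeasure M (A i) \<partial>count_space I)"
    using A by (intro nn_integral_cong) simp
  also have "\<dots> \<le> (\<integral>\<^sup>+i. k * (\<integral>\<^sup>+x\<in>B i. g x \<partial>M) \<partial>count_space I)"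
    using le by (intro nn_integral_mono) auto
  also have "\<dots> = k * (\<integral>\<^sup>+i. (\<integral>\<^sup>+x\<in>B i. g x \<partial>M) \<partial>count_space I)"
    by (simp add: nn_integral_cmult)
  also have "(\<integral>\<^sup>+i. (\<integral>\<^sup>+x\<in>B i. g x \<partial>M) \<partial>count_space I)
      = (\<integral>\<^sup>+x. (\<integral>\<^sup>+i. g x * indicator (B i) x \<partial>count_space I) \<partial>M)"
    using I B(1) by (intro nn_integral_count_space_nn_integral[symmetric] borel_measurable_times_ennreal g
        borel_measurable_indicator) auto
  also have "\<dots> \<le> (\<integral>\<^sup>+x\<in>S. g x \<partial>M)"
  proof (intro nn_integral_mono)
    fix x
    show "(\<integral>\<^sup>+i. g x * indicator (B i) x \<partial>count_space I) \<le> g x * indicator S x"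
    proof (cases "\<exists>i\<in>I. x \<in> B i")
      case True
      then obtain i where i: "i \<in> I" "x \<in> B i" by blast
      have "(\<integral>\<^sup>+j. g x * indicator (B j) x \<partial>count_space I) = (\<integral>\<^sup>+j. g x * indicator {i} j \<partial>count_space I)"
        using i B(3) by (intro nn_integral_cong) (auto simp: indicator_def disjoint_family_on_def)
      also have "\<dots> = g x" using i by (simp add: nn_integral_cmult)
      finally show ?thesis using i B(2) by (auto simp: indicator_def)
    next
      case False
      then have "(\<integral>\<^sup>+j. g x * indicator (B j) x \<partial>count_space I) = (\<integral>\<^sup>+j. 0 \<partial>count_space I)"
        by (intro nn_integral_cong) (auto simp: indicator_def)
      then show ?thesis by simp
    qed
  qed
  finally show ?thesis by (simp add: mult_left_mono)
qed

section \<open>Comparable sides, logarithmic growth and oscillation of the means\<close>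

context mean_family
begin

lemma f_meas [measurable]: "f \<in> borel_measurable M"
  using f_L1loc by (simp add: L1loc_def)

text \<open>Between comparable sides there are at most p + 1 grid scales, each with density at most
  \<open>C0\<close>.\<close>

lemma mean_close:
  assumes "x \<in> msupp M" "y \<in> msupp M" "0 < l" "l \<le> r" "r \<le> 2 ^ p * l" "x \<in> qc y r"
  shows "\<bar>c x l - c y r\<bar> \<le> C1 * (1 + C0 * (real p + 1))"
proof -
  have "0 < r" using assms by simp
  then have "sc r \<le> sc l + int p" using sc_mono[OF _ assms(5)] sc_mult_power[OF assms(3)] by simp
  then have "C0 * real (nat (sc r - sc l + 1)) \<le> C0 * (real p + 1)"
    using C0_pos sc_mono[OF assms(3,4)] by (intro mult_left_mono) auto
  then have "TT x (sc l) (sc r) \<le> C0 * (real p + 1)" using TT_le_card[OF assms(1), of "sc l" "sc r"] by linarith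
  then have "C1 * (1 + TT x (sc l) (sc r)) \<le> C1 * (1 + C0 * (real p + 1))"
    using C1_nonneg by (intro mult_left_mono) auto
  then show ?thesis using mean_diff[of x y l r] assms by linarith
qed

text \<open>A cube with side at most 1 is compared with the concentric cube of side 2, where
  \<open>mean_large\<close> applies. At most k + 2 grid scales lie between, each with density at
  most \<open>C0\<close>. Hence means grow at most logarithmically in the inverse of the
  side.\<close>

lemma mean_log_bound:
  assumes x: "x \<in> msupp M" and "0 < l" "- int k \<le> sc l"
  shows "\<bar>c x l\<bar> \<le> C1 * (2 + C0 * (2 + real k))"
proof (cases "l \<le> 1")
  case True
  have "sc l \<le> sc 1" using assms True by (intro sc_mono) auto
  then have sl: "sc l \<le> 0" by (simp add: sc_def)
  have s2: "sc 2 = 1" by (simp add: sc_def)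
  have "TT x (sc l) 1 \<le> C0 * real (nat (1 - sc l + 1))" by (rule TT_le_card[OF x])
  also have "\<dots> \<le> C0 * (2 + real k)" using C0_pos assms sl by (intro mult_left_mono) auto
  finally have T: "C1 * (1 + TT x (sc l) 1) \<le> C1 * (1 + C0 * (2 + real k))"
    using C1_nonneg by (intro mult_left_mono) auto
  have "\<bar>c x l - c x 2\<bar> \<le> C1 * (1 + TT x (sc l) (sc 2))" using x assms True by (intro mean_diff) auto
  then have "\<bar>c x l\<bar> \<le> C1 + C1 * (1 + C0 * (2 + real k))" using mean_large[OF x, of 2] T s2 by simp
  then show ?thesis by (simp add: algebra_simps)
next
  case False
  have "C1 * 1 \<le> C1 * (2 + C0 * (2 + real k))"
    using C1_nonneg C0_pos by (intro mult_left_mono) (auto intro: add_increasing2)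
  then show ?thesis using mean_large[OF x, of l] False by simp
qed

lemma osc_triangle:
  "osc f x l v \<le> osc f x l w + ennreal (\<bar>w - v\<bar> * mq x l)"
proof -
  have "osc f x l v
      \<le> (\<integral>\<^sup>+y. ennreal \<bar>f y - w\<bar> * indicator (qc x l) y + ennreal \<bar>w - v\<bar> * indicator (qc x l) y \<partial>M)"
    by (intro nn_integral_mono) (auto simp: indicator_def simp flip: ennreal_plus intro!: ennreal_leI)
  also have "\<dots> = osc f x l w + ennreal \<bar>w - v\<bar> * ennreal (mq x l)"
    by (simp add: nn_integral_add nn_integral_cmult_indicator emeasure_qc)
  finally show ?thesis by (simp flip: ennreal_mult)
qed

lemma osc_shift:
  assumes "x \<in> msupp M" "0 < l"
  shows "osc f x l v \<le> ennreal (C1 * mq x (\<eta> * l) + \<bar>c x l - v\<bar> * mq x l)"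
proof -
  have "osc f x l v
      \<le> ennreal (C1 * mq x (\<eta> * l)) + ennreal (\<bar>c x l - v\<bar> * mq x l)"
    using osc_triangle[where x=x and l=l and v=v and w="c x l"] mean_osc[OF assms] by (meson add_right_mono order_trans)
  then show ?thesis using C1_nonneg by simp
qed

text \<open>Covering a cube by boundedly many smaller ones replaces the dilation factor by 2.\<close>

lemma mean_osc2:
  obtains C where "0 \<le> C" "\<And>x l. x \<in> msupp M \<Longrightarrow> 0 < l \<Longrightarrow>
    osc f x l (c x l) \<le> ennreal (C * mq x (2 * l))"
proof -
  \<comment> \<open>The pieces will have side 2l/N. N \<ge> 2\<eta> makes their \<eta>-dilates fit
    into 2Q when the centres are in Q, and N \<ge> 2 keeps their sides at most l.\<close>
  define N where "N = nat \<lceil>2 * \<eta>\<rceil>"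
  have N: "2 * \<eta> \<le> real N" "2 \<le> real N" using eta_ge unfolding N_def by linarith+
  obtain p where p: "real N < 2 ^ p" using real_arch_pow[of 2 "real N"] by auto
  obtain B where B: "\<And>(A :: (real^'d) set) x l s. A \<subseteq> qc x l \<Longrightarrow> 0 < s \<Longrightarrow> l \<le> real N * s \<Longrightarrow>
    \<exists>F\<subseteq>A. finite F \<and> card F \<le> B \<and> A \<subseteq> (\<Union>z\<in>F. qc z (2 * s))" by (rule finite_cover_by_cubes[of N]) blast
  define E where "E = C1 * (1 + C0 * (real p + 1))"
  have E: "0 \<le> E" using C1_nonneg C0_pos by (simp add: E_def)
  show ?thesis
  proof (rule that[of "real B * (C1 + E)"])
    show "0 \<le> real B * (C1 + E)" using E C1_nonneg by simp
    fix x and l :: real assume x: "x \<in> msupp M" and l: "0 < l"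
    define s where "s = l / N"
    have s: "0 < s" "l \<le> real N * s" "2 * s \<le> l" using N l by (auto simp: s_def field_simps)
    \<comment> \<open>Only the part of the cube in the support is covered, since the pieces need
      centres there; the rest is a null set.\<close>
    obtain F where F: "F \<subseteq> qc x l \<inter> msupp M" "finite F" "card F \<le> B" "qc x l \<inter> msupp M \<subseteq> (\<Union>z\<in>F. qc z (2 * s))"
      using B[of "qc x l \<inter> msupp M" x l s] s by auto
    have "\<eta> * (2 * s) \<le> l" using N l by (simp add: s_def divide_le_eq mult.commute mult.left_commute)
    then have sub: "qc z (\<eta> * (2 * s)) \<subseteq> qc x (2 * l)" if "z \<in> F" for z
      using that F by (intro qc_subset_add[of z x l]) auto
    have one: "osc f z (2 * s) (c x l) \<le> ennreal ((C1 + E) * mq x (2 * l))" if z: "z \<in> F" for z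
    proof -
      have zs: "z \<in> msupp M" "z \<in> qc x l" using F z by auto
      have "real N * s \<le> 2 ^ p * (2 * s)" using p s by (intro mult_mono) auto
      then have "l \<le> 2 ^ p * (2 * s)" using s by linarith
      then have "\<bar>c z (2 * s) - c x l\<bar> \<le> E" unfolding E_def
        using zs x s by (intro mean_close) auto
      moreover have "mq z (\<eta> * (2 * s)) \<le> mq x (2 * l)" using sub[OF z] by (rule mq_mono)
      moreover have "mq z (2 * s) \<le> mq z (\<eta> * (2 * s))"
        using eta_ge s mult_right_mono[of 1 \<eta> "2 * s"] by (intro mq_mono qc_mono) auto
      ultimately have "C1 * mq z (\<eta> * (2 * s)) + \<bar>c z (2 * s) - c x l\<bar> * mq z (2 * s)
          \<le> C1 * mq x (2 * l) + E * mq x (2 * l)"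
        using C1_nonneg E by (intro add_mono mult_mono) auto
      also have "\<dots> = (C1 + E) * mq x (2 * l)" by (simp add: algebra_simps)
      finally show ?thesis using osc_shift[OF zs(1), of "2 * s" "c x l"] s by (auto intro: order_trans ennreal_leI)
    qed
    have "osc f x l (c x l)
        \<le> (\<integral>\<^sup>+y. (\<Sum>z\<in>F. ennreal \<bar>f y - c x l\<bar> * indicator (qc z (2 * s)) y) \<partial>M)"
    proof (rule nn_integral_mono_AE)
      show "AE y in M. ennreal \<bar>f y - c x l\<bar> * indicator (qc x l) y
          \<le> (\<Sum>z\<in>F. ennreal \<bar>f y - c x l\<bar> * indicator (qc z (2 * s)) y)"
        using AE_msupp[OF sets_M]
      proof eventually_elim
        fix y assume y: "y \<in> msupp M"
        show "ennreal \<bar>f y - c x l\<bar> * indicator (qc x l) y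
          \<le> (\<Sum>z\<in>F. ennreal \<bar>f y - c x l\<bar> * indicator (qc z (2 * s)) y)"
        proof (cases "y \<in> qc x l")
          case True
          then obtain z where z: "z \<in> F" "y \<in> qc z (2 * s)" using F(4) y by blast
          have "ennreal \<bar>f y - c x l\<bar> * indicator (qc z (2 * s)) y
              \<le> (\<Sum>z\<in>F. ennreal \<bar>f y - c x l\<bar> * indicator (qc z (2 * s)) y)"
            using z F(2) by (intro member_le_sum) auto
          then show ?thesis using z True by simp
        qed simp
      qed
    qed
    also have "\<dots> = (\<Sum>z\<in>F. osc f z (2 * s) (c x l))"
      by (intro nn_integral_sum) measurable
    also have "\<dots> \<le> (\<Sum>z\<in>F. ennreal ((C1 + E) * mq x (2 * l)))" by (intro sum_mono one)
    also have "\<dots> = ennreal (real (card F) * ((C1 + E) * mq x (2 * l)))"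
      by (simp add: ennreal_mult ennreal_of_nat_eq_real_of_nat E C1_nonneg)
    also have "\<dots> \<le> ennreal (real B * (C1 + E) * mq x (2 * l))"
      using F(3) E C1_nonneg by (intro ennreal_leI) (simp add: mult.assoc mult_right_mono)
    finally show "osc f x l (c x l) \<le> ennreal (real B * (C1 + E) * mq x (2 * l))" .
  qed
qed

end


section \<open>A John--Nirenberg inequality\<close>

text \<open>Open cubes make the superlevel sets below open, hence measurable, although these are
  uncountable unions.\<close>

definition oqc :: "real^'d \<Rightarrow> real \<Rightarrow> (real^'d) set" where
  "oqc x l = {y. \<forall>i. \<bar>y $ i - x $ i\<bar> < l / 2}"

lemma oqc_subset: "oqc x l \<subseteq> qc x l"
  by (auto simp: oqc_def qc_def less_imp_le)

lemma qc_subset_oqc: "l < l' \<Longrightarrow> qc x l \<subseteq> oqc x l'"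
  unfolding oqc_def qc_def by (intro Collect_mono impI allI) (meson divide_strict_right_mono order_le_less_trans zero_less_numeral)

lemma open_oqc: "open (oqc x l)"
proof -
  have "oqc x l = (\<Inter>i. {y. \<bar>y $ i - x $ i\<bar> < l/2})" by (auto simp: oqc_def)
  moreover have "open {y. \<bar>y $ i - x $ i\<bar> < l/2}" for i
    by (intro open_Collect_less continuous_intros)
  ultimately show ?thesis by (auto intro: open_INT)
qed

context mean_family
begin

text \<open>The superlevel set at height t of the maximal function \<Phi> of the means, with the
  supremum over cubes that contain the point in their interior.\<close>

definition level :: "real \<Rightarrow> (real^'d) set" where
  "level t = (\<Union>z\<in>msupp M. \<Union>l\<in>{l. 0 < l \<and> t < \<bar>c z l\<bar>}. oqc z l)"

lemma open_level: "open (level t)"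
  unfolding level_def by (intro open_UN ballI open_oqc)

lemma level_sets [measurable]: "level t \<in> sets M"
  by (simp add: borel_open open_level)

lemma level_iff: "y \<in> level t \<longleftrightarrow> (\<exists>z\<in>msupp M. \<exists>l>0. t < \<bar>c z l\<bar> \<and> y \<in> oqc z l)"
  unfolding level_def by blast

lemma levelI: "z \<in> msupp M \<Longrightarrow> 0 < l \<Longrightarrow> t < \<bar>c z l\<bar> \<Longrightarrow> y \<in> oqc z l \<Longrightarrow> y \<in> level t"
  unfolding level_iff by blast

lemma level_mono: "t \<le> t' \<Longrightarrow> level t' \<subseteq> level t"
  using order_le_less_trans unfolding subset_iff level_iff by blast

text \<open>The cube containing y is replaced by the cube of the same side around y; by the case p =
  0 of \<open>mean_close\<close> the means differ by at most C1 (1 + C0).\<close>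

lemma level_center:
  assumes "y \<in> level t" "y \<in> msupp M"
  obtains l where "0 < l" "t - C1 * (1 + C0) < \<bar>c y l\<bar>"
proof -
  obtain z l where z: "z \<in> msupp M" "0 < l" "t < \<bar>c z l\<bar>" "y \<in> oqc z l" using assms(1) unfolding level_iff by blast
  have "y \<in> qc z l" by (rule subsetD[OF oqc_subset z(4)])
  then have "\<bar>c y l - c z l\<bar> \<le> C1 * (1 + C0 * (real 0 + 1))"
    using assms(2) z by (intro mean_close) simp_all
  then show ?thesis using z that[of l] by simp
qed

text \<open>No prescribed doubling constant has to be met here, so \<gamma> = 1 and \<kappa> = 2 are
  simply chosen. Since the density sum up to L is bounded, passing to the stopping cube changes the
  mean by at most a constant.\<close>

lemma stopping_cube:
  obtains L D K where "\<And>x l. x \<in> msupp M \<Longrightarrow> 0 < l \<Longrightarrow> l \<le> L x l"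
    "\<And>x l t. x \<in> msupp M \<Longrightarrow> 0 < l \<Longrightarrow> 1 \<le> t \<Longrightarrow> mq x (t * L x l) \<le> D t * mq x (L x l)"
    "\<And>x l. x \<in> msupp M \<Longrightarrow> 0 < l \<Longrightarrow> \<bar>c x l - c x (L x l)\<bar> \<le> K"
    "\<And>t. 0 \<le> D t" "0 \<le> K"
proof -
  obtain L K where L: "\<And>x l. x \<in> msupp M \<Longrightarrow> 0 < l \<Longrightarrow> l \<le> L x l \<and>
    (\<forall>t\<ge>1. mq x (t * L x l) \<le> 2 * t powr (real n + 1) * mq x (L x l)) \<and> TT x (sc l) (sc (L x l) + 2) \<le> K"
    by (rule stopping_side[of 1 2]) (simp, simp, blast)
  show ?thesis
  proof (rule that[of L "\<lambda>t. 2 * t powr (real n + 1)" "C1 * (1 + max K 0)"])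
    fix x l assume x: "x \<in> msupp M" and l: "(0::real) < l"
    have "\<bar>c x l - c x (L x l)\<bar> \<le> C1 * (1 + TT x (sc l) (sc (L x l)))"
      using L[OF x l] x l by (intro mean_diff) auto
    also have "TT x (sc l) (sc (L x l)) \<le> TT x (sc l) (sc (L x l) + 2)" by (intro TT_mono) auto
    also have "\<dots> \<le> max K 0" using L[OF x l] by (auto intro: max.coboundedI1)
    finally show "\<bar>c x l - c x (L x l)\<bar> \<le> C1 * (1 + max K 0)" using C1_nonneg by (simp add: mult_left_mono)
  qed (use L C1_nonneg in auto)
qed

text \<open>The step of a good-\<lambda> argument. Nearly maximal cubes with mean above an
  intermediate height are replaced by stopping cubes, whose dilates have comparable measure as a
  Vitali selection requires. These lie in the lower superlevel set, and within each Vitali dilate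
  the higher superlevel set has at most half the measure of the stopping cube. The window grows by
  \<epsilon> because cubes of side at most \<epsilon> centred in it may stick out.\<close>

lemma level_decay_step:
  obtains A where "0 < A" "\<And>t \<epsilon> u s. C1 \<le> t \<Longrightarrow> 0 < \<epsilon> \<Longrightarrow>
      (\<And>x l. x \<in> msupp M \<Longrightarrow> 0 < l \<Longrightarrow> t < \<bar>c x l\<bar> \<Longrightarrow> l \<le> \<epsilon>) \<Longrightarrow>
      emeasure M (msupp M \<inter> level (t + A) \<inter> qc u s) \<le> ennreal (1/2) * emeasure M (level t \<inter> qc u (s + \<epsilon>))"
proof -
  obtain L D K where L: "\<And>x l. x \<in> msupp M \<Longrightarrow> 0 < l \<Longrightarrow> l \<le> L x l"
    and LD: "\<And>x l t. x \<in> msupp M \<Longrightarrow> 0 < l \<Longrightarrow> 1 \<le> t \<Longrightarrow> mq x (t * L x l) \<le> D t * mq x (L x l)"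
    and LK: "\<And>x l. x \<in> msupp M \<Longrightarrow> 0 < l \<Longrightarrow> \<bar>c x l - c x (L x l)\<bar> \<le> K"
    and D: "\<And>t. 0 \<le> D t" and K: "0 \<le> K"
    using stopping_cube by blast
  define d where "d = 10 * real CARD('d)"
  have d: "10 \<le> d" unfolding d_def by (simp add: Suc_leI)
  define H where "H = C1 * (1 + 2 * C0)"
  have H: "0 \<le> H" using C1_nonneg C0_pos by (simp add: H_def)
  have H0: "C1 * (1 + C0) \<le> H" unfolding H_def using C1_nonneg C0_pos by (intro mult_left_mono) auto
  have near: "\<bar>c x l - c y l\<bar> \<le> H" if "x \<in> msupp M" "y \<in> msupp M" "0 < l" "x \<in> qc y l" for x y l
    using mean_close[of x y l l 0] that H0 by simp
  have double: "\<bar>c x l - c x (2 * l)\<bar> \<le> H" if "x \<in> msupp M" "0 < l" for x l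
    using mean_close[of x x l "2 * l" 1] that by (simp add: H_def mult.commute)
  define k2 where "k2 = D d * (4 * (C1 * D (2 * \<eta> * d)))"
  have k2: "0 \<le> k2" using D C1_nonneg by (simp add: k2_def)
  \<comment> \<open>A > 2H + K prevents a cube of higher mean from outgrowing the dilate by d. Half
    of A survives the losses H + K, and a quarter survives the oscillation term C1 D(\<eta>) too.
    The constant \<open>k2\<close> collects the doubling cost of the Vitali dilates, that of the
    surrounding cube and the resulting factor 4; A \<ge> 2 k2 makes k2 / A at most 1/2.\<close>
  define A where "A = 2 * H + 2 * K + 4 * (C1 * D \<eta>) + 2 * k2 + 1"
  have A: "0 < A" "2 * H + K < A" "2 * (H + K) \<le> A" "4 * (C1 * D \<eta>) \<le> A" "2 * k2 \<le> A"
    using H K k2 C1_nonneg D[of \<eta>] by (auto simp: A_def intro!: add_pos_nonneg add_nonneg_pos)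
  txt \<open>Inside a stopping cube the mean oscillation of \<open>f\<close> controls the part of the higher level set.\<close>
  have local: "emeasure M (msupp M \<inter> level (s + A) \<inter> qc x (d * L0)) \<le> ennreal (1/2) * ennreal (mq x L0)"
    if x: "x \<in> msupp M" and L0: "0 < L0" and dbl: "\<And>t. 1 \<le> t \<Longrightarrow> mq x (t * L0) \<le> D t * mq x L0"
      and large: "\<And>l. 2 * L0 \<le> l \<Longrightarrow> \<bar>c x l\<bar> \<le> s" for x L0 s
  proof -
    \<comment> \<open>The reference value is the mean over a cube that contains all cubes selected
      below.\<close>
    define v where "v = c x (2 * (d * L0))"
    have dL: "2 * L0 \<le> d * L0" "0 < d * L0" using d L0 by (auto intro!: mult_right_mono)
    have v: "\<bar>v\<bar> \<le> s" unfolding v_def using dL by (intro large) auto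
    let ?X = "msupp M \<inter> level (s + A) \<inter> qc x (d * L0)"
    have "\<exists>l>0. L y l \<le> d * L0 \<and> A - H - K \<le> \<bar>c y (L y l) - v\<bar>" if y: "y \<in> ?X" for y
    proof -
      obtain l where l: "0 < l" "s + A - C1 * (1 + C0) < \<bar>c y l\<bar>" using level_center[of y "s + A"] y by auto
      have ys: "y \<in> msupp M" using y by simp
      have cy: "s + A - H - K < \<bar>c y (L y l)\<bar>" using LK[OF ys l(1)] l(2) H0 by linarith
      \<comment> \<open>A larger stopping cube would have nearly the mean of the cube of the same
        side around x, which is at most s by \<open>large\<close>.\<close>
      have "L y l \<le> d * L0"
      proof (rule ccontr)
        assume n: "\<not> L y l \<le> d * L0"
        then have "y \<in> qc x (L y l)" using y qc_mono[of "d * L0" "L y l" x] by auto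
        then have "\<bar>c y (L y l) - c x (L y l)\<bar> \<le> H" using near ys x L[OF ys l(1)] l(1) by auto
        moreover have "\<bar>c x (L y l)\<bar> \<le> s" using n dL by (intro large) auto
        ultimately show False using cy A(2) by linarith
      qed
      moreover have "A - H - K \<le> \<bar>c y (L y l) - v\<bar>" using cy v by linarith
      ultimately show ?thesis using l by blast
    qed
    then obtain l where l: "\<And>y. y \<in> ?X \<Longrightarrow> 0 < l y" "\<And>y. y \<in> ?X \<Longrightarrow> L y (l y) \<le> d * L0"
      "\<And>y. y \<in> ?X \<Longrightarrow> A - H - K \<le> \<bar>c y (L y (l y)) - v\<bar>" by metis
    define r where "r y = L y (l y)" for y
    have r: "0 < r y" "r y \<le> d * L0" "A - H - K \<le> \<bar>c y (r y) - v\<bar>" if "y \<in> ?X" for y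
      using l[OF that] L[of y "l y"] that unfolding r_def by auto
    have rD: "mq y (t * r y) \<le> D t * mq y (r y)" if "y \<in> ?X" "1 \<le> t" for y t
      unfolding r_def using that l(1)[OF that(1)] by (intro LD) auto
    obtain I where I: "countable I" "I \<subseteq> ?X" "disjoint_family_on (\<lambda>y. qc y (r y)) I"
      "?X \<subseteq> (\<Union>y\<in>I. qc y (10 * real CARD('d) * r y))"
    proof (rule Vitali_cubes[of ?X r "d * L0"])
      show "0 < r y \<and> r y \<le> d * L0" if "y \<in> ?X" for y using r[OF that] by (intro conjI)
    qed (rule that)
    have "emeasure M ?X \<le> ennreal (D d * (4 / A)) * osc f x (2 * (d * L0)) v"
    proof (rule emeasure_le_disjoint_family[OF I(1)])
      show "?X \<subseteq> (\<Union>y\<in>I. qc y (d * r y))" using I(4) by (simp add: d_def)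
      show "disjoint_family_on (\<lambda>y. qc y (r y)) I" by (rule I(3))
      fix y assume "y \<in> I"
      then have y: "y \<in> ?X" using I by auto
      then show "qc y (r y) \<subseteq> qc x (2 * (d * L0))" using r(2)[OF y]
        by (intro qc_subset_add[of y x "d * L0"]) (blast, linarith)
      have ys: "y \<in> msupp M" using y by simp
      let ?J = "osc f y (r y) v"
      \<comment> \<open>On this cube the constant \<open>c y (r y)\<close> is far from v while f is
        close to it in mean, so f is far from v in mean.\<close>
      have "ennreal ((A - H - K) * mq y (r y)) \<le> (\<integral>\<^sup>+z\<in>qc y (r y). ennreal \<bar>c y (r y) - v\<bar> \<partial>M)"
        using r(3)[OF y] by (simp add: nn_integral_cmult_indicator emeasure_qc mult_right_mono ennreal_leI flip: ennreal_mult)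
      also have "\<dots> \<le> (\<integral>\<^sup>+z. ennreal \<bar>f z - v\<bar> * indicator (qc y (r y)) z + ennreal \<bar>f z - c y (r y)\<bar> * indicator (qc y (r y)) z \<partial>M)"
        by (intro nn_integral_mono) (auto simp: indicator_def simp flip: ennreal_plus intro!: ennreal_leI)
      also have "\<dots> = ?J + osc f y (r y) (c y (r y))"
        by (simp add: nn_integral_add)
      also have "\<dots> \<le> ?J + ennreal (C1 * D \<eta> * mq y (r y))"
      proof (intro add_left_mono order_trans[OF mean_osc[OF ys r(1)[OF y]]] ennreal_leI)
        show "C1 * mq y (\<eta> * r y) \<le> C1 * D \<eta> * mq y (r y)"
          using rD[OF y eta_ge] C1_nonneg by (simp add: mult_left_mono mult.assoc)
      qed
      finally have *: "ennreal ((A - H - K) * mq y (r y)) \<le> ?J + ennreal (C1 * D \<eta> * mq y (r y))" .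
      have J: "ennreal (A / 4 * mq y (r y)) \<le> ?J"
      proof (cases "?J = top")
        case False
        then obtain J where J: "?J = ennreal J" "0 \<le> J" by (cases ?J) auto
        have "(A - H - K) * mq y (r y) \<le> J + C1 * D \<eta> * mq y (r y)"
          using * J C1_nonneg D by (simp add: ennreal_le_iff flip: ennreal_plus)
        moreover have "A / 4 * mq y (r y) \<le> (A - H - K - C1 * D \<eta>) * mq y (r y)"
          using A by (intro mult_right_mono) auto
        ultimately show ?thesis using J by (simp add: algebra_simps ennreal_leI)
      qed simp
      have "emeasure M (qc y (d * r y)) \<le> ennreal (D d * (4 / A)) * ennreal (A / 4 * mq y (r y))"
        using rD[OF y, of d] d D A by (simp add: emeasure_qc ennreal_leI flip: ennreal_mult)
      also have "\<dots> \<le> ennreal (D d * (4 / A)) * ?J" using J by (intro mult_left_mono) auto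
      finally show "emeasure M (qc y (d * r y)) \<le> ennreal (D d * (4 / A)) * ?J" .
    qed auto
    also have "osc f x (2 * (d * L0)) v \<le> ennreal (C1 * D (2 * \<eta> * d) * mq x L0)"
    proof -
      have "1 * 1 \<le> \<eta> * d" using eta_ge d by (intro mult_mono) auto
      then have "1 \<le> 2 * \<eta> * d" by simp
      then have "mq x (\<eta> * (2 * (d * L0))) \<le> D (2 * \<eta> * d) * mq x L0"
        using dbl[of "2 * \<eta> * d"] by (simp add: mult_ac)
      then have "C1 * mq x (\<eta> * (2 * (d * L0))) \<le> C1 * D (2 * \<eta> * d) * mq x L0"
        using C1_nonneg by (simp add: mult_left_mono mult.assoc)
      then show ?thesis using mean_osc[OF x, of "2 * (d * L0)"] dL
        unfolding v_def by (auto intro: order_trans ennreal_leI)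
    qed
    also have "ennreal (D d * (4 / A)) * ennreal (C1 * D (2 * \<eta> * d) * mq x L0) = ennreal (k2 / A * mq x L0)"
      using D C1_nonneg A by (simp add: k2_def flip: ennreal_mult) 
    also have "\<dots> \<le> ennreal (1/2 * mq x L0)"
      using A by (intro ennreal_leI mult_right_mono) (auto simp: divide_le_eq)
    also have "\<dots> = ennreal (1/2) * ennreal (mq x L0)" by (subst ennreal_mult[symmetric]) auto
    finally show ?thesis by (simp add: mult_left_mono)
  qed
  show ?thesis
  proof (rule that[of "2 * A"])
    show "0 < 2 * A" using A by simp
    fix t \<epsilon> u s
    assume t: "C1 \<le> t" and e: "0 < \<epsilon>" and small: "\<And>x l. x \<in> msupp M \<Longrightarrow> 0 < l \<Longrightarrow> t < \<bar>c x l\<bar> \<Longrightarrow> l \<le> \<epsilon>"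
    let ?X = "msupp M \<inter> level (t + 2 * A) \<inter> qc u s"
    have "\<exists>l>0. t + A < \<bar>c x l\<bar> \<and> (\<forall>l'\<ge>2 * l. \<bar>c x l'\<bar> \<le> t + A)" if x: "x \<in> ?X" for x
    proof -
      \<comment> \<open>The sides whose mean exceeds the intermediate height are at most \<epsilon>.
        One above half of their supremum is nearly maximal: every side at least twice as large is
        outside the set.\<close>
      define S where "S = {l. 0 < l \<and> t + A < \<bar>c x l\<bar>}"
      have xs: "x \<in> msupp M" using x by simp
      obtain l where l: "0 < l" "t + 2 * A - C1 * (1 + C0) < \<bar>c x l\<bar>" using level_center[of x "t + 2 * A"] x by auto
      then have lS: "l \<in> S" using A H0 K H by (simp add: S_def)
      have "bdd_above S" using small[OF xs] A by (intro bdd_aboveI[of _ \<epsilon>]) (auto simp: S_def)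
      have "l \<le> Sup S" using lS \<open>bdd_above S\<close> by (rule cSup_upper)
      then have "Sup S / 2 < Sup S" using l by simp
      then obtain l1 where l1: "l1 \<in> S" "Sup S / 2 < l1" using less_cSupE lS by (metis empty_iff)
      have "\<bar>c x l'\<bar> \<le> t + A" if "2 * l1 \<le> l'" for l'
      proof (rule ccontr)
        assume "\<not> \<bar>c x l'\<bar> \<le> t + A"
        then have "l' \<in> S" using that l1 by (auto simp: S_def)
        then have "l' \<le> Sup S" using \<open>bdd_above S\<close> by (rule cSup_upper)
        then show False using that l1 by simp
      qed
      then show ?thesis using l1 by (auto simp: S_def)
    qed
    then obtain l where l: "\<And>x. x \<in> ?X \<Longrightarrow> 0 < l x" "\<And>x. x \<in> ?X \<Longrightarrow> t + A < \<bar>c x (l x)\<bar>"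
      "\<And>x l'. x \<in> ?X \<Longrightarrow> 2 * l x \<le> l' \<Longrightarrow> \<bar>c x l'\<bar> \<le> t + A" by metis
    define r where "r x = L x (l x)" for x
    have r: "l x \<le> r x" "0 < r x" "t + H < \<bar>c x (r x)\<bar>" if x: "x \<in> ?X" for x
    proof -
      have xs: "x \<in> msupp M" using x by simp
      show "l x \<le> r x" "0 < r x" using L[OF xs l(1)[OF x]] l(1)[OF x] by (auto simp: r_def)
      show "t + H < \<bar>c x (r x)\<bar>" using LK[OF xs l(1)[OF x]] l(2)[OF x] A K H unfolding r_def by linarith
    qed
    have re: "r x \<le> \<epsilon>" if x: "x \<in> ?X" for x using small[of x "r x"] r[OF x] x H by auto
    obtain I where I: "countable I" "I \<subseteq> ?X" "disjoint_family_on (\<lambda>y. qc y (r y)) I"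
      "?X \<subseteq> (\<Union>y\<in>I. qc y (10 * real CARD('d) * r y))"
    proof (rule Vitali_cubes[of ?X r \<epsilon>])
      show "0 < r y \<and> r y \<le> \<epsilon>" if "y \<in> ?X" for y using r[OF that] re[OF that] by (intro conjI)
    qed (rule that)
    have "emeasure M ?X \<le> ennreal (1/2) * (\<integral>\<^sup>+y\<in>level t \<inter> qc u (s + \<epsilon>). 1 \<partial>M)"
    proof (rule emeasure_le_disjoint_family[OF I(1)])
      show "?X \<subseteq> (\<Union>x\<in>I. msupp M \<inter> level (t + 2 * A) \<inter> qc x (d * r x))" using I(4) by (auto simp: d_def)
      show "disjoint_family_on (\<lambda>y. qc y (r y)) I" by (rule I(3))
      fix x assume "x \<in> I"
      then have x: "x \<in> ?X" using I by auto
      then have xs: "x \<in> msupp M" by simp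
      show "qc x (r x) \<subseteq> level t \<inter> qc u (s + \<epsilon>)"
      proof (intro Int_greatest subsetI)
        fix y assume "y \<in> qc x (r x)"
        \<comment> \<open>Doubling the side puts the closed cube into an open one and changes the
          mean by at most H, which the margin in the third fact of \<open>r\<close> covers.\<close>
        then have "y \<in> oqc x (2 * r x)" using qc_subset_oqc[of "r x" "2 * r x" x] r(2)[OF x] by auto
        moreover have "t < \<bar>c x (2 * r x)\<bar>" using double[OF xs r(2)[OF x]] r(3)[OF x] by linarith
        ultimately show "y \<in> level t" using xs r(2)[OF x] by (intro levelI[of x "2 * r x"]) auto
      next
        fix y assume "y \<in> qc x (r x)"
        then show "y \<in> qc u (s + \<epsilon>)" using qc_subset_add[of x u s "r x" "s + \<epsilon>"] x re[OF x] by auto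
      qed
      have "emeasure M (msupp M \<inter> level ((t + A) + A) \<inter> qc x (d * r x)) \<le> ennreal (1/2) * ennreal (mq x (r x))"
      proof (rule local[OF xs r(2)[OF x]])
        show "mq x (t * r x) \<le> D t * mq x (r x)" if "1 \<le> t" for t
          unfolding r_def using xs l(1)[OF x] that by (intro LD)
        show "\<bar>c x l'\<bar> \<le> t + A" if "2 * r x \<le> l'" for l' using l(3)[OF x, of l'] that r(1)[OF x] by simp
      qed
      then show "emeasure M (msupp M \<inter> level (t + 2 * A) \<inter> qc x (d * r x)) \<le> ennreal (1/2) * (\<integral>\<^sup>+y\<in>qc x (r x). 1 \<partial>M)"
        by (simp add: emeasure_qc add.assoc)
    qed auto
    then show "emeasure M ?X \<le> ennreal (1/2) * emeasure M (level t \<inter> qc u (s + \<epsilon>))" by simp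
  qed
qed

text \<open>Since means grow at most logarithmically, a mean above t0 + k A forces the side to be at
  most 2^(-k). The windows of the iterated decay steps therefore grow by a convergent geometric
  series and stay within side 3, so the growth bound gives one constant for all unit cubes.\<close>

theorem John_Nirenberg:
  obtains t0 A K where "0 \<le> t0" "0 < A" "0 \<le> K"
    "\<And>k u. emeasure M (msupp M \<inter> level (t0 + real k * A) \<inter> qc u 1) \<le> ennreal (K * (1/2) ^ k)"
proof -
  obtain A0 where A0: "0 < A0" "\<And>t \<epsilon> u s. C1 \<le> t \<Longrightarrow> 0 < \<epsilon> \<Longrightarrow>
      (\<And>x l. x \<in> msupp M \<Longrightarrow> 0 < l \<Longrightarrow> t < \<bar>c x l\<bar> \<Longrightarrow> l \<le> \<epsilon>) \<Longrightarrow>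
      emeasure M (msupp M \<inter> level (t + A0) \<inter> qc u s) \<le> ennreal (1/2) * emeasure M (level t \<inter> qc u (s + \<epsilon>))"
    using level_decay_step by blast
  \<comment> \<open>C1 C0 is the increment of \<open>mean_log_bound\<close> per scale; a step in
    height of at least this size halves the bound on the admissible sides.\<close>
  define A where "A = max A0 (C1 * C0)"
  have A: "A0 \<le> A" "C1 * C0 \<le> A" "0 < A" using A0 by (auto simp: A_def)
  define t0 where "t0 = C1 * (2 + 2 * C0)"
  have t0: "C1 \<le> t0" using C1_nonneg C0_pos mult_left_mono[of 1 "2 + 2 * C0" C1] by (simp add: t0_def)
  have small: "l \<le> (1/2) ^ k" if x: "x \<in> msupp M" and l: "0 < l" and ct: "t0 + real k * A < \<bar>c x l\<bar>" for x l k
  proof (rule ccontr)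
    assume "\<not> l \<le> (1/2) ^ k"
    then have "log 2 ((1/2) ^ k) \<le> log 2 l" using l by (subst log_le_cancel_iff) auto
    then have "- real k \<le> log 2 l" by (simp add: log_nat_power log_divide)
    then have "- int k \<le> sc l" unfolding sc_def by linarith
    then have "\<bar>c x l\<bar> \<le> C1 * (2 + C0 * (2 + real k))" using mean_log_bound x l by blast
    also have "\<dots> = t0 + real k * (C1 * C0)" by (simp add: t0_def algebra_simps)
    also have "\<dots> \<le> t0 + real k * A" using A by (intro add_left_mono mult_left_mono) auto
    finally show False using ct by simp
  qed
  have ind: "emeasure M (msupp M \<inter> level (t0 + real k * A) \<inter> qc u s)
      \<le> ennreal ((1/2) ^ k) * emeasure M (qc u (s + (\<Sum>j<k. (1/2) ^ j)))" for k u s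
  proof (induction k arbitrary: s)
    case 0
    show ?case by (auto intro: emeasure_mono)
  next
    case (Suc k)
    have t1: "C1 \<le> t0 + real k * A" using t0 A by (simp add: add_increasing2)
    have ae: "AE x in M. x \<in> msupp M" by (rule AE_msupp) simp
    have "emeasure M (msupp M \<inter> level (t0 + real (Suc k) * A) \<inter> qc u s)
        \<le> emeasure M (msupp M \<inter> level (t0 + real k * A + A0) \<inter> qc u s)"
      using A level_mono[of "t0 + real k * A + A0" "t0 + real (Suc k) * A"]
      by (intro emeasure_mono) (auto simp: algebra_simps)
    also have "\<dots> \<le> ennreal (1/2) * emeasure M (level (t0 + real k * A) \<inter> qc u (s + (1/2) ^ k))"
      using t1 small by (intro A0(2)) auto
    also have "\<dots> \<le> ennreal (1/2) * (ennreal ((1/2) ^ k) * emeasure M (qc u (s + (1/2) ^ k + (\<Sum>j<k. (1/2) ^ j))))"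
    proof (rule mult_left_mono)
      \<comment> \<open>The decay step ends with the full superlevel set, the induction hypothesis
        concerns its trace on the support; they agree up to a null set.\<close>
      have "emeasure M (level (t0 + real k * A) \<inter> qc u (s + (1/2) ^ k))
          = emeasure M (msupp M \<inter> level (t0 + real k * A) \<inter> qc u (s + (1/2) ^ k))"
        using ae by (intro emeasure_eq_AE) auto
      also have "\<dots> \<le> ennreal ((1/2) ^ k) * emeasure M (qc u (s + (1/2) ^ k + (\<Sum>j<k. (1/2) ^ j)))"
        by (rule Suc)
      finally show "emeasure M (level (t0 + real k * A) \<inter> qc u (s + (1/2) ^ k))
          \<le> ennreal ((1/2) ^ k) * emeasure M (qc u (s + (1/2) ^ k + (\<Sum>j<k. (1/2) ^ j)))" .
    qed simp
    also have "\<dots> = ennreal (1/2) * ennreal ((1/2) ^ k) * emeasure M (qc u (s + (\<Sum>j<Suc k. (1/2) ^ j)))"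
      by (simp only: mult.assoc sum.lessThan_Suc add_ac)
    also have "ennreal (1/2) * ennreal ((1/2) ^ k) = ennreal ((1/2) ^ Suc k)"
      by (subst ennreal_mult[symmetric]) auto
    finally show ?case .
  qed
  show ?thesis
  proof (rule that[of t0 A "C0 * (real CARD('d) * 3) ^ n"])
    show "0 \<le> t0" using t0 C1_nonneg by simp
    show "0 < A" by (rule A)
    show "0 \<le> C0 * (real CARD('d) * 3) ^ n" using C0_pos by simp
    fix k u
    have "(\<Sum>j<k. (1/2) ^ j) \<le> (\<Sum>j. (1/2::real) ^ j)"
      by (intro sum_le_suminf summable_geometric) auto
    also have "\<dots> = 2" by (subst suminf_geometric) auto
    finally have "emeasure M (qc u (1 + (\<Sum>j<k. (1/2) ^ j))) \<le> emeasure M (qc u 3)"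
      by (intro emeasure_mono qc_mono) auto
    also have "\<dots> \<le> ennreal (C0 * (real CARD('d) * 3) ^ n)" by (rule qc_growth) simp
    finally have "ennreal ((1/2) ^ k) * emeasure M (qc u (1 + (\<Sum>j<k. (1/2) ^ j)))
        \<le> ennreal ((1/2) ^ k) * ennreal (C0 * (real CARD('d) * 3) ^ n)" by (intro mult_left_mono) auto
    also have "\<dots> = ennreal (C0 * (real CARD('d) * 3) ^ n * (1/2) ^ k)"
      using C0_pos by (simp add: mult.commute flip: ennreal_mult)
    finally show "emeasure M (msupp M \<inter> level (t0 + real k * A) \<inter> qc u 1)
        \<le> ennreal (C0 * (real CARD('d) * 3) ^ n * (1/2) ^ k)"
      using ind[of k u 1] by (rule order_trans[rotated])
  qed
qed

end


section \<open>The Orlicz function\<close>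

lemma ln_exp1_ge1: "0 \<le> t \<Longrightarrow> 1 \<le> ln (exp 1 + t :: real)"
  by (simp add: ln_ge_iff add_pos_nonneg)

text \<open>Concavity of the logarithm on the segment from e to e + t, with value 1 at the left end,
  gives ln(e + s) / ln(e + t) \<ge> s / t.\<close>

lemma wp_mono:
  assumes "0 \<le> s" "s \<le> t" shows "wp s \<le> wp t"
proof (cases "t = 0")
  case False
  then have t: "0 < t" using assms by simp
  define q where "q = s / t"
  have q: "0 \<le> q" "q \<le> 1" "s = q * t" using assms t by (auto simp: q_def)
  have "(1 - q) * ln (exp 1) + q * ln (exp 1 + t) \<le> ln ((1 - q) * exp 1 + q * (exp 1 + t))"
    using concave_onD[OF ln_concave, of q "exp 1" "exp 1 + t"] q t by (simp add: add_pos_pos)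
  also have "(1 - q) * exp 1 + q * (exp 1 + t) = exp 1 + s" using q by (simp add: algebra_simps)
  finally have "q * ln (exp 1 + t) \<le> ln (exp 1 + s)" using q by simp
  then have "q * ln (exp 1 + t) * t \<le> ln (exp 1 + s) * t" using t by (intro mult_right_mono) auto
  then have "s * ln (exp 1 + t) \<le> t * ln (exp 1 + s)" unfolding q(3) by (simp add: mult_ac)
  moreover have "0 < ln (exp 1 + s)" "0 < ln (exp 1 + t)"
    using ln_exp1_ge1[of s] ln_exp1_ge1[of t] assms t by linarith+
  ultimately show ?thesis unfolding wp_def by (simp add: divide_le_eq pos_le_divide_eq mult.commute)
qed (use assms in simp)

text \<open>Either ln(e + st) is at least t and cancels it, or e + st < e^t and the exponential
  alone dominates.\<close>

lemma wp_Young: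
  assumes "0 \<le> s" "0 \<le> t" shows "wp (s * t) \<le> s + exp t"
proof (cases "t \<le> ln (exp 1 + s * t)")
  case True
  have "s * t \<le> s * ln (exp 1 + s * t)" using True assms by (intro mult_left_mono)
  then have "wp (s * t) \<le> s"
    using ln_exp1_ge1[of "s * t"] assms by (simp add: wp_def divide_le_eq)
  also have "s \<le> s + exp t" by simp
  finally show ?thesis .
next
  case False
  have st: "0 \<le> s * t" using assms by simp
  have "0 < exp 1 + s * t" using st by (simp add: add_pos_nonneg)
  moreover have "exp (ln (exp 1 + s * t)) < exp t" using False by simp
  ultimately have "exp 1 + s * t < exp t" by simp
  moreover have "(0::real) < exp 1" by simp
  ultimately have "s * t < exp t" by linarith
  moreover have "wp (s * t) \<le> s * t / 1"
    unfolding wp_def using st ln_exp1_ge1[OF st] by (intro divide_left_mono) auto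
  ultimately show ?thesis using assms by simp
qed

text \<open>A substitute for homogeneity: dividing the argument by L lowers the logarithm by at most
  the factor 1 + ln L \<le> 2 sqrt L, so a power of L is still gained.\<close>

lemma wp_shrink:
  assumes "1 \<le> L" "0 \<le> u" shows "wp (u / L) \<le> 2 / sqrt L * wp u"
proof -
  have L: "0 < L" using assms by simp
  have uL: "0 \<le> u / L" using assms by simp
  have ge: "1 \<le> ln (exp 1 + u / L)" "1 \<le> ln (exp 1 + u)" using ln_exp1_ge1 assms by auto
  have "exp 1 + u \<le> L * (exp 1 + u / L)" using assms by (simp add: distrib_left)
  then have "ln (exp 1 + u) \<le> ln (L * (exp 1 + u / L))" using assms by (intro ln_mono) (auto simp: add_pos_nonneg)
  also have "\<dots> = ln L + ln (exp 1 + u / L)"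
    using L uL add_pos_nonneg[of "exp 1" "u / L"] by (subst ln_mult) auto
  also have "\<dots> \<le> ln L * ln (exp 1 + u / L) + ln (exp 1 + u / L)"
    using mult_left_mono[OF ge(1), of "ln L"] assms by simp
  also have "\<dots> = (1 + ln L) * ln (exp 1 + u / L)" by (simp add: algebra_simps)
  also have "\<dots> \<le> 2 * sqrt L * ln (exp 1 + u / L)"
  proof (rule mult_right_mono)
    have "ln (sqrt L) \<le> sqrt L - 1" using L by (intro ln_le_minus_one) auto
    moreover have "ln (sqrt L) = ln L / 2" using L by (simp add: ln_sqrt)
    ultimately show "1 + ln L \<le> 2 * sqrt L" by simp
  qed (use ge in simp)
  finally have le: "ln (exp 1 + u) \<le> 2 * sqrt L * ln (exp 1 + u / L)" .
  have sq: "0 < sqrt L" "sqrt L * sqrt L = L" using L by auto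
  define q where "q = sqrt L"
  define X where "X = ln (exp 1 + u)"
  define Y where "Y = ln (exp 1 + u / L)"
  have q: "0 < q" "L = q * q" using sq by (simp_all add: q_def)
  have XY: "0 < X" "0 < Y" "X \<le> 2 * q * Y" using ge le by (simp_all add: X_def Y_def q_def)
  have "u / L / Y = u * X / (q * q * Y * X)" using XY q by simp
  also have "\<dots> \<le> u * (2 * q * Y) / (q * q * Y * X)"
    using XY q assms by (intro divide_right_mono mult_left_mono) auto
  also have "\<dots> = 2 / q * (u / X)" using XY q by simp
  finally show ?thesis by (simp add: wp_def X_def Y_def q_def)
qed

text \<open>The closed cubes overlap on their faces. In each coordinate an integer within 1/2 of
  that of y is its floor or the next integer, which leaves 2^d choices.\<close>

lemma card_integer_cubes_le:
  obtains B :: nat where "\<And>y F. finite F \<Longrightarrow> F \<subseteq> {j :: real^'d. \<forall>i. j $ i \<in> \<int>} \<Longrightarrow> card {j \<in> F. y \<in> qc j 1} \<le> B"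
proof
  define P where "P = PiE (UNIV::'d set) (\<lambda>_. {0, 1::int})"
  have finP: "finite P" unfolding P_def by (intro finite_PiE) auto
  fix y :: "real^'d" and F assume F: "finite F" "F \<subseteq> {j :: real^'d. \<forall>i. j $ i \<in> \<int>}"
  define g where "g j = (\<lambda>i. \<lfloor>j $ i\<rfloor> - \<lfloor>y $ i\<rfloor>)" for j :: "real^'d"
  show "card {j \<in> F. y \<in> qc j 1} \<le> card P"
  proof (rule card_inj_on_le[of g])
    show "inj_on g {j \<in> F. y \<in> qc j 1}"
    proof (rule inj_onI)
      fix j k assume j: "j \<in> {j \<in> F. y \<in> qc j 1}" and k: "k \<in> {j \<in> F. y \<in> qc j 1}" and e: "g j = g k"
      have "j $ i = k $ i" for i
      proof -
        have "\<lfloor>j $ i\<rfloor> = \<lfloor>k $ i\<rfloor>" using fun_cong[OF e, of i] by (simp add: g_def)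
        moreover have "j $ i \<in> \<int>" "k $ i \<in> \<int>" using j k F by auto
        ultimately show ?thesis by (metis floor_of_int Ints_cases)
      qed
      then show "j = k" by (simp add: vec_eq_iff)
    qed
    show "g ` {j \<in> F. y \<in> qc j 1} \<subseteq> P"
    proof
      fix h assume "h \<in> g ` {j \<in> F. y \<in> qc j 1}"
      then obtain j where j: "j \<in> F" "y \<in> qc j 1" "h = g j" by auto
      have "h i \<in> {0, 1}" for i
      proof -
        have "j $ i \<in> \<int>" using j F by auto
        then obtain m where m: "j $ i = of_int m" by (rule Ints_cases)
        have "\<bar>y $ i - j $ i\<bar> \<le> 1/2" using j by (simp add: qc_def)
        then have "m = \<lfloor>y $ i\<rfloor> \<or> m = \<lfloor>y $ i\<rfloor> + 1" unfolding m by linarith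
        then show ?thesis unfolding j(3) g_def m by auto
      qed
      then show "h \<in> P" by (auto simp: P_def)
    qed
  qed (rule finP)
qed

context growth_space
begin

lemma wp_norm_le:
  assumes "0 < k" "(\<integral>\<^sup>+y\<in>E. wp_ext (g y / ennreal k) \<partial>M) \<le> 1"
  shows "wp_norm M E g \<le> ennreal k"
  unfolding wp_norm_def using assms by (intro Inf_lower) auto

text \<open>Exponential integrability of \<open>J\<close> is dual to the weight \<open>log (e + t)\<close> in \<open>\<wp>\<close>.\<close>

lemma exp_weight_in_L_wp_star:
  fixes E :: "nat \<Rightarrow> (real^'d) set" and G F :: "real^'d \<Rightarrow> ennreal"
  assumes E [measurable]: "\<And>k. E k \<in> sets M" and dec: "\<And>k. E (Suc k) \<subseteq> E k" and K: "0 \<le> K"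
    and decay: "\<And>k u. emeasure M (E k \<inter> qc u 1) \<le> ennreal (K * (1/2) ^ k)"
    and G [measurable]: "G \<in> borel_measurable M" and Gfin: "(\<integral>\<^sup>+y. G y \<partial>M) < \<infinity>"
    and F [measurable]: "F \<in> borel_measurable M" and a: "0 < a"
    and le: "AE y in M. F y \<le> ennreal a * (1 + (\<Sum>k. indicator (E k) y)) * G y"
  shows "F \<in> L_wp_star M"
proof -
  define J where "J y = (\<Sum>k. indicator (E k) y :: ennreal)" for y
  \<comment> \<open>Any base between 1 and 2 would serve: the growth (3/2)^k is beaten by the decay
    2^(-k), leaving (3/4)^k.\<close>
  define \<tau> where "\<tau> = ln (3/2 :: real)"
  have tau: "0 < \<tau>" by (simp add: \<tau>_def)
  \<comment> \<open>A measurable majorant of exp(\<tau> (1 + J)). As the sets are nested, J = m + 1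
    means that the point lies in exactly E 0, ..., E m, and the term with index m already reaches
    (3/2)^(m+1). The outer 3/2 accounts for the 1 in 1 + J, the summand 1 for J = 0.\<close>
  define P where "P y = ennreal (3/2) * (1 + (\<Sum>k. ennreal ((3/2) ^ Suc k) * indicator (E k) y))" for y
  have P_meas [measurable]: "P \<in> borel_measurable M" unfolding P_def by measurable
  have E_mono: "E j \<subseteq> E i" if "i \<le> j" for i j using lift_Suc_antimono_le[of E, OF dec that] .
  have expJ: "ennreal (exp (\<tau> * (1 + j))) \<le> P y" if j: "J y = ennreal j" "0 \<le> j" for y j
  proof (cases "y \<in> E 0")
    case False
    then have "y \<notin> E k" for k using E_mono[of 0 k] by auto
    then have "J y = 0" by (simp add: J_def)
    then have "j = 0" using j by simp
    then have "ennreal (exp (\<tau> * (1 + j))) = ennreal (3/2) * 1" by (simp add: \<tau>_def)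
    also have "\<dots> \<le> P y" unfolding P_def by (intro mult_left_mono) auto
    finally show ?thesis .
  next
    case True
    define S where "S = {k. y \<in> E k}"
    have S0: "0 \<in> S" using True by (simp add: S_def)
    have down: "i \<in> S" if "k \<in> S" "i \<le> k" for i k using that E_mono by (auto simp: S_def)
    have ge: "ennreal (real N) \<le> J y" if "{..<N} \<subseteq> S" for N
    proof -
      have "ennreal (real N) = (\<Sum>k<N. indicator (E k) y)"
        using that by (simp add: S_def subset_iff ennreal_of_nat_eq_real_of_nat)
      also have "\<dots> \<le> J y" unfolding J_def by (intro sum_le_suminf) auto
      finally show ?thesis .
    qed
    have "k < nat \<lceil>j\<rceil> + 1" if "k \<in> S" for k
    proof -
      have "{..<Suc k} \<subseteq> S" using down[OF that] by auto
      then have "real (Suc k) \<le> j" using ge[of "Suc k"] j by (simp add: ennreal_le_iff del: of_nat_Suc)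
      then show ?thesis by linarith
    qed
    then have finS: "finite S" by (meson finite_nat_set_iff_bounded)
    define m where "m = Max S"
    have mS: "m \<in> S" unfolding m_def using finS S0 by (intro Max_in) auto
    have Seq: "S = {..m}" using down[OF mS] finS by (auto simp: m_def)
    have "J y = (\<Sum>k\<in>{..m}. indicator (E k) y)"
      unfolding J_def using Seq by (intro suminf_finite) (auto simp: S_def indicator_def)
    also have "\<dots> = (\<Sum>k\<in>{..m}. 1)" using Seq by (intro sum.cong) (auto simp: S_def set_eq_iff indicator_def)
    also have "\<dots> = ennreal (real (Suc m))" by (simp add: ennreal_of_nat_eq_real_of_nat del: of_nat_Suc)
    finally have jm: "j = real (Suc m)" using j by (simp del: of_nat_Suc)
    have "exp (\<tau> * (1 + j)) = (3/2) * (3/2) ^ Suc m"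
    proof -
      have "exp (\<tau> * (1 + j)) = exp \<tau> * exp (real (Suc m) * \<tau>)" by (simp add: jm distrib_left exp_add mult.commute del: of_nat_Suc)
      also have "exp (real (Suc m) * \<tau>) = exp \<tau> ^ Suc m" by (rule exp_of_nat_mult)
      finally show ?thesis by (simp add: \<tau>_def)
    qed
    then have "ennreal (exp (\<tau> * (1 + j))) = ennreal (3/2) * ennreal ((3/2) ^ Suc m)" by (subst ennreal_mult[symmetric]) auto
    also have "ennreal ((3/2) ^ Suc m) \<le> (\<Sum>k. ennreal ((3/2) ^ Suc k) * indicator (E k) y)"
    proof -
      have "ennreal ((3/2) ^ Suc m) = (\<Sum>k\<in>{m}. ennreal ((3/2) ^ Suc k) * indicator (E k) y)"
        using mS by (simp add: S_def)
      also have "\<dots> \<le> (\<Sum>k. ennreal ((3/2) ^ Suc k) * indicator (E k) y)" by (intro sum_le_suminf) auto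
      finally show ?thesis .
    qed
    also have "\<dots> \<le> 1 + (\<Sum>k. ennreal ((3/2) ^ Suc k) * indicator (E k) y)" by simp
    finally show ?thesis unfolding P_def by (simp add: mult_left_mono)
  qed
  define PP where "PP = (3/2) * (C0 * real CARD('d) ^ n + 6 * K)"
  have PP: "0 \<le> PP" using C0_pos K by (simp add: PP_def)
  have intP: "(\<integral>\<^sup>+y\<in>qc u 1. P y \<partial>M) \<le> ennreal PP" for u
  proof -
    have "(\<integral>\<^sup>+y\<in>qc u 1. P y \<partial>M) = (\<integral>\<^sup>+y. ennreal (3/2) * (indicator (qc u 1) y + (\<Sum>k. ennreal ((3/2) ^ Suc k) * indicator (E k \<inter> qc u 1) y)) \<partial>M)"
      unfolding P_def by (intro nn_integral_cong) (auto simp: indicator_def)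
    also have "\<dots> = ennreal (3/2) * (emeasure M (qc u 1) + (\<Sum>k. ennreal ((3/2) ^ Suc k) * emeasure M (E k \<inter> qc u 1)))"
      by (simp add: nn_integral_cmult nn_integral_add nn_integral_suminf nn_integral_cmult_indicator del: power_Suc)
    also have "\<dots> \<le> ennreal (3/2) * (ennreal (C0 * real CARD('d) ^ n) + (\<Sum>k. ennreal (3/2 * K * (3/4) ^ k)))"
    proof (intro mult_left_mono add_mono suminf_le summableI)
      show "emeasure M (qc u 1) \<le> ennreal (C0 * real CARD('d) ^ n)" using qc_growth[of 1 u] by simp
      fix k
      have "ennreal ((3/2) ^ Suc k) * emeasure M (E k \<inter> qc u 1) \<le> ennreal ((3/2) ^ Suc k) * ennreal (K * (1/2) ^ k)"
        using decay by (intro mult_left_mono) auto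
      also have "\<dots> = ennreal (3/2 * K * (3/4) ^ k)"
      proof -
        have "(3/2::real) ^ k * (1/2) ^ k = (3/4) ^ k" by (simp flip: power_mult_distrib)
        then have "(3/2) ^ Suc k * (K * (1/2) ^ k) = 3/2 * K * (3/4) ^ k" by (simp add: mult_ac)
        then show ?thesis using K by (subst ennreal_mult[symmetric]) auto
      qed
      finally show "ennreal ((3/2) ^ Suc k) * emeasure M (E k \<inter> qc u 1) \<le> ennreal (3/2 * K * (3/4) ^ k)" .
    qed simp
    also have "(\<Sum>k. ennreal (3/2 * K * (3/4) ^ k)) = ennreal (\<Sum>k. 3/2 * K * (3/4) ^ k)"
      using K by (intro suminf_ennreal2 summable_mult summable_geometric) auto
    also have "(\<Sum>k. 3/2 * K * (3/4) ^ k) = 6 * K"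
      by (subst suminf_mult) (auto simp: suminf_geometric summable_geometric)
    also have "ennreal (3/2) * (ennreal (C0 * real CARD('d) ^ n) + ennreal (6 * K)) = ennreal PP"
      unfolding PP_def using C0_pos K by (simp del: ennreal_half add: ennreal_mult[symmetric] ennreal_plus[symmetric] del: ennreal_plus)
    finally show ?thesis .
  qed
  \<comment> \<open>Chosen so that the gain 2 / sqrt L from \<open>wp_shrink\<close> cancels 1 + PP
    exactly and brings the modular down to 1.\<close>
  define L where "L = (2 * (1 + PP))\<^sup>2"
  have L: "1 \<le> L" "2 / sqrt L * (1 + PP) = 1"
    using PP by (auto simp: L_def real_sqrt_power field_simps one_le_power)
  \<comment> \<open>Absorbs a and turns 1 + J into the exponent \<tau> (1 + J) to which
    \<open>wp_Young\<close> is applied.\<close>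
  define B where "B = a / \<tau>"
  have B: "0 < B" using a tau by (simp add: B_def)
  have point: "wp_ext (F y / ennreal (k * B * L)) \<le> ennreal (2 / sqrt L) * (G y / ennreal k + P y)"
    if k: "0 < k" and Fy: "F y \<le> ennreal a * (1 + J y) * G y" for k y
  proof (cases "G y = \<infinity> \<or> J y = \<infinity>")
    case True
    have "P y = \<infinity>" if "J y = \<infinity>"
    proof -
      have "J y \<le> (\<Sum>k. ennreal ((3/2) ^ Suc k) * indicator (E k) y)"
        unfolding J_def
      proof (intro suminf_le summableI)
        fix k
        have "ennreal 1 \<le> ennreal ((3/2) ^ Suc k)" by (intro ennreal_leI one_le_power) auto
        then show "indicator (E k) y \<le> ennreal ((3/2) ^ Suc k) * indicator (E k) y" by (auto simp: indicator_def simp del: power_Suc)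
      qed
      then have "(\<Sum>k. ennreal ((3/2) ^ Suc k) * indicator (E k) y) = \<infinity>" using that by (simp add: top_unique)
      then show ?thesis unfolding P_def by (simp add: ennreal_mult_top)
    qed
    moreover have "G y / ennreal k = \<infinity>" if "G y = \<infinity>" using that k by (simp add: ennreal_top_divide)
    ultimately have "G y / ennreal k + P y = \<infinity>" using True by auto
    moreover have "ennreal (2 / sqrt L) \<noteq> 0" using L(1) PP by (simp add: ennreal_eq_0_iff)
    ultimately have "ennreal (2 / sqrt L) * (G y / ennreal k + P y) = top"
      using ennreal_mult_eq_top_iff by (metis infinity_ennreal_def)
    then show ?thesis by simp
  next
    case False
    then obtain g j where g: "G y = ennreal g" "0 \<le> g" and j: "J y = ennreal j" "0 \<le> j"
      by (metis ennreal_cases infinity_ennreal_def)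
    have "ennreal a * (1 + J y) * G y = ennreal (a * (1 + j) * g)"
      using a g j by (simp add: ennreal_mult ennreal_plus)
    then have "F y \<le> ennreal (a * (1 + j) * g)" using Fy by simp
    then obtain v where v: "F y = ennreal v" "0 \<le> v" "v \<le> a * (1 + j) * g"
      using a g j by (cases "F y") (auto simp: ennreal_le_iff top_unique)
    have pos: "0 < k * B * L" using k B L by (intro mult_pos_pos) auto
    have "v / (k * B * L) \<le> a * (1 + j) * g / (k * B * L)" using v(3) pos by (intro divide_right_mono) auto
    also have "\<dots> = g / k * (\<tau> * (1 + j)) / L" using a tau k L by (simp add: B_def field_simps)
    finally have "wp (v / (k * B * L)) \<le> wp (g / k * (\<tau> * (1 + j)) / L)" using v pos by (intro wp_mono) auto
    also have "\<dots> \<le> 2 / sqrt L * wp (g / k * (\<tau> * (1 + j)))" using L PP g j k tau by (intro wp_shrink) auto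
    also have "\<dots> \<le> 2 / sqrt L * (g / k + exp (\<tau> * (1 + j)))"
      using L PP g j k tau by (intro mult_left_mono wp_Young) auto
    finally have w: "wp (v / (k * B * L)) \<le> 2 / sqrt L * (g / k + exp (\<tau> * (1 + j)))" .
    have "wp_ext (F y / ennreal (k * B * L)) = ennreal (wp (v / (k * B * L)))"
      unfolding v(1) using v(2) pos by (simp add: wp_ext_def divide_ennreal)
    also have "\<dots> \<le> ennreal (2 / sqrt L * (g / k + exp (\<tau> * (1 + j))))" using w by (rule ennreal_leI)
    also have "\<dots> = ennreal (2 / sqrt L) * (G y / ennreal k + ennreal (exp (\<tau> * (1 + j))))"
    proof -
      have "G y / ennreal k = ennreal (g / k)" using g k by (simp add: divide_ennreal)
      moreover have "ennreal (q * (s + t)) = ennreal q * (ennreal s + ennreal t)" if "0 \<le> q" "0 \<le> s" "0 \<le> t" for q s t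
        using that by (simp add: ennreal_mult)
      moreover have "0 \<le> 2 / sqrt L" "0 \<le> g / k" using L(1) g k by auto
      ultimately show ?thesis by (simp only: exp_ge_zero)
    qed
    also have "\<dots> \<le> ennreal (2 / sqrt L) * (G y / ennreal k + P y)"
      using expJ[OF j] by (intro mult_left_mono add_left_mono) auto
    finally show ?thesis .
  qed
  have norm_le: "wp_norm M (qc u 1) F \<le> ennreal (B * L) * (\<integral>\<^sup>+y\<in>qc u 1. G y \<partial>M)" for u
  proof -
    have "(\<integral>\<^sup>+y\<in>qc u 1. G y \<partial>M) \<le> (\<integral>\<^sup>+y. G y \<partial>M)" by (intro nn_integral_mono) (auto simp: indicator_def)
    then have "(\<integral>\<^sup>+y\<in>qc u 1. G y \<partial>M) < \<infinity>" using Gfin by (rule order_le_less_trans)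
    then obtain i where i: "(\<integral>\<^sup>+y\<in>qc u 1. G y \<partial>M) = ennreal i" "0 \<le> i"
      by (cases "\<integral>\<^sup>+y\<in>qc u 1. G y \<partial>M") auto
    \<comment> \<open>The integral i may be zero, while the Luxemburg norm needs a positive
      parameter; the bound with k = i is reached afterwards by a limit.\<close>
    have norm_k: "wp_norm M (qc u 1) F \<le> ennreal (k * B * L)" if k: "0 < k" "i \<le> k" for k
    proof (rule wp_norm_le)
      show "0 < k * B * L" using k B L by (intro mult_pos_pos) auto
      have "(\<integral>\<^sup>+y\<in>qc u 1. wp_ext (F y / ennreal (k * B * L)) \<partial>M)
          \<le> (\<integral>\<^sup>+y. ennreal (2 / sqrt L) * (G y * indicator (qc u 1) y / ennreal k + P y * indicator (qc u 1) y) \<partial>M)"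
      proof (rule nn_integral_mono_AE)
        show "AE y in M. wp_ext (F y / ennreal (k * B * L)) * indicator (qc u 1) y
          \<le> ennreal (2 / sqrt L) * (G y * indicator (qc u 1) y / ennreal k + P y * indicator (qc u 1) y)"
          using le
        proof eventually_elim
          fix y assume "F y \<le> ennreal a * (1 + (\<Sum>k. indicator (E k) y)) * G y"
          then have "F y \<le> ennreal a * (1 + J y) * G y" by (simp add: J_def)
          from point[OF k(1) this] show "wp_ext (F y / ennreal (k * B * L)) * indicator (qc u 1) y
            \<le> ennreal (2 / sqrt L) * (G y * indicator (qc u 1) y / ennreal k + P y * indicator (qc u 1) y)"
            by (cases "y \<in> qc u 1") auto
        qed
      qed
      also have "\<dots> = ennreal (2 / sqrt L) * ((\<integral>\<^sup>+y\<in>qc u 1. G y \<partial>M) / ennreal k + (\<integral>\<^sup>+y\<in>qc u 1. P y \<partial>M))"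
        by (simp add: nn_integral_cmult nn_integral_add nn_integral_divide)
      also have "\<dots> \<le> ennreal (2 / sqrt L) * (1 + ennreal PP)"
      proof (intro mult_left_mono add_mono intP)
        have "i / k \<le> 1" using k i(2) by simp
        then show "(\<integral>\<^sup>+y\<in>qc u 1. G y \<partial>M) / ennreal k \<le> 1"
          unfolding i(1) using k i by (simp add: divide_ennreal)
      qed simp
      also have "1 + ennreal PP = ennreal (1 + PP)" using PP by simp
      also have "ennreal (2 / sqrt L) * ennreal (1 + PP) = ennreal (2 / sqrt L * (1 + PP))" using PP L by (subst ennreal_mult) auto
      also have "\<dots> = 1" unfolding L(2) by simp
      finally show "(\<integral>\<^sup>+y\<in>qc u 1. wp_ext (F y / ennreal (k * B * L)) \<partial>M) \<le> 1" .
    qed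
    have BL: "0 < B * L" using B L by simp
    have "wp_norm M (qc u 1) F \<le> ennreal (B * L * i)"
    proof (rule ennreal_le_epsilon)
      fix e :: real assume e: "0 < e"
      have "wp_norm M (qc u 1) F \<le> ennreal ((i + e / (B * L)) * B * L)"
        using i(2) e BL by (intro norm_k) (auto simp: add_nonneg_pos)
      also have "(i + e / (B * L)) * B * L = B * L * i + e" using B L(1) by (simp add: field_simps)
      finally show "wp_norm M (qc u 1) F \<le> ennreal (B * L * i) + ennreal e" using e i BL by simp
    qed
    also have "\<dots> = ennreal (B * L) * (\<integral>\<^sup>+y\<in>qc u 1. G y \<partial>M)" unfolding i(1) using i(2) BL by (intro ennreal_mult) auto
    finally show ?thesis .
  qed
  obtain N :: nat where N: "\<And>y F. finite F \<Longrightarrow> F \<subseteq> {j :: real^'d. \<forall>i. j $ i \<in> \<int>} \<Longrightarrow> card {j \<in> F. y \<in> qc j 1} \<le> N"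
    by (rule card_integer_cubes_le) blast
  \<comment> \<open>As no point lies in more than N of the unit cubes, summing the local integrals
    of G costs only a factor N.\<close>
  have "wp_star_norm M F \<le> ennreal (B * L) * (of_nat N * (\<integral>\<^sup>+y. G y \<partial>M))"
    unfolding wp_star_norm_def
  proof (subst nonneg_infsum_complete, simp, intro SUP_least, clarify)
    fix T assume T: "finite T" "T \<subseteq> {j :: real^'d. \<forall>i. j $ i \<in> \<int>}"
    have "(\<Sum>j\<in>T. wp_norm M (cube_set (Cube j 1)) F) \<le> (\<Sum>j\<in>T. ennreal (B * L) * (\<integral>\<^sup>+y\<in>qc j 1. G y \<partial>M))"
      by (intro sum_mono) (simp add: norm_le)
    also have "\<dots> = ennreal (B * L) * (\<integral>\<^sup>+y. (\<Sum>j\<in>T. G y * indicator (qc j 1) y) \<partial>M)"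
      by (subst nn_integral_sum) (auto simp: sum_distrib_left)
    also have "(\<integral>\<^sup>+y. (\<Sum>j\<in>T. G y * indicator (qc j 1) y) \<partial>M) \<le> (\<integral>\<^sup>+y. of_nat N * G y \<partial>M)"
    proof (rule nn_integral_mono)
      fix y
      have "(\<Sum>j\<in>T. G y * indicator (qc j 1) y) = G y * (\<Sum>j\<in>T. if y \<in> qc j 1 then 1 else 0)"
        unfolding sum_distrib_left by (intro sum.cong) (auto simp: indicator_def)
      also have "(\<Sum>j\<in>T. if y \<in> qc j 1 then 1 else 0 :: ennreal) = of_nat (card {j \<in> T. y \<in> qc j 1})"
        using T(1) by (simp add: sum.If_cases Int_def)
      also have "G y * of_nat (card {j \<in> T. y \<in> qc j 1}) \<le> G y * of_nat N"
        using N[OF T] by (intro mult_left_mono) auto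
      finally show "(\<Sum>j\<in>T. G y * indicator (qc j 1) y) \<le> of_nat N * G y" by (simp add: mult.commute)
    qed
    also have "\<dots> = of_nat N * (\<integral>\<^sup>+y. G y \<partial>M)" by (simp add: nn_integral_cmult)
    finally show "(\<Sum>j\<in>T. wp_norm M (cube_set (Cube j 1)) F) \<le> ennreal (B * L) * (of_nat N * (\<integral>\<^sup>+y. G y \<partial>M))"
      by (simp add: mult_left_mono)
  qed
  also have "\<dots> < \<infinity>" using Gfin by (simp add: ennreal_mult_less_top of_nat_less_top)
  finally show ?thesis unfolding L_wp_star_def by simp
qed

end


section \<open>Majorants of the maximal function of an atom\<close>

lemma ennreal_abs_sums_le:
  assumes "u sums s" shows "ennreal \<bar>s\<bar> \<le> (\<Sum>i. ennreal \<bar>u i\<bar>)"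
proof (rule LIMSEQ_le_const2)
  show "(\<lambda>n. ennreal \<bar>\<Sum>i<n. u i\<bar>) \<longlonglongrightarrow> ennreal \<bar>s\<bar>"
    using assms unfolding sums_def by (intro tendsto_ennrealI tendsto_rabs)
  have "ennreal \<bar>\<Sum>i<n. u i\<bar> \<le> (\<Sum>i. ennreal \<bar>u i\<bar>)" for n
  proof -
    have "ennreal \<bar>\<Sum>i<n. u i\<bar> \<le> ennreal (\<Sum>i<n. \<bar>u i\<bar>)" by (intro ennreal_leI sum_abs)
    also have "\<dots> = (\<Sum>i<n. ennreal \<bar>u i\<bar>)" by (simp add: sum_ennreal)
    also have "\<dots> \<le> (\<Sum>i. ennreal \<bar>u i\<bar>)" by (intro sum_le_suminf) auto
    finally show ?thesis .
  qed
  then show "\<exists>N. \<forall>n\<ge>N. ennreal \<bar>\<Sum>i<n. u i\<bar> \<le> (\<Sum>i. ennreal \<bar>u i\<bar>)" by blast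
qed

lemma ennreal_le_suminf: "f k \<le> (\<Sum>i. f i)" for f :: "nat \<Rightarrow> ennreal"
  using sum_le_suminf[of f "{k}"] by simp

lemma C1_continuous: "\<phi> \<in> C1 \<Longrightarrow> continuous_on UNIV \<phi>"
  by (auto simp: C1_def continuous_on_eq_continuous_at differentiable_imp_continuous_within)

lemma frechet_derivative_eq_grad:
  assumes "\<phi> differentiable (at w)"
  shows "frechet_derivative \<phi> (at w) h = grad \<phi> w \<bullet> h"
proof -
  have lin: "linear (frechet_derivative \<phi> (at w))" using assms by (rule linear_frechet_derivative)
  have "frechet_derivative \<phi> (at w) h = frechet_derivative \<phi> (at w) (\<Sum>i\<in>UNIV. h $ i *\<^sub>R axis i 1)"
    using basis_expansion[of h] by (simp add: scalar_mult_eq_scaleR)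
  also have "\<dots> = (\<Sum>i\<in>UNIV. h $ i * frechet_derivative \<phi> (at w) (axis i 1))"
    using lin by (simp add: linear_sum linear_cmul)
  also have "\<dots> = grad \<phi> w \<bullet> h" by (simp add: grad_def partial_def inner_vec_def mult.commute)
  finally show ?thesis .
qed

lemma grad_bound_imp_Lipschitz:
  assumes "convex S" and d: "\<And>w. \<phi> differentiable (at w)" and B: "\<And>w. w \<in> S \<Longrightarrow> norm (grad \<phi> w) \<le> B"
    and "y \<in> S" "z \<in> S"
  shows "\<bar>\<phi> y - \<phi> z\<bar> \<le> B * norm (y - z)"
proof -
  have "norm (\<phi> y - \<phi> z) \<le> B * norm (y - z)"
  proof (rule differentiable_bound[OF assms(1)])
    fix w assume w: "w \<in> S"
    show "(\<phi> has_derivative (frechet_derivative \<phi> (at w))) (at w within S)"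
      using d[of w] by (auto simp: frechet_derivative_works has_derivative_at_withinI)
    show "onorm (frechet_derivative \<phi> (at w)) \<le> B"
    proof (rule onorm_le)
      fix h
      have "norm (frechet_derivative \<phi> (at w) h) = \<bar>grad \<phi> w \<bullet> h\<bar>"
        using frechet_derivative_eq_grad[OF d] by simp
      also have "\<dots> \<le> norm (grad \<phi> w) * norm h" by (rule Cauchy_Schwarz_ineq2)
      also have "\<dots> \<le> B * norm h" using B[OF w] by (intro mult_right_mono) auto
      finally show "norm (frechet_derivative \<phi> (at w) h) \<le> B * norm h" .
    qed
  qed (use assms in auto)
  then show ?thesis by simp
qed

lemma shell_exists:
  fixes x z :: "real^'d"
  assumes "0 < l" "x \<notin> qc z (2 ^ j * l)"
  obtains k where "j \<le> k" "x \<notin> qc z (2 ^ k * l)" "x \<in> qc z (2 ^ Suc k * l)"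
proof -
  obtain N where N: "2 * norm (x - z) / l < 2 ^ N" using real_arch_pow[of 2] by auto
  then have "2 * norm (x - z) \<le> 2 ^ N * l" using assms by (simp add: divide_less_eq)
  then have "x \<in> qc z (2 ^ N * l)"
  proof -
    have "x \<in> cball z (norm (x - z))" by (simp add: dist_norm norm_minus_commute)
    also note cball_subset_qc[of z "norm (x - z)"]
    also note qc_mono[OF \<open>2 * norm (x - z) \<le> 2 ^ N * l\<close>, of z]
    finally show ?thesis .
  qed
  define m where "m = (LEAST k. x \<in> qc z (2 ^ k * l))"
  have m: "x \<in> qc z (2 ^ m * l)" unfolding m_def by (rule LeastI) fact
  have "\<not> m \<le> j"
  proof
    assume "m \<le> j"
    then have "qc z (2 ^ m * l) \<subseteq> qc z (2 ^ j * l)" using assms by (intro qc_mono mult_right_mono power_increasing) auto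
    then show False using m assms by blast
  qed
  then obtain k where k: "m = Suc k" "j \<le> k" by (cases m) auto
  have "x \<notin> qc z (2 ^ k * l)" using not_less_Least[of k "\<lambda>k. x \<in> qc z (2 ^ k * l)"] k by (simp add: m_def)
  then show ?thesis using k m that by auto
qed

context growth_space
begin

lemma F_classD:
  assumes "\<phi> \<in> F_class M n x"
  shows "\<phi> \<in> C1" "\<And>y. 0 \<le> \<phi> y" "\<phi> \<in> borel_measurable M" "(\<integral>\<^sup>+y. ennreal (\<phi> y) \<partial>M) \<le> 1"
    "\<And>y. y \<noteq> x \<Longrightarrow> \<phi> y \<le> 1 / norm (y - x) ^ n"
    "\<And>y. y \<noteq> x \<Longrightarrow> norm (grad \<phi> y) \<le> 1 / norm (y - x) ^ (n + 1)"
    "\<And>y. \<phi> differentiable (at y)"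
proof -
  show c: "\<phi> \<in> C1" and nn: "\<And>y. 0 \<le> \<phi> y" using assms by (auto simp: F_class_def)
  show "\<And>y. y \<noteq> x \<Longrightarrow> \<phi> y \<le> 1 / norm (y - x) ^ n"
    "\<And>y. y \<noteq> x \<Longrightarrow> norm (grad \<phi> y) \<le> 1 / norm (y - x) ^ (n + 1)" using assms by (auto simp: F_class_def)
  show "\<And>y. \<phi> differentiable (at y)" using c by (simp add: C1_def)
  show "\<phi> \<in> borel_measurable M" using borel_measurable_continuous_onI[OF C1_continuous[OF c]] by simp
  have "integrable M \<phi>" "(\<integral>y. \<bar>\<phi> y\<bar> \<partial>M) \<le> 1" using assms by (auto simp: F_class_def)
  then show "(\<integral>\<^sup>+y. ennreal (\<phi> y) \<partial>M) \<le> 1"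
    using nn by (simp add: nn_integral_eq_integral)
qed

definition atom_height :: "(real^'d) cube \<Rightarrow> (real^'d) cube \<Rightarrow> real" where
  "atom_height Q R = inverse (measure M (cube_set (dilate 2 Q))) * inverse (SS Q R)"

text \<open>A point of 2R outside 2^k Q forces k \<le> \<open>N_coeff Q R + 1\<close>; the extra
  index comes from 2R in place of R.\<close>

definition shells :: "(real^'d) cube \<Rightarrow> (real^'d) cube \<Rightarrow> nat set" where
  "shells Q R = {k. 1 \<le> k \<and> enat k \<le> N_coeff Q R + 1}"

text \<open>On 2Q the majorant comes from the integral bound on members of \<open>F_class\<close>,
  on the shell between 2^k Q and 2^(k+1) Q from their size: there |y - x| \<ge> 2^k l / 4 for y in
  Q, which explains 8 / (2^(k+1) l). Full cubes replace the shells in the indicators; the densities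
  of these cubes are what \<open>S_coeff\<close> sums.\<close>

definition atom_majorant :: "(real^'d) cube \<Rightarrow> (real^'d) cube \<Rightarrow> real^'d \<Rightarrow> ennreal" where
  "atom_majorant Q R x = ennreal (atom_height Q R) * (case Q of Whole \<Rightarrow> 1 | Cube z l \<Rightarrow>
     indicator (qc z (2 * l)) x + ennreal (mq z l) *
       (\<Sum>k. indicator (shells Q R) k * (ennreal ((8 / (2 ^ Suc k * l)) ^ n) * indicator (qc z (2 ^ Suc k * l)) x)))"

lemma atom_height_nonneg: "is_cube M Q \<Longrightarrow> 0 \<le> atom_height Q R"
  unfolding atom_height_def using S_coeff_ge1[of Q R] by (intro mult_nonneg_nonneg) auto

lemma Whole_subset_imp: "cube_set Whole \<subseteq> cube_set (R :: (real^'d) cube) \<Longrightarrow> R = Whole"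
proof (cases R)
  case (Cube z r)
  assume "cube_set Whole \<subseteq> cube_set R"
  then have "qc z r = UNIV" using Cube by auto
  then have "bounded (UNIV :: (real^'d) set)" using compact_qc[of z r] compact_imp_bounded by metis
  then show ?thesis using not_bounded_UNIV by blast
qed simp

lemma S_coeff_Whole_Whole: "SS Whole Whole = 1"
  by (simp add: S_coeff_def)

lemma atom_height_Whole: "atom_height Whole Whole * measure M UNIV \<le> 1"
  by (cases "measure M UNIV = 0") (simp_all add: atom_height_def S_coeff_Whole_Whole)

lemma atom_height_mq:
  assumes "is_cube M (Cube z l)"
  shows "atom_height (Cube z l) R * mq z (2 * l) = inverse (SS (Cube z l) R)"
  using assms mq_pos[of z "2 * l"] by (simp add: atom_height_def)

lemma atom_height_measure_le:
  assumes "is_cube M Q" "is_cube M R" "cube_set Q \<subseteq> cube_set R"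
  shows "ennreal (atom_height Q R) * emeasure M (cube_set Q) \<le> 1"
proof (cases Q)
  case (Cube z l)
  have "atom_height Q R * mq z l \<le> atom_height Q R * mq z (2 * l)"
    using assms atom_height_nonneg Cube by (intro mult_left_mono mq_mono qc_mono) auto
  also have "\<dots> = inverse (SS Q R)" using atom_height_mq assms Cube by simp
  also have "\<dots> \<le> 1" using S_coeff_ge1[OF assms(1), of R] by (simp add: inverse_le_1_iff)
  finally show ?thesis
    using Cube atom_height_nonneg[OF assms(1), of R] by (simp add: emeasure_qc flip: ennreal_mult)
next
  case Whole
  then have R: "R = Whole" using Whole_subset_imp assms by blast
  have "emeasure M UNIV = ennreal (measure M UNIV)" using assms(1) Whole by (simp add: emeasure_eq_ennreal_measure)
  then show ?thesis
    using Whole R atom_height_Whole atom_height_nonneg[OF assms(1), of R] by (simp flip: ennreal_mult)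
qed

lemma atom_majorant_measurable [measurable]: "atom_majorant Q R \<in> borel_measurable M"
  unfolding atom_majorant_def by (cases Q) simp_all

text \<open>For a bounded R the sides 2^(k+1) l run over the exponents 2 to N + 2, two past the
  range of \<open>S_coeff\<close>, and each excess density is at most \<open>C0\<close>.\<close>

lemma shell_sum_le:
  assumes Q: "is_cube M (Cube z l)" and R: "is_cube M R"
  shows "(\<Sum>k. indicator (shells (Cube z l) R) k * ennreal (th z (2 ^ Suc k * l))) \<le> ennreal (SS (Cube z l) R + 2 * C0)"
proof (cases R)
  case (Cube y r)
  then have lr: "0 < l" "0 < r" "z \<in> msupp M" using Q R by auto
  obtain N where N: "N_coeff (Cube z l) (Cube y r) = enat N" using N_coeff_Cube[OF lr(1,2)] .
  have sh: "shells (Cube z l) R = {1..Suc N}" by (auto simp: shells_def Cube N one_enat_def)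
  have "(\<Sum>k. indicator (shells (Cube z l) R) k * ennreal (th z (2 ^ Suc k * l)))
      = (\<Sum>k=1..Suc N. indicator (shells (Cube z l) R) k * ennreal (th z (2 ^ Suc k * l)))"
    unfolding sh by (intro suminf_finite) (auto simp: indicator_def)
  also have "\<dots> = ennreal (\<Sum>k=1..Suc N. th z (2 ^ Suc k * l))"
    using lr by (subst sum_ennreal[symmetric]) (auto simp: sh intro!: sum.cong simp del: power_Suc)
  also have "(\<Sum>k=1..Suc N. th z (2 ^ Suc k * l)) = (\<Sum>k=Suc 1..Suc (Suc N). th z (2 ^ k * l))"
    by (rule sum.shift_bounds_cl_Suc_ivl[symmetric])
  also have "\<dots> \<le> (\<Sum>k=1..Suc (Suc N). th z (2 ^ k * l))" using lr by (intro sum_mono2) auto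
  also have "\<dots> = (\<Sum>k=1..N. th z (2 ^ k * l)) + th z (2 ^ Suc N * l) + th z (2 ^ Suc (Suc N) * l)" by simp
  also have "\<dots> \<le> SS (Cube z l) R + 2 * C0"
    using th_le[OF lr(3), of "2 ^ Suc N * l"] th_le[OF lr(3), of "2 ^ Suc (Suc N) * l"] lr S_coeff_finite[OF N]
    by (simp add: Cube)
  finally show ?thesis by (simp add: ennreal_leI)
next
  case Whole
  then have fin: "emeasure M UNIV < \<infinity>" and l: "0 < l" using Q R by auto
  have s: "summable (\<lambda>k. th z (2 ^ Suc k * l))"
    using summable_th_whole[OF fin l, of z] by (subst summable_Suc_iff)
  have "(\<Sum>k. indicator (shells (Cube z l) R) k * ennreal (th z (2 ^ Suc k * l))) \<le> (\<Sum>k. ennreal (th z (2 ^ Suc k * l)))"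
    by (intro suminf_le summableI) (auto simp: indicator_def)
  also have "\<dots> = ennreal (\<Sum>k. th z (2 ^ Suc k * l))" using s l by (intro suminf_ennreal2) auto
  also have "\<dots> \<le> ennreal (SS (Cube z l) R + 2 * C0)"
    using S_coeff_Whole[OF fin l, of z] C0_pos unfolding Whole by (intro ennreal_leI) simp
  finally show ?thesis .
qed

text \<open>The normalization of atoms by \<open>S_coeff\<close> pays for the shells, whose
  densities sum to \<open>S_coeff\<close> up to a constant; the factor \<mu>(Q) \<le> \<mu>(2Q)
  cancels the rest of the height.\<close>

lemma atom_majorant_integral:
  assumes Q: "is_cube M Q" and R: "is_cube M R" and sub: "cube_set Q \<subseteq> cube_set R"
  shows "(\<integral>\<^sup>+x. atom_majorant Q R x \<partial>M) \<le> ennreal (1 + 8 ^ n * (1 + 2 * C0))"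
proof (cases Q)
  case (Cube z l)
  have zl: "z \<in> msupp M" "0 < l" using Q Cube by auto
  have S: "1 \<le> SS Q R" by (rule S_coeff_ge1[OF Q])
  define H where "H = atom_height Q R"
  have H: "0 \<le> H" unfolding H_def by (rule atom_height_nonneg[OF Q])
  have "(\<integral>\<^sup>+x. atom_majorant Q R x \<partial>M) = ennreal H * (emeasure M (qc z (2 * l)) + ennreal (mq z l) *
       (\<Sum>k. indicator (shells Q R) k * (ennreal ((8 / (2 ^ Suc k * l)) ^ n) * emeasure M (qc z (2 ^ Suc k * l)))))"
    unfolding atom_majorant_def Cube H_def
    by (simp add: nn_integral_cmult nn_integral_add nn_integral_suminf nn_integral_cmult_indicator del: power_Suc)
  also have "(\<Sum>k. indicator (shells Q R) k * (ennreal ((8 / (2 ^ Suc k * l)) ^ n) * emeasure M (qc z (2 ^ Suc k * l))))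
      = (\<Sum>k. ennreal (8 ^ n) * (indicator (shells Q R) k * ennreal (th z (2 ^ Suc k * l))))"
  proof (intro suminf_cong)
    fix k
    have "ennreal ((8 / (2 ^ Suc k * l)) ^ n) * emeasure M (qc z (2 ^ Suc k * l)) = ennreal (8 ^ n * th z (2 ^ Suc k * l))"
      unfolding emeasure_qc using zl by (subst ennreal_mult[symmetric]) (auto simp: qc_density_def power_divide simp del: power_Suc)
    also have "\<dots> = ennreal (8 ^ n) * ennreal (th z (2 ^ Suc k * l))" using zl by (intro ennreal_mult) auto
    finally show "indicator (shells Q R) k * (ennreal ((8 / (2 ^ Suc k * l)) ^ n) * emeasure M (qc z (2 ^ Suc k * l)))
       = ennreal (8 ^ n) * (indicator (shells Q R) k * ennreal (th z (2 ^ Suc k * l)))" by (simp add: mult.left_commute)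
  qed
  also have "\<dots> = ennreal (8 ^ n) * (\<Sum>k. indicator (shells Q R) k * ennreal (th z (2 ^ Suc k * l)))" by simp
  also have "ennreal H * (emeasure M (qc z (2 * l)) + ennreal (mq z l) * \<dots>)
     \<le> ennreal H * (ennreal (mq z (2 * l)) + ennreal (mq z (2 * l)) * (ennreal (8 ^ n) * ennreal (SS Q R + 2 * C0)))"
    using shell_sum_le[of z l R] Q R Cube zl
    by (intro mult_left_mono add_mono mult_mono) (auto simp: emeasure_qc intro!: ennreal_leI mq_mono qc_mono)
  also have "\<dots> = ennreal (H * mq z (2 * l) * (1 + 8 ^ n * (SS Q R + 2 * C0)))"
  proof -
    have "H * mq z (2 * l) * (1 + 8 ^ n * (SS Q R + 2 * C0)) = H * (mq z (2 * l) + mq z (2 * l) * (8 ^ n * (SS Q R + 2 * C0)))"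
      by (simp add: algebra_simps)
    moreover have "0 \<le> SS Q R + 2 * C0" using S C0_pos by simp
    then have "ennreal (H * (mq z (2 * l) + mq z (2 * l) * (8 ^ n * (SS Q R + 2 * C0))))
        = ennreal H * (ennreal (mq z (2 * l)) + ennreal (mq z (2 * l)) * (ennreal (8 ^ n) * ennreal (SS Q R + 2 * C0)))"
      using H by (simp add: ennreal_mult)
    ultimately show ?thesis by (simp only:)
  qed
  also have "H * mq z (2 * l) = inverse (SS Q R)" unfolding H_def using atom_height_mq Q Cube by simp
  also have "inverse (SS Q R) * (1 + 8 ^ n * (SS Q R + 2 * C0)) \<le> 1 + 8 ^ n * (1 + 2 * C0)"
  proof -
    have "1 \<le> SS Q R * 1" using S by simp
    moreover have "2 * C0 \<le> SS Q R * (2 * C0)" using S C0_pos by simp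
    ultimately have "1 + 8 ^ n * (SS Q R + 2 * C0) \<le> SS Q R * 1 + 8 ^ n * (SS Q R + SS Q R * (2 * C0))"
      by (intro add_mono mult_left_mono) auto
    also have "\<dots> = SS Q R * (1 + 8 ^ n * (1 + 2 * C0))" by (simp add: algebra_simps)
    finally show ?thesis using S by (simp add: field_simps)
  qed
  finally show ?thesis by (simp add: ennreal_leI)
next
  case Whole
  have "(\<integral>\<^sup>+x. atom_majorant Q R x \<partial>M) = ennreal (atom_height Q R) * emeasure M (cube_set Q)"
    unfolding atom_majorant_def Whole by simp
  also have "\<dots> \<le> ennreal 1" using atom_height_measure_le[OF Q R sub] by simp
  also have "\<dots> \<le> ennreal (1 + 8 ^ n * (1 + 2 * C0))" using C0_pos by (intro ennreal_leI) simp
  finally show ?thesis .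
qed

lemma atom_maximal_le:
  assumes Q: "is_cube M Q" and R: "is_cube M R" and sub: "cube_set Q \<subseteq> cube_set R"
    and x: "x \<in> cube_set (dilate 2 R)" and phi: "\<phi> \<in> F_class M n x"
    and supp: "AE y in M. y \<notin> cube_set Q \<longrightarrow> a y = 0" and bd: "AE y in M. \<bar>a y\<bar> \<le> atom_height Q R"
  shows "(\<integral>\<^sup>+y. ennreal (\<bar>a y\<bar> * \<phi> y) \<partial>M) \<le> atom_majorant Q R x"
proof -
  note F = F_classD[OF phi]
  note [measurable] = F(3)
  define H where "H = atom_height Q R"
  have H: "0 \<le> H" unfolding H_def by (rule atom_height_nonneg[OF Q])
  have le: "AE y in M. ennreal (\<bar>a y\<bar> * \<phi> y) \<le> ennreal H * (ennreal (\<phi> y) * indicator (cube_set Q) y)"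
    using supp bd
  proof eventually_elim
    fix y assume "y \<notin> cube_set Q \<longrightarrow> a y = 0" "\<bar>a y\<bar> \<le> atom_height Q R"
    then show "ennreal (\<bar>a y\<bar> * \<phi> y) \<le> ennreal H * (ennreal (\<phi> y) * indicator (cube_set Q) y)"
      using F(2)[of y] H by (cases "y \<in> cube_set Q") (auto simp: H_def mult_right_mono ennreal_leI simp flip: ennreal_mult)
  qed
  have Qs: "cube_set Q \<in> sets M" by (cases Q) (auto simp: )
  have le2: "(\<integral>\<^sup>+y. ennreal (\<bar>a y\<bar> * \<phi> y) \<partial>M) \<le> ennreal H * (\<integral>\<^sup>+y. ennreal (\<phi> y) * indicator (cube_set Q) y \<partial>M)"
  proof -
    have "(\<integral>\<^sup>+y. ennreal (\<bar>a y\<bar> * \<phi> y) \<partial>M) \<le> (\<integral>\<^sup>+y. ennreal H * (ennreal (\<phi> y) * indicator (cube_set Q) y) \<partial>M)"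
      using le by (rule nn_integral_mono_AE)
    also have "\<dots> = ennreal H * (\<integral>\<^sup>+y. ennreal (\<phi> y) * indicator (cube_set Q) y \<partial>M)"
      using Qs F(3) by (intro nn_integral_cmult borel_measurable_times_ennreal borel_measurable_indicator) auto
    finally show ?thesis .
  qed
  have near: "(\<integral>\<^sup>+y. ennreal (\<bar>a y\<bar> * \<phi> y) \<partial>M) \<le> ennreal H"
  proof -
    have "(\<integral>\<^sup>+y. ennreal (\<phi> y) * indicator (cube_set Q) y \<partial>M) \<le> (\<integral>\<^sup>+y. ennreal (\<phi> y) \<partial>M)"
      by (intro nn_integral_mono) (auto simp: indicator_def)
    also have "\<dots> \<le> 1" by (rule F(4))
    finally have "ennreal H * (\<integral>\<^sup>+y. ennreal (\<phi> y) * indicator (cube_set Q) y \<partial>M) \<le> ennreal H * 1" by (intro mult_left_mono) auto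
    then show ?thesis using le2 by simp
  qed
  show ?thesis
  proof (cases Q)
    case Whole
    then show ?thesis using near by (simp add: atom_majorant_def H_def)
  next
    case (Cube z l)
    have zl: "z \<in> msupp M" "0 < l" using Q Cube by auto
    show ?thesis
    proof (cases "x \<in> qc z (2 * l)")
      case True
      have "ennreal H * 1 \<le> atom_majorant Q R x"
        unfolding atom_majorant_def Cube H_def using True by (intro mult_left_mono) auto
      then show ?thesis using near by simp
    next
      case False
      then have "x \<notin> qc z (2 ^ 1 * l)" by simp
      then obtain k where k: "1 \<le> k" "x \<notin> qc z (2 ^ k * l)" "x \<in> qc z (2 ^ Suc k * l)"
        using shell_exists[OF zl(2)] by blast
      have ksh: "k \<in> shells Q R"
      proof (cases R)
        case Whole
        then show ?thesis using k N_coeff_Whole[OF zl(2), of z] by (simp add: shells_def Cube)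
      next
        case R': (Cube w r)
        then have r: "0 < r" using R by simp
        obtain N where N: "N_coeff (Cube z l) (Cube w r) = enat N" "1 \<le> N" "r \<le> 2 ^ N * l"
          using N_coeff_Cube[OF zl(2) r] by metis
        have "k \<le> Suc N"
        proof (rule ccontr)
          assume "\<not> k \<le> Suc N"
          then have "(2::real) ^ (N + 2) \<le> 2 ^ k" by (intro power_increasing) auto
          then have "2 ^ (N + 2) * l \<le> 2 ^ k * l" using zl by (intro mult_right_mono) auto
          then have kl: "r + 2 * r \<le> 2 ^ k * l" using N(3) r by (simp add: power_add)
          have "z \<in> qc w r" using sub zl by (auto simp: Cube R')
          then have "qc w (2 * r) \<subseteq> qc z (2 ^ k * l)" using kl by (intro qc_subset_add[of w z r]) (auto simp: qc_sym)
          then show False using k x by (auto simp: R')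
        qed
        then show ?thesis using k by (simp add: shells_def Cube R' N one_enat_def)
      qed
      have pb: "\<phi> y \<le> (8 / (2 ^ Suc k * l)) ^ n" if y: "y \<in> qc z l" for y
      proof -
        have "2 ^ 1 * l \<le> 2 ^ k * l" using k zl by (intro mult_right_mono power_increasing) auto
        moreover have "(2 ^ k * l - l) / 2 \<le> norm (y - x)" using y k by (intro dist_outside_qc)
        ultimately have d: "2 ^ k * l / 4 \<le> norm (y - x)" by simp
        have p: "0 < 2 ^ k * l / 4" using zl by simp
        then have "y \<noteq> x" "0 < norm (y - x)" using d by auto
        have "\<phi> y \<le> 1 / norm (y - x) ^ n" by (rule F(5)) fact
        also have "\<dots> \<le> 1 / (2 ^ k * l / 4) ^ n"
          using d p \<open>0 < norm (y - x)\<close> by (intro divide_left_mono power_mono mult_pos_pos zero_less_power) auto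
        also have "\<dots> = (8 / (2 ^ Suc k * l)) ^ n" by (simp add: power_divide power_mult_distrib field_simps flip: power_mult_distrib)
        finally show ?thesis .
      qed
      define X where "X = (8 / (2 ^ Suc k * l)) ^ n"
      have "(\<integral>\<^sup>+y. ennreal (\<phi> y) * indicator (cube_set Q) y \<partial>M) \<le> (\<integral>\<^sup>+y. ennreal X * indicator (qc z l) y \<partial>M)"
        using pb by (intro nn_integral_mono) (auto simp: indicator_def Cube X_def ennreal_leI)
      also have "\<dots> = ennreal (mq z l) * (indicator (shells Q R) k * (ennreal X * indicator (qc z (2 ^ Suc k * l)) x))"
        using k ksh by (simp add: nn_integral_cmult_indicator emeasure_qc mult.commute)
      also have "\<dots> \<le> ennreal (mq z l) * (\<Sum>k. indicator (shells Q R) k * (ennreal ((8 / (2 ^ Suc k * l)) ^ n) * indicator (qc z (2 ^ Suc k * l)) x))"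
        unfolding X_def
        by (intro mult_left_mono ennreal_le_suminf[of "\<lambda>k. indicator (shells Q R) k * (ennreal ((8 / (2 ^ Suc k * l)) ^ n) * indicator (qc z (2 ^ Suc k * l)) x)"]) simp
      also have "\<dots> \<le> indicator (qc z (2 * l)) x + \<dots>" by simp
      finally have "ennreal H * (\<integral>\<^sup>+y. ennreal (\<phi> y) * indicator (cube_set Q) y \<partial>M) \<le> atom_majorant Q R x"
        unfolding atom_majorant_def H_def Cube by (simp add: mult_left_mono del: power_Suc)
      then show ?thesis using le2 by simp
    qed
  qed
qed

text \<open>Gradient bound times diameter: for x outside 2^(k+1) R a member of
  \<open>F_class\<close> has gradient at most (2 / (2^k r))^(n+1) on R, and points of R are within
  \<open>CARD('d)\<close> r / 2 of the centre.\<close>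

definition tail_coeff :: "real \<Rightarrow> nat \<Rightarrow> real" where
  "tail_coeff r k = real CARD('d) * 2 ^ n * r / (2 ^ k * r) ^ (n + 1)"

text \<open>The weight k + 1 is the possible growth of the mean from R to a cube of side 2^(k+3) r.
  Against \<mu>(2^(k+2) R) the coefficient leaves a multiple of 2^(-k), so the weighted series still
  has a bounded integral.\<close>

definition tail_majorant :: "(real^'d) cube \<Rightarrow> real^'d \<Rightarrow> ennreal" where
  "tail_majorant R x = (case R of Whole \<Rightarrow> 0 | Cube z r \<Rightarrow>
     \<Sum>k. ennreal (real (Suc k) * tail_coeff r k) * indicator (qc z (2 ^ (k + 2) * r)) x)"

lemma tail_majorant_measurable [measurable]: "tail_majorant R \<in> borel_measurable M"
  unfolding tail_majorant_def by (cases R) simp_all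

lemma tail_majorant_integral:
  assumes "is_cube M R"
  shows "(\<integral>\<^sup>+x. tail_majorant R x \<partial>M) \<le> ennreal (real CARD('d) * 8 ^ n * C0 * 4)"
proof (cases R)
  case (Cube z r)
  have zr: "z \<in> msupp M" "0 < r" using assms Cube by auto
  have "(\<integral>\<^sup>+x. tail_majorant R x \<partial>M) = (\<Sum>k. ennreal (real (Suc k) * tail_coeff r k) * emeasure M (qc z (2 ^ (k + 2) * r)))"
    unfolding tail_majorant_def Cube
    by (simp add: nn_integral_suminf nn_integral_cmult_indicator del: power_Suc of_nat_Suc power_add)
  also have "\<dots> \<le> (\<Sum>k. ennreal (real CARD('d) * 8 ^ n * C0 * (real (Suc k) * (1/2) ^ k)))"
  proof (intro suminf_le summableI)
    fix k
    have t: "0 \<le> tail_coeff r k" using zr by (simp add: tail_coeff_def)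
    have "real (Suc k) * tail_coeff r k * mq z (2 ^ (k + 2) * r) \<le> real (Suc k) * tail_coeff r k * (C0 * (2 ^ (k + 2) * r) ^ n)"
      using zr t by (intro mult_left_mono mq_supp_le) auto
    also have "\<dots> = real CARD('d) * 8 ^ n * C0 * (real (Suc k) * (1/2) ^ k)"
    proof -
      define X where "X = 2 ^ k * r"
      have X: "0 < X" using zr by (simp add: X_def)
      have "tail_coeff r k * (2 ^ (k + 2) * r) ^ n = real CARD('d) * 2 ^ n * r / (X ^ n * X) * (4 * X) ^ n"
        by (simp add: tail_coeff_def X_def power_add mult.commute mult.left_commute)
      also have "\<dots> = real CARD('d) * (2 ^ n * 4 ^ n) * (r / X)" using X by (simp add: power_mult_distrib)
      also have "(2::real) ^ n * 4 ^ n = 8 ^ n" by (simp flip: power_mult_distrib)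
      also have "r / X = (1/2) ^ k" using zr by (simp add: X_def power_divide)
      finally have e: "tail_coeff r k * (2 ^ (k + 2) * r) ^ n = real CARD('d) * 8 ^ n * (1/2) ^ k" .
      have "real (Suc k) * tail_coeff r k * (C0 * (2 ^ (k + 2) * r) ^ n) = real (Suc k) * C0 * (tail_coeff r k * (2 ^ (k + 2) * r) ^ n)"
        by (simp only: mult_ac)
      then show ?thesis unfolding e by (simp only: mult_ac)
    qed
    finally show "ennreal (real (Suc k) * tail_coeff r k) * emeasure M (qc z (2 ^ (k + 2) * r))
        \<le> ennreal (real CARD('d) * 8 ^ n * C0 * (real (Suc k) * (1/2) ^ k))"
      unfolding emeasure_qc using t by (subst ennreal_mult[symmetric]) (auto intro!: ennreal_leI simp del: of_nat_Suc)
  qed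
  also have "\<dots> = ennreal (real CARD('d) * 8 ^ n * C0 * 4)"
  proof -
    have s: "(\<lambda>k. real (Suc k) * (1/2) ^ k) sums 4"
      using geometric_deriv_sums[of "1/2::real"] by (simp add: power2_eq_square)
    have "(\<lambda>k. real CARD('d) * 8 ^ n * C0 * (real (Suc k) * (1/2) ^ k)) sums (real CARD('d) * 8 ^ n * C0 * 4)"
      using s by (rule sums_mult)
    then show ?thesis using C0_pos by (intro suminf_ennreal_eq) (auto simp del: of_nat_Suc)
  qed
  finally show ?thesis .
qed (simp add: tail_majorant_def)

lemma F_class_tail:
  assumes r: "0 < r" and x: "x \<notin> qc z (2 * r)" and phi: "\<phi> \<in> F_class M n x"
  obtains k where "x \<in> qc z (2 ^ (k + 2) * r)" "\<And>y. y \<in> qc z r \<Longrightarrow> \<bar>\<phi> y - \<phi> z\<bar> \<le> tail_coeff r k"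
proof -
  note F = F_classD[OF phi]
  have "x \<notin> qc z (2 ^ 1 * r)" using x by simp
  then obtain j where j: "1 \<le> j" "x \<notin> qc z (2 ^ j * r)" "x \<in> qc z (2 ^ Suc j * r)"
    using shell_exists[OF r] by blast
  \<comment> \<open>The shells outside 2R start at j = 1; k = j - 1 makes the series in
    \<open>tail_majorant\<close> start at 0.\<close>
  then obtain k where k: "j = Suc k" by (cases j) auto
  have "\<bar>\<phi> y - \<phi> z\<bar> \<le> tail_coeff r k" if y: "y \<in> qc z r" for y
  proof -
    define X where "X = 2 ^ k * r"
    have X: "0 < X" "r \<le> X" using r mult_right_mono[of 1 "2 ^ k" r] by (auto simp: X_def)
    have "\<bar>\<phi> y - \<phi> z\<bar> \<le> (2 / X) ^ (n + 1) * norm (y - z)"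
    proof (rule grad_bound_imp_Lipschitz[OF convex_qc[of z r]])
      fix w assume w: "w \<in> qc z r"
      have "(2 ^ j * r - r) / 2 \<le> norm (w - x)" using w j by (intro dist_outside_qc)
      moreover have "2 ^ j * r = 2 * X" by (simp add: X_def k)
      ultimately have d: "X / 2 \<le> norm (w - x)" using X by simp
      then have "w \<noteq> x" "0 < norm (w - x)" using X by auto
      have "norm (grad \<phi> w) \<le> 1 / norm (w - x) ^ (n + 1)" by (rule F(6)) fact
      also have "\<dots> \<le> 1 / (X / 2) ^ (n + 1)"
        using d X \<open>0 < norm (w - x)\<close> by (intro divide_left_mono power_mono mult_pos_pos zero_less_power) auto
      also have "\<dots> = (2 / X) ^ (n + 1)" by (simp add: power_divide)
      finally show "norm (grad \<phi> w) \<le> (2 / X) ^ (n + 1)" .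
    qed (use y r F(7) in auto)
    also have "\<dots> \<le> (2 / X) ^ (n + 1) * (real CARD('d) * r / 2)"
      using norm_le_qc[OF y] X by (intro mult_left_mono) auto
    also have "\<dots> = tail_coeff r k" by (simp add: tail_coeff_def X_def power_divide)
    finally show ?thesis .
  qed
  then show ?thesis using that[of k] j k by simp
qed

end


section \<open>Blocks against means\<close>

lemma test_fun_C1:
  assumes "\<phi> \<in> test_fun" shows "\<phi> \<in> C1"
proof -
  have d: "partials is \<phi> differentiable (at y)" for "is" y using assms by (simp add: test_fun_def)
  have c: "continuous_on UNIV (partial i \<phi>)" for i
    using d[of "[i]"] by (simp add: partials_def continuous_on_eq_continuous_at differentiable_imp_continuous_within)
  have "continuous_on UNIV (grad \<phi>)"
    unfolding grad_def by (intro continuous_on_vec_lambda) (rule c)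
  then show ?thesis using d[of "[]"] by (simp add: C1_def partials_def)
qed

lemma compact_support_bounded:
  fixes g :: "real^'d \<Rightarrow> 'b::real_normed_vector"
  assumes "compact (closure S)" "continuous_on UNIV g" "\<And>y. y \<notin> S \<Longrightarrow> g y = 0"
  obtains B where "0 \<le> B" "\<And>y. norm (g y) \<le> B"
proof -
  have "compact (g ` closure S)" using assms continuous_on_subset[OF assms(2) subset_UNIV] by (intro compact_continuous_image)
  then obtain B where B: "\<And>v. v \<in> g ` closure S \<Longrightarrow> norm v \<le> B"
    using compact_imp_bounded bounded_iff by metis
  have "norm (g y) \<le> max B 0" for y
  proof (cases "y \<in> S")
    case True
    then have "g y \<in> g ` closure S" using closure_subset by blast
    then show ?thesis using B by (simp add: max.coboundedI1)
  qed (simp add: assms)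
  then show ?thesis using that[of "max B 0"] by simp
qed

lemma test_fun_bounded:
  assumes "\<phi> \<in> test_fun"
  obtains B where "0 \<le> B" "\<And>y. \<bar>\<phi> y\<bar> \<le> B"
proof -
  have "compact (closure {y. \<phi> y \<noteq> 0})" using assms by (simp add: test_fun_def)
  moreover have "\<phi> y = 0" if "y \<notin> {y. \<phi> y \<noteq> 0}" for y using that by simp
  ultimately obtain B where "0 \<le> B" "\<And>y. norm (\<phi> y) \<le> B"
    using compact_support_bounded[OF _ C1_continuous[OF test_fun_C1[OF assms]]] by metis
  then show ?thesis by (intro that[of B]) (simp_all only: real_norm_def)
qed

context growth_space
begin

lemma test_fun_measurable:
  assumes "\<phi> \<in> test_fun" shows "\<phi> \<in> borel_measurable M"
  using borel_measurable_continuous_onI[OF C1_continuous[OF test_fun_C1[OF assms]]] by simp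

lemma integrable_mult_test:
  assumes "integrable M g" "\<phi> \<in> test_fun" shows "integrable M (\<lambda>y. g y * \<phi> y)"
proof -
  obtain B where B: "0 \<le> B" "\<And>y. \<bar>\<phi> y\<bar> \<le> B" by (rule test_fun_bounded[OF assms(2)]) blast
  have phi: "\<phi> \<in> borel_measurable M" by (rule test_fun_measurable) fact
  have g: "g \<in> borel_measurable M" using assms(1) by (rule borel_measurable_integrable)
  show ?thesis
  proof (rule Bochner_Integration.integrable_bound)
    show "integrable M (\<lambda>y. B * g y)" using assms(1) by (rule integrable_mult_right)
    have "norm (g y * \<phi> y) \<le> norm (B * g y)" for y
      using mult_left_mono[OF B(2)[of y], of "\<bar>g y\<bar>"] B(1) by (simp add: abs_mult mult.commute[of B])
    then show "AE y in M. norm (g y * \<phi> y) \<le> norm (B * g y)" by (rule AE_I2)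
    show "(\<lambda>y. g y * \<phi> y) \<in> borel_measurable M" using g phi by (rule borel_measurable_times)
  qed
qed

lemma ennreal_abs_integral_le: "ennreal \<bar>\<integral>y. g y \<partial>M\<bar> \<le> (\<integral>\<^sup>+y. ennreal \<bar>g y\<bar> \<partial>M)"
proof (cases "integrable M g")
  case True
  then show ?thesis using integral_norm_bound_ennreal[of M g] by simp
qed (simp add: not_integrable_integral_eq)

lemma cube_set_sets [measurable, simp]: "cube_set Q \<in> sets M"
  by (cases Q) auto

lemma block_integral_le:
  assumes b: "AE y in M. (\<lambda>i. lam i * a i y) sums b y" and a [measurable]: "\<And>i::nat. a i \<in> borel_measurable M"
    and g [measurable]: "g \<in> borel_measurable M"
  shows "(\<integral>\<^sup>+y. ennreal \<bar>b y\<bar> * g y \<partial>M) \<le> (\<Sum>i. ennreal \<bar>lam i\<bar> * (\<integral>\<^sup>+y. ennreal \<bar>a i y\<bar> * g y \<partial>M))"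
proof -
  have "(\<integral>\<^sup>+y. ennreal \<bar>b y\<bar> * g y \<partial>M) \<le> (\<integral>\<^sup>+y. (\<Sum>i. ennreal \<bar>lam i\<bar> * (ennreal \<bar>a i y\<bar> * g y)) \<partial>M)"
  proof (rule nn_integral_mono_AE)
    show "AE y in M. ennreal \<bar>b y\<bar> * g y \<le> (\<Sum>i. ennreal \<bar>lam i\<bar> * (ennreal \<bar>a i y\<bar> * g y))"
      using b
    proof eventually_elim
      fix y assume "(\<lambda>i. lam i * a i y) sums b y"
      from ennreal_abs_sums_le[OF this]
      have "ennreal \<bar>b y\<bar> * g y \<le> (\<Sum>i. ennreal \<bar>lam i * a i y\<bar>) * g y" by (intro mult_right_mono) auto
      also have "\<dots> = (\<Sum>i. ennreal \<bar>lam i\<bar> * (ennreal \<bar>a i y\<bar> * g y))"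
        by (simp add: abs_mult ennreal_mult mult.assoc flip: ennreal_suminf_multc)
      finally show "ennreal \<bar>b y\<bar> * g y \<le> (\<Sum>i. ennreal \<bar>lam i\<bar> * (ennreal \<bar>a i y\<bar> * g y))" .
    qed
  qed
  also have "\<dots> = (\<Sum>i. ennreal \<bar>lam i\<bar> * (\<integral>\<^sup>+y. ennreal \<bar>a i y\<bar> * g y \<partial>M))"
    by (subst nn_integral_suminf) (auto simp: nn_integral_cmult)
  finally show ?thesis .
qed

lemma atom_integral_le:
  assumes "is_cube M Q" and supp: "AE y in M. y \<notin> cube_set Q \<longrightarrow> a y = 0" and bd: "AE y in M. \<bar>a y\<bar> \<le> atom_height Q R"
    and g [measurable]: "g \<in> borel_measurable M"
  shows "(\<integral>\<^sup>+y. ennreal \<bar>a y\<bar> * g y \<partial>M) \<le> ennreal (atom_height Q R) * (\<integral>\<^sup>+y\<in>cube_set Q. g y \<partial>M)"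
proof -
  have "(\<integral>\<^sup>+y. ennreal \<bar>a y\<bar> * g y \<partial>M) \<le> (\<integral>\<^sup>+y. ennreal (atom_height Q R) * (g y * indicator (cube_set Q) y) \<partial>M)"
  proof (rule nn_integral_mono_AE)
    show "AE y in M. ennreal \<bar>a y\<bar> * g y \<le> ennreal (atom_height Q R) * (g y * indicator (cube_set Q) y)"
      using supp bd
    proof eventually_elim
      fix y assume "y \<notin> cube_set Q \<longrightarrow> a y = 0" "\<bar>a y\<bar> \<le> atom_height Q R"
      then show "ennreal \<bar>a y\<bar> * g y \<le> ennreal (atom_height Q R) * (g y * indicator (cube_set Q) y)"
        by (cases "y \<in> cube_set Q") (auto intro!: mult_right_mono ennreal_leI)
    qed
  qed
  also have "\<dots> = ennreal (atom_height Q R) * (\<integral>\<^sup>+y\<in>cube_set Q. g y \<partial>M)"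
    by (intro nn_integral_cmult borel_measurable_times_ennreal borel_measurable_indicator g cube_set_sets)
  finally show ?thesis .
qed

lemma atomic_blockE:
  assumes "atomic_block M n R b lam"
  obtains a Q where "is_cube M R" "b \<in> borel_measurable M" "integrable M b" "(\<integral>y. b y \<partial>M) = 0"
    "AE y in M. y \<notin> cube_set R \<longrightarrow> b y = 0"
    "\<And>i. is_cube M (Q i)" "\<And>i. cube_set (Q i) \<subseteq> cube_set R" "\<And>i::nat. a i \<in> borel_measurable M"
    "\<And>i. AE y in M. y \<notin> cube_set (Q i) \<longrightarrow> a i y = 0" "\<And>i. AE y in M. \<bar>a i y\<bar> \<le> atom_height (Q i) R"
    "AE y in M. (\<lambda>i. lam i * a i y) sums b y"
  using assms unfolding atomic_block_def atom_height_def has_bochner_integral_iff L1loc_def by blast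

lemma block_norm_le:
  assumes "atomic_block M n R b lam" shows "(\<integral>\<^sup>+y. ennreal \<bar>b y\<bar> \<partial>M) \<le> block_size lam"
proof -
  obtain a Q where R: "is_cube M R" and Q: "\<And>i. is_cube M (Q i)" "\<And>i. cube_set (Q i) \<subseteq> cube_set R" "\<And>i::nat. a i \<in> borel_measurable M"
    "\<And>i. AE y in M. y \<notin> cube_set (Q i) \<longrightarrow> a i y = 0" "\<And>i. AE y in M. \<bar>a i y\<bar> \<le> atom_height (Q i) R"
    and b: "AE y in M. (\<lambda>i. lam i * a i y) sums b y"
    by (rule atomic_blockE[OF assms]) blast
  have "(\<integral>\<^sup>+y. ennreal \<bar>b y\<bar> * 1 \<partial>M) \<le> (\<Sum>i. ennreal \<bar>lam i\<bar> * (\<integral>\<^sup>+y. ennreal \<bar>a i y\<bar> * 1 \<partial>M))"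
    using b Q(3) by (intro block_integral_le) auto
  also have "\<dots> \<le> (\<Sum>i. ennreal \<bar>lam i\<bar> * 1)"
  proof (intro suminf_le summableI mult_left_mono)
    fix i
    have "(\<integral>\<^sup>+y. ennreal \<bar>a i y\<bar> * 1 \<partial>M) \<le> ennreal (atom_height (Q i) R) * (\<integral>\<^sup>+y\<in>cube_set (Q i). 1 \<partial>M)"
      using Q by (intro atom_integral_le) auto
    also have "(\<integral>\<^sup>+y\<in>cube_set (Q i). 1 \<partial>M) = emeasure M (cube_set (Q i))"
      by (simp add: nn_integral_indicator[OF cube_set_sets])
    also have "ennreal (atom_height (Q i) R) * \<dots> \<le> 1" by (rule atom_height_measure_le[OF Q(1) R Q(2)])
    finally show "(\<integral>\<^sup>+y. ennreal \<bar>a i y\<bar> * 1 \<partial>M) \<le> 1" .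
  qed auto
  finally show ?thesis by (simp add: block_size_def)
qed

text \<open>The vanishing integral of b lets \<phi> be replaced by \<phi> - v. In the uses v is a
  value of \<phi> when its oscillation on R counts, and 0 when only its size does.\<close>

lemma block_cancel:
  assumes blk: "atomic_block M n R b lam" and test: "\<phi> \<in> test_fun"
    and B: "0 \<le> B" "\<And>y. y \<in> cube_set R \<Longrightarrow> \<bar>\<phi> y - v\<bar> \<le> B"
  shows "ennreal \<bar>\<integral>y. b y * \<phi> y \<partial>M\<bar> \<le> ennreal B * block_size lam"
proof -
  have bm: "b \<in> borel_measurable M" "integrable M b" "(\<integral>y. b y \<partial>M) = 0" "AE y in M. y \<notin> cube_set R \<longrightarrow> b y = 0"
    by (rule atomic_blockE[OF blk]; assumption)+
  note [measurable] = bm(1)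
  have "(\<integral>y. b y * (\<phi> y - v) \<partial>M) = (\<integral>y. b y * \<phi> y \<partial>M) - (\<integral>y. b y * v \<partial>M)"
    unfolding right_diff_distrib using integrable_mult_test[OF bm(2) test] bm(2)
    by (intro Bochner_Integration.integral_diff) auto
  then have eq: "(\<integral>y. b y * \<phi> y \<partial>M) = (\<integral>y. b y * (\<phi> y - v) \<partial>M)" using bm(3) by simp
  have "ennreal \<bar>\<integral>y. b y * \<phi> y \<partial>M\<bar> \<le> (\<integral>\<^sup>+y. ennreal \<bar>b y * (\<phi> y - v)\<bar> \<partial>M)"
    unfolding eq by (rule ennreal_abs_integral_le)
  also have "\<dots> \<le> (\<integral>\<^sup>+y. ennreal B * ennreal \<bar>b y\<bar> \<partial>M)"
  proof (rule nn_integral_mono_AE)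
    show "AE y in M. ennreal \<bar>b y * (\<phi> y - v)\<bar> \<le> ennreal B * ennreal \<bar>b y\<bar>"
      using bm(4)
    proof eventually_elim
      fix y assume y: "y \<notin> cube_set R \<longrightarrow> b y = 0"
      have "\<bar>b y * (\<phi> y - v)\<bar> \<le> B * \<bar>b y\<bar>"
      proof (cases "y \<in> cube_set R")
        case True
        then show ?thesis using mult_left_mono[OF B(2)[OF True], of "\<bar>b y\<bar>"] by (simp add: abs_mult mult.commute[of B])
      qed (use y in simp)
      then show "ennreal \<bar>b y * (\<phi> y - v)\<bar> \<le> ennreal B * ennreal \<bar>b y\<bar>"
        using B(1) by (simp add: ennreal_leI flip: ennreal_mult)
    qed
  qed
  also have "\<dots> = ennreal B * (\<integral>\<^sup>+y. ennreal \<bar>b y\<bar> \<partial>M)" by (simp add: nn_integral_cmult)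
  also have "\<dots> \<le> ennreal B * block_size lam" by (intro mult_left_mono block_norm_le[OF blk]) auto
  finally show ?thesis .
qed

end

context mean_family
begin

definition cube_mean :: "(real^'d) cube \<Rightarrow> real" where
  "cube_mean R = (case R of Cube z r \<Rightarrow> c z r | Whole \<Rightarrow> cW)"

text \<open>Translates \<open>mean_diff\<close> back to \<open>S_coeff\<close>, the quantity in the
  height of an atom. For \<open>Whole\<close> the comparison passes through the concentric cube of
  side \<open>max l 2\<close>, whose mean is bounded, as is \<open>cW\<close>.\<close>

lemma mean_diff_S_coeff:
  obtains D where "0 \<le> D" "\<And>x l R. is_cube M (Cube x l) \<Longrightarrow> is_cube M R \<Longrightarrow> qc x l \<subseteq> cube_set R \<Longrightarrow>
    \<bar>c x l - cube_mean R\<bar> \<le> D * SS (Cube x l) R"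
proof -
  define D where "D = C1 * (2 ^ n + C0 + 1) + 2 * C1"
  have D: "0 \<le> C1 * (2 ^ n + C0 + 1)" using C1_nonneg C0_pos by simp
  show ?thesis
  proof (rule that[of D])
    show "0 \<le> D" using D C1_nonneg by (simp add: D_def)
    fix x l and R :: "(real^'d) cube" assume Q: "is_cube M (Cube x l)" and R: "is_cube M R" and sub: "qc x l \<subseteq> cube_set R"
    have x: "x \<in> msupp M" and l: "0 < l" using Q by auto
    have S: "1 \<le> SS (Cube x l) R" by (rule S_coeff_ge1[OF Q])
    have main: "\<bar>c x l - c y r\<bar> \<le> C1 * (2 ^ n + C0 + 1) * SS (Cube x l) (Cube y r)"
      if "y \<in> msupp M" "l \<le> r" "x \<in> qc y r" for y r
    proof -
      have "\<bar>c x l - c y r\<bar> \<le> C1 * (1 + TT x (sc l) (sc r))" using that x l by (intro mean_diff) auto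
      also have "\<dots> \<le> C1 * ((2 ^ n + C0 + 1) * SS (Cube x l) (Cube y r))"
        using S_coeff_ge[OF x l, of r y] l that C1_nonneg by (intro mult_left_mono) auto
      finally show ?thesis by (simp add: mult.assoc)
    qed
    show "\<bar>c x l - cube_mean R\<bar> \<le> D * SS (Cube x l) R"
    proof (cases R)
      case (Cube y r)
      have "l \<le> r" "x \<in> qc y r" using sub l qc_subset_imp_le[of x l y r] Cube by auto
      then have "\<bar>c x l - cube_mean R\<bar> \<le> C1 * (2 ^ n + C0 + 1) * SS (Cube x l) R"
        using main[of y r] R by (simp add: Cube cube_mean_def)
      moreover have "0 \<le> 2 * C1 * SS (Cube x l) R" using C1_nonneg S by simp
      ultimately show ?thesis by (simp add: D_def distrib_right)
    next
      case Whole
      then have fin: "emeasure M UNIV < \<infinity>" using R by simp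
      define r where "r = max l 2"
      have "\<bar>c x l - c x r\<bar> \<le> C1 * (2 ^ n + C0 + 1) * SS (Cube x l) (Cube x r)"
        using x l by (intro main) (auto simp: r_def)
      also have "\<dots> \<le> C1 * (2 ^ n + C0 + 1) * SS (Cube x l) R"
        using S_coeff_Whole_ge[OF fin l, of r x x] D unfolding Whole by (intro mult_left_mono) (auto simp: r_def)
      finally have 1: "\<bar>c x l - c x r\<bar> \<le> C1 * (2 ^ n + C0 + 1) * SS (Cube x l) R" .
      have 2: "\<bar>c x r\<bar> \<le> C1" "\<bar>cW\<bar> \<le> C1" using mean_large[OF x, of r] mean_whole[OF fin] by (auto simp: r_def)
      have "2 * C1 * 1 \<le> 2 * C1 * SS (Cube x l) R" using S C1_nonneg by (intro mult_left_mono) auto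
      then show ?thesis using 1 2 by (simp add: D_def distrib_right cube_mean_def Whole)
    qed
  qed
qed

text \<open>The two factors in the height of an atom are used separately: \<mu>(2Q) against the
  oscillation of f around c(Q), for which \<open>mean_osc2\<close> has the dilation factor 2, and
  \<open>S_coeff\<close> against |c(Q) - c(R)|.\<close>

lemma block_oscillation:
  obtains C where "0 \<le> C" "\<And>R b lam. atomic_block M n R b lam \<Longrightarrow>
    (\<integral>\<^sup>+y. ennreal \<bar>b y\<bar> * ennreal \<bar>f y - cube_mean R\<bar> \<partial>M) \<le> ennreal C * block_size lam"
proof -
  obtain C where C: "0 \<le> C" "\<And>x l. x \<in> msupp M \<Longrightarrow> 0 < l \<Longrightarrow>
    osc f x l (c x l) \<le> ennreal (C * mq x (2 * l))"
    using mean_osc2 by blast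
  obtain D where D: "0 \<le> D" "\<And>x l R. is_cube M (Cube x l) \<Longrightarrow> is_cube M R \<Longrightarrow> qc x l \<subseteq> cube_set R \<Longrightarrow>
    \<bar>c x l - cube_mean R\<bar> \<le> D * SS (Cube x l) R"
    using mean_diff_S_coeff by blast
  have atom: "ennreal (atom_height Q R) * (\<integral>\<^sup>+y\<in>cube_set Q. ennreal \<bar>f y - cube_mean R\<bar> \<partial>M) \<le> ennreal (C + D + C1)"
    if Q: "is_cube M Q" and R: "is_cube M R" and sub: "cube_set Q \<subseteq> cube_set R" for Q R
  proof (cases Q)
    case (Cube x l)
    have x: "x \<in> msupp M" and l: "0 < l" using Q Cube by auto
    have S: "1 \<le> SS Q R" by (rule S_coeff_ge1[OF Q])
    have H: "0 \<le> atom_height Q R" by (rule atom_height_nonneg[OF Q])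
    have "osc f x l (cube_mean R)
        \<le> ennreal (C * mq x (2 * l)) + ennreal (\<bar>c x l - cube_mean R\<bar> * mq x l)"
      using osc_triangle[where x=x and l=l and v="cube_mean R" and w="c x l"] C(2)[OF x l] by (meson add_right_mono order_trans)
    also have "\<dots> \<le> ennreal (C * mq x (2 * l)) + ennreal (D * SS Q R * mq x (2 * l))"
      using D Q R sub Cube S l by (intro add_left_mono ennreal_leI mult_mono mq_mono qc_mono) auto
    also have "\<dots> = ennreal ((C + D * SS Q R) * mq x (2 * l))" using C D S by (simp add: distrib_right)
    finally have "ennreal (atom_height Q R) * (\<integral>\<^sup>+y\<in>cube_set Q. ennreal \<bar>f y - cube_mean R\<bar> \<partial>M)
        \<le> ennreal (atom_height Q R) * ennreal ((C + D * SS Q R) * mq x (2 * l))" unfolding Cube by (intro mult_left_mono) auto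
    also have "\<dots> = ennreal ((atom_height Q R * mq x (2 * l)) * (C + D * SS Q R))"
      using H by (simp add: mult_ac flip: ennreal_mult')
    also have "atom_height Q R * mq x (2 * l) = inverse (SS Q R)" using atom_height_mq Q Cube by simp
    also have "inverse (SS Q R) * (C + D * SS Q R) \<le> C + D + C1"
    proof -
      have "inverse (SS Q R) * (C + D * SS Q R) = C / SS Q R + D" using S by (simp add: field_simps)
      moreover have "C / SS Q R \<le> C / 1" using S C by (intro divide_left_mono) auto
      ultimately show ?thesis using C1_nonneg by simp
    qed
    finally show ?thesis by (simp add: ennreal_leI)
  next
    case Whole
    then have RW: "R = Whole" using Whole_subset_imp sub by blast
    have fin: "emeasure M UNIV < \<infinity>" using Q Whole by simp
    have "ennreal (atom_height Q R) * (\<integral>\<^sup>+y\<in>cube_set Q. ennreal \<bar>f y - cube_mean R\<bar> \<partial>M)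
        \<le> ennreal (atom_height Whole Whole) * ennreal (C1 * measure M UNIV)"
      using mean_osc_whole[OF fin] unfolding RW Whole by (intro mult_left_mono) (auto simp: cube_mean_def)
    also have "\<dots> = ennreal (atom_height Whole Whole * measure M UNIV * C1)"
      using atom_height_nonneg[of Whole Whole] fin C1_nonneg by (simp add: mult_ac flip: ennreal_mult')
    also have "\<dots> \<le> ennreal (C + D + C1)"
      using atom_height_Whole C1_nonneg C D mult_right_mono[OF atom_height_Whole, of C1] by (intro ennreal_leI) simp
    finally show ?thesis .
  qed
  show ?thesis
  proof (rule that[of "C + D + C1"])
    show "0 \<le> C + D + C1" using C D C1_nonneg by simp
    fix R b lam assume blk: "atomic_block M n R b lam"
    obtain a Q where R: "is_cube M R" and Q: "\<And>i. is_cube M (Q i)" "\<And>i. cube_set (Q i) \<subseteq> cube_set R" "\<And>i::nat. a i \<in> borel_measurable M"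
      "\<And>i. AE y in M. y \<notin> cube_set (Q i) \<longrightarrow> a i y = 0" "\<And>i. AE y in M. \<bar>a i y\<bar> \<le> atom_height (Q i) R"
      and b: "AE y in M. (\<lambda>i. lam i * a i y) sums b y"
      by (rule atomic_blockE[OF blk]) blast
    have "(\<integral>\<^sup>+y. ennreal \<bar>b y\<bar> * ennreal \<bar>f y - cube_mean R\<bar> \<partial>M)
        \<le> (\<Sum>i. ennreal \<bar>lam i\<bar> * (\<integral>\<^sup>+y. ennreal \<bar>a i y\<bar> * ennreal \<bar>f y - cube_mean R\<bar> \<partial>M))"
      using b Q(3) by (intro block_integral_le) auto
    also have "\<dots> \<le> (\<Sum>i. ennreal \<bar>lam i\<bar> * ennreal (C + D + C1))"
    proof (intro suminf_le summableI mult_left_mono)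
      fix i
      have "(\<integral>\<^sup>+y. ennreal \<bar>a i y\<bar> * ennreal \<bar>f y - cube_mean R\<bar> \<partial>M)
          \<le> ennreal (atom_height (Q i) R) * (\<integral>\<^sup>+y\<in>cube_set (Q i). ennreal \<bar>f y - cube_mean R\<bar> \<partial>M)"
        using Q by (intro atom_integral_le) auto
      also have "\<dots> \<le> ennreal (C + D + C1)" by (rule atom[OF Q(1) R Q(2)])
      finally show "(\<integral>\<^sup>+y. ennreal \<bar>a i y\<bar> * ennreal \<bar>f y - cube_mean R\<bar> \<partial>M) \<le> ennreal (C + D + C1)" .
    qed auto
    also have "\<dots> = ennreal (C + D + C1) * block_size lam" by (simp add: block_size_def mult.commute)
    finally show "(\<integral>\<^sup>+y. ennreal \<bar>b y\<bar> * ennreal \<bar>f y - cube_mean R\<bar> \<partial>M) \<le> ennreal (C + D + C1) * block_size lam" .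
  qed
qed

text \<open>On the support this counts the heights t0 + k A below \<Phi>: a measurable integer
  substitute for (\<Phi> - t0) / A, possibly infinite.\<close>

definition level_count :: "real \<Rightarrow> real \<Rightarrow> real^'d \<Rightarrow> ennreal" where
  "level_count t0 A x = (\<Sum>k. indicator (msupp M \<inter> level (t0 + real k * A)) x)"

lemma mean_le_count:
  assumes "x \<in> msupp M" "0 < l" "0 < A" "0 \<le> t0"
  shows "ennreal \<bar>c x l\<bar> \<le> ennreal t0 + ennreal A * level_count t0 A x"
proof -
  define m where "m = nat \<lceil>(\<bar>c x l\<bar> - t0) / A\<rceil>"
  have mem: "x \<in> msupp M \<inter> level (t0 + real k * A)" if "k < m" for k
  proof -
    have "real k < (\<bar>c x l\<bar> - t0) / A" using that unfolding m_def by linarith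
    then have "t0 + real k * A < \<bar>c x l\<bar>" using assms by (simp add: pos_less_divide_eq)
    moreover have "x \<in> oqc x l" using assms by (simp add: oqc_def)
    ultimately show ?thesis using assms by (auto intro: levelI)
  qed
  have "(\<bar>c x l\<bar> - t0) / A \<le> real m" unfolding m_def by linarith
  then have "\<bar>c x l\<bar> \<le> t0 + A * real m" using assms by (simp add: divide_le_eq mult.commute)
  then have "ennreal \<bar>c x l\<bar> \<le> ennreal t0 + ennreal A * ennreal (real m)"
    using assms by (simp flip: ennreal_mult ennreal_plus)
  also have "ennreal (real m) = (\<Sum>k<m. indicator (msupp M \<inter> level (t0 + real k * A)) x)"
    using mem by (simp add: ennreal_of_nat_eq_real_of_nat)
  also have "\<dots> \<le> level_count t0 A x" unfolding level_count_def by (intro sum_le_suminf) auto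
  finally show ?thesis by (simp add: add_left_mono mult_left_mono)
qed

text \<open>Inside 2R, |c(R)| is at most \<Phi>(x) plus a constant and the block is estimated atom
  by atom. Outside 2R the cancellation of the whole block is used, and |c(R)| exceeds \<Phi>(x) by
  at most a multiple of k + 1, the weight in \<open>tail_majorant\<close>. \<open>G\<close> is
  chosen before x and \<phi>, so that it can be summed over the blocks.\<close>

lemma block_maximal:
  assumes A: "0 < A" and t0: "0 \<le> t0"
  shows "\<exists>a>0. \<forall>R b lam. atomic_block M n R b lam \<longrightarrow> (\<exists>G\<in>borel_measurable M.
    (\<integral>\<^sup>+x. G x \<partial>M) \<le> ennreal a * block_size lam \<and>
    (\<forall>x\<in>msupp M. \<forall>\<phi>\<in>F_class M n x \<inter> test_fun.
       ennreal \<bar>cube_mean R * (\<integral>y. b y * \<phi> y \<partial>M)\<bar> \<le> ennreal a * (1 + level_count t0 A x) * G x))"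
proof -
  define J where "J = level_count t0 A"
  define E where "E = C1 * (1 + 4 * C0)"
  have E: "0 \<le> E" using C1_nonneg C0_pos by (simp add: E_def)
  define U where "U = 1 + 8 ^ n * (1 + 2 * C0)"
  define V where "V = real CARD('d) * 8 ^ n * C0 * 4"
  have UV: "0 \<le> U" "0 \<le> V" using C0_pos by (auto simp: U_def V_def)
  define a where "a = t0 + A + E + C1 + U + V + 1"
  have a: "t0 + E \<le> a" "A \<le> a" "C1 \<le> a" "U + V \<le> a" "0 < a" using A t0 E C1_nonneg UV by (auto simp: a_def)
  have mean_le: "ennreal \<bar>v\<bar> \<le> ennreal a * (1 + J x) * ennreal (real (Suc k))"
    if x: "x \<in> msupp M" and l: "0 < l" and v: "\<bar>v\<bar> \<le> \<bar>c x l\<bar> + E * real (Suc k)" for x l v k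
  proof -
    have "ennreal \<bar>v\<bar> \<le> ennreal \<bar>c x l\<bar> + ennreal (E * real (Suc k))"
      using v E by (simp flip: ennreal_plus add: ennreal_leI)
    also have "ennreal \<bar>c x l\<bar> \<le> ennreal t0 + ennreal A * J x" unfolding J_def by (rule mean_le_count[OF x l A t0])
    also have "ennreal t0 + ennreal A * J x + ennreal (E * real (Suc k))
        \<le> (ennreal t0 + ennreal A * J x) * ennreal (real (Suc k)) + ennreal E * ennreal (real (Suc k))"
    proof (rule add_mono)
      have "(ennreal t0 + ennreal A * J x) * ennreal 1 \<le> (ennreal t0 + ennreal A * J x) * ennreal (real (Suc k))"
        by (intro mult_left_mono ennreal_leI) auto
      then show "ennreal t0 + ennreal A * J x \<le> (ennreal t0 + ennreal A * J x) * ennreal (real (Suc k))" by simp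
    qed (use E in \<open>simp add: ennreal_mult del: of_nat_Suc\<close>)
    also have "\<dots> = (ennreal (t0 + E) + ennreal A * J x) * ennreal (real (Suc k))"
      using t0 E by (simp add: distrib_right add_ac del: of_nat_Suc)
    also have "\<dots> \<le> (ennreal a * 1 + ennreal a * J x) * ennreal (real (Suc k))"
      using a by (intro mult_right_mono add_mono) (auto intro: ennreal_leI)
    finally show ?thesis by (simp add: distrib_left add_right_mono mult_right_mono)
  qed
  show ?thesis unfolding J_def[symmetric]
  proof (intro exI[of _ a] conjI allI impI)
    show "0 < a" by (rule a)
    fix R b lam assume blk: "atomic_block M n R b lam"
    obtain \<alpha> Q where R: "is_cube M R" and bm: "b \<in> borel_measurable M" "integrable M b" "(\<integral>y. b y \<partial>M) = 0"
        "AE y in M. y \<notin> cube_set R \<longrightarrow> b y = 0"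
      and Q: "\<And>i. is_cube M (Q i)" "\<And>i. cube_set (Q i) \<subseteq> cube_set R" "\<And>i::nat. \<alpha> i \<in> borel_measurable M"
      "\<And>i. AE y in M. y \<notin> cube_set (Q i) \<longrightarrow> \<alpha> i y = 0" "\<And>i. AE y in M. \<bar>\<alpha> i y\<bar> \<le> atom_height (Q i) R"
      and b: "AE y in M. (\<lambda>i. lam i * \<alpha> i y) sums b y"
      by (rule atomic_blockE[OF blk]) blast
    note [measurable] = bm(1)
    define G1 where "G1 x = (\<Sum>i. ennreal \<bar>lam i\<bar> * atom_majorant (Q i) R x)" for x
    define G where "G x = G1 x + block_size lam * tail_majorant R x" for x
    have [measurable]: "G1 \<in> borel_measurable M" unfolding G1_def by measurable
    have G: "G \<in> borel_measurable M" unfolding G_def by measurable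
    have "(\<integral>\<^sup>+x. G x \<partial>M) = (\<Sum>i. ennreal \<bar>lam i\<bar> * (\<integral>\<^sup>+x. atom_majorant (Q i) R x \<partial>M)) + block_size lam * (\<integral>\<^sup>+x. tail_majorant R x \<partial>M)"
      unfolding G_def G1_def by (simp add: nn_integral_add nn_integral_suminf nn_integral_cmult)
    also have "\<dots> \<le> (\<Sum>i. ennreal \<bar>lam i\<bar> * ennreal U) + block_size lam * ennreal V"
      unfolding U_def V_def
      by (intro add_mono suminf_le summableI mult_left_mono atom_majorant_integral tail_majorant_integral Q R) auto
    also have "\<dots> = ennreal (U + V) * block_size lam"
      using UV by (simp add: block_size_def distrib_right mult.commute)
    also have "\<dots> \<le> ennreal a * block_size lam" using a by (intro mult_right_mono ennreal_leI) auto
    finally have int: "(\<integral>\<^sup>+x. G x \<partial>M) \<le> ennreal a * block_size lam" .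
    have "ennreal \<bar>cube_mean R * (\<integral>y. b y * \<phi> y \<partial>M)\<bar> \<le> ennreal a * (1 + J x) * G x"
      if x: "x \<in> msupp M" and phi: "\<phi> \<in> F_class M n x" and test: "\<phi> \<in> test_fun" for x \<phi>
    proof (cases "x \<in> cube_set (dilate 2 R)")
      case True
      note F = F_classD[OF phi]
      have "ennreal \<bar>\<integral>y. b y * \<phi> y \<partial>M\<bar> \<le> (\<integral>\<^sup>+y. ennreal \<bar>b y * \<phi> y\<bar> \<partial>M)" by (rule ennreal_abs_integral_le)
      also have "\<dots> = (\<integral>\<^sup>+y. ennreal \<bar>b y\<bar> * ennreal (\<phi> y) \<partial>M)" using F(2) by (simp add: abs_mult ennreal_mult)
      also have "\<dots> \<le> (\<Sum>i. ennreal \<bar>lam i\<bar> * (\<integral>\<^sup>+y. ennreal \<bar>\<alpha> i y\<bar> * ennreal (\<phi> y) \<partial>M))"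
        using b Q(3) F(3) by (intro block_integral_le) auto
      also have "\<dots> \<le> G1 x" unfolding G1_def
      proof (intro suminf_le summableI mult_left_mono)
        fix i
        show "(\<integral>\<^sup>+y. ennreal \<bar>\<alpha> i y\<bar> * ennreal (\<phi> y) \<partial>M) \<le> atom_majorant (Q i) R x"
          using atom_maximal_le[OF Q(1) R Q(2) True phi Q(4) Q(5)] F(2) by (simp add: ennreal_mult)
      qed auto
      also have "\<dots> \<le> G x" by (simp add: G_def)
      finally have 1: "ennreal \<bar>\<integral>y. b y * \<phi> y \<partial>M\<bar> \<le> G x" .
      have 2: "ennreal \<bar>cube_mean R\<bar> \<le> ennreal a * (1 + J x)"
      proof (cases R)
        case (Cube z r)
        have zr: "z \<in> msupp M" "0 < r" using R Cube by auto
        have "x \<in> qc z (2 * r)" using True Cube by simp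
        \<comment> \<open>The centre moves to x because \<open>mean_le\<close> counts levels through
          cubes centred at x; the side 4r is only two doublings away.\<close>
        then have "z \<in> qc x (4 * r)" using qc_sym[of x z "2 * r"] qc_mono[of "2 * r" "4 * r" x] zr by auto
        then have "\<bar>c z r - c x (4 * r)\<bar> \<le> C1 * (1 + C0 * (real 2 + 1))" using zr x by (intro mean_close) auto
        also have "\<dots> \<le> E" unfolding E_def using C1_nonneg C0_pos by (intro mult_left_mono) auto
        finally show ?thesis using mean_le[OF x, of "4 * r" "c z r" 0] zr by (simp add: cube_mean_def Cube)
      next
        case Whole
        then have "\<bar>cube_mean R\<bar> \<le> a" using mean_whole R a by (simp add: cube_mean_def)
        then have "ennreal \<bar>cube_mean R\<bar> \<le> ennreal a * 1" by (simp add: ennreal_leI)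
        also have "\<dots> \<le> ennreal a * (1 + J x)" by (intro mult_left_mono) auto
        finally show ?thesis .
      qed
      show ?thesis unfolding abs_mult using 1 2 by (subst ennreal_mult) (auto intro: mult_mono)
    next
      case False
      then obtain z r where Rc: "R = Cube z r" by (cases R) auto
      have zr: "z \<in> msupp M" "0 < r" using R Rc by auto
      have "x \<notin> qc z (2 * r)" using False Rc by simp
      from F_class_tail[OF zr(2) this phi] obtain k where k: "x \<in> qc z (2 ^ (k + 2) * r)"
        "\<And>y. y \<in> qc z r \<Longrightarrow> \<bar>\<phi> y - \<phi> z\<bar> \<le> tail_coeff r k" by blast
      have t: "0 \<le> tail_coeff r k" using zr by (simp add: tail_coeff_def)
      have 1: "ennreal \<bar>\<integral>y. b y * \<phi> y \<partial>M\<bar> \<le> ennreal (tail_coeff r k) * block_size lam"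
        using t k(2) by (intro block_cancel[OF blk test, of _ "\<phi> z"]) (auto simp: Rc)
      \<comment> \<open>The side of a cube around x that contains z. The k + 3 doublings from r to s
        produce the linear growth in k.\<close>
      define s where "s = 2 ^ (k + 3) * r"
      have s: "0 < s" using zr by (simp add: s_def)
      have "2 ^ (k + 2) * r \<le> s" unfolding s_def using zr by (intro mult_right_mono power_increasing) auto
      then have "z \<in> qc x s" using k(1) qc_sym[of x z] qc_mono[of "2 ^ (k + 2) * r" s x] by auto
      moreover have "r \<le> s" unfolding s_def using zr mult_right_mono[of 1 "2 ^ (k + 3)" r] one_le_power[of "2::real" "k+3"] by simp
      ultimately have "\<bar>c z r - c x s\<bar> \<le> C1 * (1 + C0 * (real (k + 3) + 1))"
        using zr x by (intro mean_close) (auto simp: s_def)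
      also have "\<dots> \<le> E * real (Suc k)"
      proof -
        have "1 + C0 * (real (k + 3) + 1) \<le> (1 + 4 * C0) * real (Suc k)" using C0_pos by (simp add: algebra_simps)
        then show ?thesis unfolding E_def mult.assoc using C1_nonneg by (intro mult_left_mono)
      qed
      finally have 2: "ennreal \<bar>cube_mean R\<bar> \<le> ennreal a * (1 + J x) * ennreal (real (Suc k))"
        using s by (intro mean_le[OF x, of s]) (auto simp: cube_mean_def Rc)
      have "ennreal \<bar>cube_mean R * (\<integral>y. b y * \<phi> y \<partial>M)\<bar>
          \<le> ennreal a * (1 + J x) * ennreal (real (Suc k)) * (ennreal (tail_coeff r k) * block_size lam)"
        unfolding abs_mult using 1 2 by (subst ennreal_mult) (auto intro: mult_mono)
      also have "\<dots> = ennreal a * (1 + J x) * (block_size lam * ennreal (real (Suc k) * tail_coeff r k))"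
        using t by (subst ennreal_mult) (auto simp: mult_ac)
      also have "\<dots> \<le> ennreal a * (1 + J x) * G x"
      proof (intro mult_left_mono)
        have "ennreal (real (Suc k) * tail_coeff r k) \<le> tail_majorant R x"
          unfolding tail_majorant_def Rc cube.case
          using ennreal_le_suminf[of "\<lambda>k. ennreal (real (Suc k) * tail_coeff r k) * indicator (qc z (2 ^ (k + 2) * r)) x" k] k(1)
          by (simp only: indicator_simps mult_1_right)
        then have "block_size lam * ennreal (real (Suc k) * tail_coeff r k) \<le> block_size lam * tail_majorant R x"
          by (intro mult_left_mono) auto
        also have "\<dots> \<le> G x" by (simp add: G_def)
        finally show "block_size lam * ennreal (real (Suc k) * tail_coeff r k) \<le> G x" .
      qed auto
      finally show ?thesis .
    qed
    then show "\<exists>G\<in>borel_measurable M. (\<integral>\<^sup>+x. G x \<partial>M) \<le> ennreal a * block_size lam \<and>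
      (\<forall>x\<in>msupp M. \<forall>\<phi>\<in>F_class M n x \<inter> test_fun.
         ennreal \<bar>cube_mean R * (\<integral>y. b y * \<phi> y \<partial>M)\<bar> \<le> ennreal a * (1 + J x) * G x)"
      by (intro bexI[OF _ G] conjI int ballI) (elim IntE)
  qed
qed

text \<open>With sc l = -k the mean is at most linear in k by \<open>mean_log_bound\<close>, while l
  \<le> 2^(-k), and k 2^(-k) is bounded.\<close>

lemma mean_times_side:
  assumes "x \<in> msupp M" "0 < l" "l \<le> 1" shows "\<bar>c x l\<bar> * l \<le> C1 * (2 + 3 * C0)"
proof -
  define k where "k = nat (- sc l)"
  have "sc l \<le> sc 1" using assms by (intro sc_mono) auto
  then have k: "sc l = - int k" by (simp add: k_def sc_def)
  have "\<bar>c x l\<bar> \<le> C1 * (2 + C0 * (2 + real k))" using assms k by (intro mean_log_bound) auto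
  then have "\<bar>c x l\<bar> * l \<le> C1 * (2 + C0 * (2 + real k)) * l" using assms by (intro mult_right_mono) auto
  also have "\<dots> = C1 * (2 * l + C0 * (2 * l + real k * l))" by (simp add: algebra_simps)
  also have "\<dots> \<le> C1 * (2 * 1 + C0 * (2 * 1 + 1))"
  proof (intro mult_left_mono add_mono)
    have "l \<le> 2 powr (- real k)" using sc_bounds(1)[OF assms(2)] k by simp
    then have "l * 2 ^ k \<le> 1" by (simp add: powr_minus powr_realpow divide_simps)
    moreover have "real k * l \<le> 2 ^ k * l" using assms of_nat_less_two_power[of k] by (intro mult_right_mono) (auto intro: less_imp_le)
    ultimately show "real k * l \<le> 1" by (simp add: mult.commute)
  qed (use assms C1_nonneg C0_pos in auto)
  finally show ?thesis by (simp add: algebra_simps)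
qed

text \<open>On small cubes the cancellation of b gains the side of R, which outweighs the
  logarithmic growth of c(R); on large cubes c(R) is bounded. One derivative of \<phi> enters, so
  the second series will be a distribution of order at most one.\<close>

lemma block_test_bound:
  obtains C where "0 \<le> C" "\<And>R b lam (\<phi> :: real^'d \<Rightarrow> real) b0 b1. atomic_block M n R b lam \<Longrightarrow> \<phi> \<in> test_fun \<Longrightarrow>
    0 \<le> b0 \<Longrightarrow> 0 \<le> b1 \<Longrightarrow> (\<And>y. \<bar>\<phi> y\<bar> \<le> b0) \<Longrightarrow> (\<And>y. norm (grad \<phi> y) \<le> b1) \<Longrightarrow>
    ennreal \<bar>cube_mean R * (\<integral>y. b y * \<phi> y \<partial>M)\<bar> \<le> ennreal (C * (b0 + b1)) * block_size lam"
proof -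
  define E where "E = C1 * (2 + 3 * C0) * real CARD('d)"
  have E: "0 \<le> E" using C1_nonneg C0_pos by (simp add: E_def)
  show ?thesis
  proof (rule that[of "C1 + E"])
    show "0 \<le> C1 + E" using C1_nonneg E by simp
    fix R b lam and \<phi> :: "real^'d \<Rightarrow> real" and b0 b1 :: real
    assume blk: "atomic_block M n R b lam" and test: "\<phi> \<in> test_fun"
      and b0: "0 \<le> b0" "\<And>y. \<bar>\<phi> y\<bar> \<le> b0" and b1: "0 \<le> b1" "\<And>y. norm (grad \<phi> y) \<le> b1"
    have R: "is_cube M R" using blk by (simp add: atomic_block_def)
    have bound: "ennreal \<bar>v * (\<integral>y. b y * \<phi> y \<partial>M)\<bar> \<le> ennreal ((C1 + E) * (b0 + b1)) * block_size lam"
      if w: "\<bar>v\<bar> * B \<le> (C1 + E) * (b0 + b1)" "0 \<le> B" and psi: "\<And>y. y \<in> cube_set R \<Longrightarrow> \<bar>\<phi> y - u\<bar> \<le> B" for v B u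
    proof -
      have "ennreal \<bar>v * (\<integral>y. b y * \<phi> y \<partial>M)\<bar> \<le> ennreal \<bar>v\<bar> * (ennreal B * block_size lam)"
        unfolding abs_mult using block_cancel[OF blk test w(2) psi] by (subst ennreal_mult) (auto intro: mult_left_mono)
      also have "\<dots> = ennreal (\<bar>v\<bar> * B) * block_size lam" using w by (simp add: ennreal_mult mult.assoc)
      also have "\<dots> \<le> ennreal ((C1 + E) * (b0 + b1)) * block_size lam" using w by (intro mult_right_mono ennreal_leI) auto
      finally show ?thesis .
    qed
    show "ennreal \<bar>cube_mean R * (\<integral>y. b y * \<phi> y \<partial>M)\<bar> \<le> ennreal ((C1 + E) * (b0 + b1)) * block_size lam"
    proof (cases "\<exists>z r. R = Cube z r \<and> r \<le> 1")
      case True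
      then obtain z r where Rc: "R = Cube z r" "r \<le> 1" by blast
      have zr: "z \<in> msupp M" "0 < r" using R Rc by auto
      have d: "\<phi> differentiable (at w)" for w using test_fun_C1[OF test] by (simp add: C1_def)
      show ?thesis
      proof (rule bound)
        show "0 \<le> b1 * (real CARD('d) * r)" using b1 zr by simp
        have "\<bar>c z r\<bar> * r * (real CARD('d) * b1) \<le> C1 * (2 + 3 * C0) * (real CARD('d) * b1)"
          using mean_times_side[OF zr Rc(2)] b1 by (intro mult_right_mono) auto
        also have "\<dots> = E * b1" by (simp add: E_def)
        also have "\<dots> \<le> (C1 + E) * (b0 + b1)" using E C1_nonneg b0 b1 by (intro mult_mono) auto
        finally show "\<bar>cube_mean R\<bar> * (b1 * (real CARD('d) * r)) \<le> (C1 + E) * (b0 + b1)"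
          by (simp add: cube_mean_def Rc mult_ac)
        fix y assume y: "y \<in> cube_set R"
        have "\<bar>\<phi> y - \<phi> z\<bar> \<le> b1 * norm (y - z)"
          using b1 d by (intro grad_bound_imp_Lipschitz[of UNIV]) auto
        also have "\<dots> \<le> b1 * (real CARD('d) * r)"
        proof (rule mult_left_mono[OF _ b1(1)])
          have "norm (y - z) \<le> real CARD('d) * r / 2" using norm_le_qc[of y z r] y by (simp add: Rc)
          then show "norm (y - z) \<le> real CARD('d) * r" using norm_ge_zero[of "y - z"] by linarith
        qed
        finally show "\<bar>\<phi> y - \<phi> z\<bar> \<le> b1 * (real CARD('d) * r)" .
      qed
    next
      case False
      have "\<bar>cube_mean R\<bar> \<le> C1"
        using False R mean_large mean_whole by (cases R) (auto simp: cube_mean_def not_le)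
      then have "\<bar>cube_mean R\<bar> * b0 \<le> (C1 + E) * (b0 + b1)" using E C1_nonneg b0 b1 by (intro mult_mono) auto
      then show ?thesis using b0 by (intro bound[of _ b0 0]) auto
    qed
  qed
qed

end


section \<open>Distributions\<close>

lemma has_derivative_scale_partial:
  assumes "\<phi> differentiable (at y)"
  shows "partial i (\<lambda>y. q * \<phi> y) y = q * partial i \<phi> y" "(\<lambda>y. q * \<phi> y) differentiable (at y)"
proof -
  have d: "((\<lambda>y. q * \<phi> y) has_derivative (\<lambda>h. q * frechet_derivative \<phi> (at y) h)) (at y)"
    using assms by (intro has_derivative_mult_right) (simp add: frechet_derivative_works)
  from frechet_derivative_at[OF d] show "partial i (\<lambda>y. q * \<phi> y) y = q * partial i \<phi> y"
    unfolding partial_def by (metis (no_types))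
  from d show "(\<lambda>y. q * \<phi> y) differentiable (at y)" by (rule differentiableI)
qed

lemma partials_scale:
  assumes "\<And>is y. partials is \<phi> differentiable (at y)"
  shows "partials is (\<lambda>y. q * \<phi> y) = (\<lambda>y. q * partials is \<phi> y)"
proof (induction "is")
  case (Cons i "is")
  have "partials (i # is) (\<lambda>y. q * \<phi> y) = partial i (\<lambda>y. q * partials is \<phi> y)"
    using Cons by (simp add: partials_def)
  also have "\<dots> = (\<lambda>y. q * partial i (partials is \<phi>) y)"
    using has_derivative_scale_partial(1)[OF assms] by blast
  finally show ?case by (simp add: partials_def)
qed (simp add: partials_def)

lemma test_fun_scale:
  assumes "\<phi> \<in> test_fun" "q \<noteq> 0" shows "(\<lambda>y. q * \<phi> y) \<in> test_fun"
proof -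
  have d: "partials is \<phi> differentiable (at y)" for "is" y using assms by (simp add: test_fun_def)
  have "partials is (\<lambda>y. q * \<phi> y) differentiable (at y)" for "is" y
    unfolding partials_scale[OF d] by (rule has_derivative_scale_partial(2)[OF d])
  moreover have "{y. q * \<phi> y \<noteq> 0} = {y. \<phi> y \<noteq> 0}" using assms by auto
  ultimately show ?thesis using assms by (simp add: test_fun_def)
qed

lemma grad_scale:
  assumes "\<phi> differentiable (at y)" shows "grad (\<lambda>y. q * \<phi> y) y = q *\<^sub>R grad \<phi> y"
  using has_derivative_scale_partial(1)[OF assms] by (simp add: grad_def vec_eq_iff)

lemma norm_grad_le:
  fixes \<phi> :: "real^'d \<Rightarrow> real"
  assumes "\<And>i. \<bar>partial i \<phi> y\<bar> \<le> e" shows "norm (grad \<phi> y) \<le> real CARD('d) * e"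
proof -
  have "norm (grad \<phi> y) \<le> (\<Sum>i\<in>UNIV. \<bar>grad \<phi> y $ i\<bar>)" by (rule norm_le_l1_cart)
  also have "\<dots> \<le> (\<Sum>i\<in>(UNIV::'d set). e)" using assms by (intro sum_mono) (simp add: grad_def)
  finally show ?thesis by simp
qed

lemma test_fun_grad_bounded:
  fixes \<phi> :: "real^'d \<Rightarrow> real"
  assumes "\<phi> \<in> test_fun"
  obtains B where "0 \<le> B" "\<And>y. norm (grad \<phi> y) \<le> B"
proof -
  let ?S = "{y. \<phi> y \<noteq> 0}"
  have c: "compact (closure (closure ?S))" using assms by (simp add: test_fun_def)
  have "grad \<phi> y = 0" if "y \<notin> closure ?S" for y
  proof -
    have "(\<phi> has_derivative (\<lambda>_. 0)) (at y)"
    proof (rule has_derivative_transform_within_open[of "\<lambda>_. 0" "\<lambda>_. 0" y UNIV "- closure ?S"])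
      show "0 = \<phi> x" if "x \<in> - closure ?S" for x using that closure_subset[of ?S] by auto
    qed (use that in auto)
    from frechet_derivative_at[OF this] show ?thesis
      unfolding grad_def partial_def by (simp add: vec_eq_iff flip: fun_cong[OF \<open>_ = frechet_derivative \<phi> (at y)\<close>])
  qed
  moreover have "continuous_on UNIV (grad \<phi>)" using test_fun_C1[OF assms] by (simp add: C1_def)
  ultimately show ?thesis using compact_support_bounded[OF c] that by blast
qed

text \<open>Sequential continuity follows from uniform convergence of the functions and of their
  first partial derivatives, the lists of length 0 and 1.\<close>

lemma distributionI_bound:
  fixes T :: "(real^'d \<Rightarrow> real) \<Rightarrow> real"
  assumes add: "\<And>\<phi> \<psi>. \<phi> \<in> test_fun \<Longrightarrow> \<psi> \<in> test_fun \<Longrightarrow> T (\<lambda>y. \<phi> y + \<psi> y) = T \<phi> + T \<psi>"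
    and scale: "\<And>c \<psi>. \<psi> \<in> test_fun \<Longrightarrow> T (\<lambda>y. c * \<psi> y) = c * T \<psi>"
    and K: "0 \<le> K" and bound: "\<And>\<phi> b0 b1. \<phi> \<in> test_fun \<Longrightarrow> 0 \<le> b0 \<Longrightarrow> 0 \<le> b1 \<Longrightarrow> (\<And>y. \<bar>\<phi> y\<bar> \<le> b0) \<Longrightarrow>
      (\<And>y. norm (grad \<phi> y) \<le> b1) \<Longrightarrow> \<bar>T \<phi>\<bar> \<le> K * (b0 + b1)"
  shows "distribution T"
  unfolding distribution_def
proof (intro conjI ballI allI impI)
  fix \<psi> :: "nat \<Rightarrow> real^'d \<Rightarrow> real" and S
  assume A: "(\<forall>k. \<psi> k \<in> test_fun \<and> {y. \<psi> k y \<noteq> 0} \<subseteq> S) \<and> compact S \<and>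
        (\<forall>is. uniform_limit UNIV (\<lambda>k. partials is (\<psi> k)) (\<lambda>_. 0) sequentially)"
  show "(\<lambda>k. T (\<psi> k)) \<longlonglongrightarrow> 0"
  proof (rule tendstoI)
    fix e :: real assume e: "0 < e"
    let ?d = "1 + real CARD('d)"
    define e' where "e' = e / ((K + 1) * ?d)"
    have e': "0 < e'" unfolding e'_def using e K by (intro divide_pos_pos mult_pos_pos) auto
    have u: "\<forall>\<^sub>F k in sequentially. \<forall>y\<in>UNIV. dist (partials is (\<psi> k) y) 0 < e'" for "is"
      using A e' unfolding uniform_limit_iff by blast
    have "\<forall>\<^sub>F k in sequentially. \<forall>y. \<bar>\<psi> k y\<bar> < e'" using u[of "[]"] by (simp add: partials_def)
    moreover have "\<forall>\<^sub>F k in sequentially. \<forall>i. \<forall>y. \<bar>partial i (\<psi> k) y\<bar> < e'"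
    proof (rule eventually_all_finite)
      show "\<forall>\<^sub>F k in sequentially. \<forall>y. \<bar>partial i (\<psi> k) y\<bar> < e'" for i
        using u[of "[i]"] by (simp add: partials_def)
    qed
    ultimately show "\<forall>\<^sub>F k in sequentially. dist (T (\<psi> k)) 0 < e"
    proof eventually_elim
      fix k assume 1: "\<forall>y. \<bar>\<psi> k y\<bar> < e'" and 2: "\<forall>i. \<forall>y. \<bar>partial i (\<psi> k) y\<bar> < e'"
      have "\<bar>T (\<psi> k)\<bar> \<le> K * (e' + real CARD('d) * e')"
      proof (rule bound)
        show "\<psi> k \<in> test_fun" using A by blast
        show "\<bar>\<psi> k y\<bar> \<le> e'" for y using 1 by (simp add: less_imp_le)
        show "norm (grad (\<psi> k) y) \<le> real CARD('d) * e'" for y using 2 by (intro norm_grad_le) (simp add: less_imp_le)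
      qed (use e' in auto)
      also have "\<dots> = K * (?d * e')" by (simp add: algebra_simps)
      also have "\<dots> < (K + 1) * (?d * e')" using e' by (intro mult_strict_right_mono) auto
      also have "\<dots> = e" using K by (simp add: e'_def)
      finally show "dist (T (\<psi> k)) 0 < e" by simp
    qed
  qed
qed (use add scale in auto)

text \<open>Scaling by a factor less than one creates room to move the centre of the class
  \<open>F_class\<close>; hence maximal functions are lower semicontinuous.\<close>

lemma weighted_bound_perturb:
  fixes g :: "real^'d \<Rightarrow> real"
  assumes g: "\<And>y. 0 \<le> g y" "\<And>y. g y \<le> B" and m: "0 < m" and le: "\<And>y. g y * norm (y - x) ^ m \<le> 1" and q: "0 < q" "q < 1"
  obtains \<delta> where "0 < \<delta>" "\<And>x' y. dist x' x < \<delta> \<Longrightarrow> q * g y * norm (y - x') ^ m \<le> 1"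
proof -
  have B: "0 \<le> B" using g[of undefined] by linarith
  \<comment> \<open>If |y - x| < a, then |y - x'| is at most 1 / (B + 1) and the bound on g
    suffices. Otherwise |y - x'| \<le> (1 + \<epsilon>) |y - x|, and q (1 + \<epsilon>)^m = 1 pays
    for it.\<close>
  define a where "a = 1 / (2 * (B + 1))"
  have a: "0 < a" using B by (simp add: a_def)
  define \<epsilon> where "\<epsilon> = root m (1 / q) - 1"
  have "root m 1 < root m (1 / q)" using q m by (intro real_root_less_mono) auto
  then have eps: "0 < \<epsilon>" using m by (simp add: \<epsilon>_def)
  have q1: "q * (1 + \<epsilon>) ^ m = 1" using q m by (simp add: \<epsilon>_def)
  show ?thesis
  proof (rule that[of "min a (\<epsilon> * a)"])
    show "0 < min a (\<epsilon> * a)" using a eps by simp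
    fix x' y assume d: "dist x' x < min a (\<epsilon> * a)"
    have tri: "norm (y - x') \<le> norm (y - x) + dist x' x"
      using norm_triangle_ineq[of "y - x" "x - x'"] by (simp add: dist_norm norm_minus_commute)
    show "q * g y * norm (y - x') ^ m \<le> 1"
    proof (cases "norm (y - x) < a")
      case True
      have "a + a = 1 / (B + 1)" using B by (simp add: a_def field_simps)
      then have n: "norm (y - x') \<le> 1 / (B + 1)" using True tri d by linarith
      have "norm (y - x') ^ m \<le> (1 / (B + 1)) ^ m" using n by (intro power_mono) auto
      also have "\<dots> \<le> (1 / (B + 1)) ^ 1" using m B by (intro power_decreasing) auto
      finally have p: "norm (y - x') ^ m \<le> 1 / (B + 1)" by simp
      have "q * g y \<le> 1 * B" using q g[of y] B by (intro mult_mono) auto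
      then have "q * g y * norm (y - x') ^ m \<le> B * (1 / (B + 1))" using p q g[of y] B by (intro mult_mono) auto
      also have "\<dots> \<le> 1" using B by simp
      finally show ?thesis .
    next
      case False
      have "\<epsilon> * a \<le> \<epsilon> * norm (y - x)" using False eps by (intro mult_left_mono) auto
      then have "norm (y - x') \<le> norm (y - x) + \<epsilon> * norm (y - x)" using tri d by linarith
      also have "\<dots> = (1 + \<epsilon>) * norm (y - x)" by (simp add: algebra_simps)
      finally have "norm (y - x') ^ m \<le> ((1 + \<epsilon>) * norm (y - x)) ^ m" by (intro power_mono) auto
      then have "q * g y * norm (y - x') ^ m \<le> q * g y * ((1 + \<epsilon>) * norm (y - x)) ^ m"
        using q g[of y] by (intro mult_left_mono) auto
      also have "\<dots> = (q * (1 + \<epsilon>) ^ m) * (g y * norm (y - x) ^ m)" by (simp add: power_mult_distrib mult_ac)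
      also have "\<dots> \<le> 1" unfolding q1 using le[of y] by simp
      finally show ?thesis .
    qed
  qed
qed

context growth_space
begin

text \<open>Multiplying out removes the exception y = x: there the products vanish because the
  exponents are positive.\<close>

lemma F_class_iff:
  "\<phi> \<in> F_class M n x \<longleftrightarrow> \<phi> \<in> C1 \<and> integrable M \<phi> \<and> (\<integral>y. \<bar>\<phi> y\<bar> \<partial>M) \<le> 1 \<and> (\<forall>y. 0 \<le> \<phi> y) \<and>
     (\<forall>y. \<phi> y * norm (y - x) ^ n \<le> 1) \<and> (\<forall>y. norm (grad \<phi> y) * norm (y - x) ^ (n + 1) \<le> 1)"
proof -
  have "(y \<noteq> x \<longrightarrow> v \<le> 1 / norm (y - x) ^ m) \<longleftrightarrow> v * norm (y - x) ^ m \<le> 1" if "0 < m" for v :: real and y m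
    using that by (cases "y = x") (auto simp: pos_le_divide_eq zero_power)
  note e = this
  have "(\<forall>y. y \<noteq> x \<longrightarrow> \<phi> y \<le> 1 / norm (y - x) ^ n \<and> norm (grad \<phi> y) \<le> 1 / norm (y - x) ^ (n + 1)) \<longleftrightarrow>
      (\<forall>y. \<phi> y * norm (y - x) ^ n \<le> 1) \<and> (\<forall>y. norm (grad \<phi> y) * norm (y - x) ^ (n + 1) \<le> 1)"
    unfolding e[OF n_pos, symmetric] e[of "n + 1", OF add_pos_pos[OF n_pos zero_less_one], symmetric] by blast
  then show ?thesis unfolding F_class_def by simp
qed

lemma F_class_perturb:
  assumes phi: "\<phi> \<in> F_class M n x" "\<phi> \<in> test_fun" and q: "0 < q" "q < 1"
  obtains \<delta> where "0 < \<delta>" "\<And>x'. dist x' x < \<delta> \<Longrightarrow> (\<lambda>y. q * \<phi> y) \<in> F_class M n x'"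
proof -
  have F: "\<phi> \<in> C1" "integrable M \<phi>" "(\<integral>y. \<bar>\<phi> y\<bar> \<partial>M) \<le> 1" "\<And>y. 0 \<le> \<phi> y" "\<And>y. \<phi> y * norm (y - x) ^ n \<le> 1"
    "\<And>y. norm (grad \<phi> y) * norm (y - x) ^ (n + 1) \<le> 1"
    using phi(1) unfolding F_class_iff by auto
  have d: "\<phi> differentiable (at y)" for y using F(1) by (simp add: C1_def)
  obtain B0 where B0: "0 \<le> B0" "\<And>y. \<bar>\<phi> y\<bar> \<le> B0" by (rule test_fun_bounded[OF phi(2)]) blast
  obtain B1 where B1: "0 \<le> B1" "\<And>y. norm (grad \<phi> y) \<le> B1" by (rule test_fun_grad_bounded[OF phi(2)]) blast
  obtain d0 where d0: "0 < d0" "\<And>x' y. dist x' x < d0 \<Longrightarrow> q * \<phi> y * norm (y - x') ^ n \<le> 1"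
    using weighted_bound_perturb[of \<phi> B0 n x q] F(4,5) B0 n_pos q by (metis abs_le_D1)
  obtain d1 where d1: "0 < d1" "\<And>x' y. dist x' x < d1 \<Longrightarrow> q * norm (grad \<phi> y) * norm (y - x') ^ (n + 1) \<le> 1"
    using weighted_bound_perturb[of "\<lambda>y. norm (grad \<phi> y)" B1 "n + 1" x q] F(6) B1 q by (metis norm_ge_zero add_gr_0 zero_less_one)
  show ?thesis
  proof (rule that[of "min d0 d1"])
    show "0 < min d0 d1" using d0 d1 by simp
    fix x' assume x': "dist x' x < min d0 d1"
    show "(\<lambda>y. q * \<phi> y) \<in> F_class M n x'"
      unfolding F_class_iff
    proof (intro conjI allI)
      show "(\<lambda>y. q * \<phi> y) \<in> C1" using test_fun_C1 test_fun_scale phi(2) q by (metis less_irrefl)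
      show "integrable M (\<lambda>y. q * \<phi> y)" using F by simp
      have "q * (\<integral>y. \<bar>\<phi> y\<bar> \<partial>M) \<le> 1 * 1" using q F(3) by (intro mult_mono) (auto intro: integral_nonneg_AE)
      then show "(\<integral>y. \<bar>q * \<phi> y\<bar> \<partial>M) \<le> 1" using q by (simp add: abs_mult)
      show "0 \<le> q * \<phi> y" for y using q F by simp
      show "q * \<phi> y * norm (y - x') ^ n \<le> 1" for y using d0 x' by simp
      show "norm (grad (\<lambda>y. q * \<phi> y) y) * norm (y - x') ^ (n + 1) \<le> 1" for y
        using d1(2)[of x' y] x' q by (simp add: grad_scale[OF d])
    qed
  qed
qed

lemma maximal_measurable:
  assumes T: "distribution T" shows "maximal M n T \<in> borel_measurable M"
proof (rule borel_measurableI_greater)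
  fix t
  have "open {x. t < maximal M n T x}"
    unfolding open_dist
  proof (intro ballI)
    fix x assume "x \<in> {x. t < maximal M n T x}"
    then obtain \<phi> where phi: "\<phi> \<in> F_class M n x" "\<phi> \<in> test_fun" "t < ennreal \<bar>T \<phi>\<bar>"
      by (auto simp: maximal_def less_SUP_iff)
    obtain t' where t': "t = ennreal t'" "0 \<le> t'" "t' < \<bar>T \<phi>\<bar>"
      using phi(3) by (cases t) (auto simp: ennreal_less_iff)
    \<comment> \<open>Chosen so that q |T \<phi>| is the midpoint of t' and |T \<phi>|, hence still
      above t'.\<close>
    define q where "q = (t' + \<bar>T \<phi>\<bar>) / (2 * \<bar>T \<phi>\<bar>)"
    have q: "0 < q" "q < 1" "t' < q * \<bar>T \<phi>\<bar>" using t' by (auto simp: q_def divide_less_eq)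
    obtain \<delta> where \<delta>: "0 < \<delta>" "\<And>x'. dist x' x < \<delta> \<Longrightarrow> (\<lambda>y. q * \<phi> y) \<in> F_class M n x'"
      using F_class_perturb[OF phi(1,2) q(1,2)] by blast
    have "T (\<lambda>y. q * \<phi> y) = q * T \<phi>" using T phi(2) unfolding distribution_def by blast
    then have lt: "t < ennreal \<bar>T (\<lambda>y. q * \<phi> y)\<bar>" using q t' by (simp add: abs_mult ennreal_less_iff)
    have "t < maximal M n T x'" if "dist x' x < \<delta>" for x'
    proof -
      have "(\<lambda>y. q * \<phi> y) \<in> F_class M n x' \<inter> test_fun" using \<delta>(2)[OF that] test_fun_scale[OF phi(2)] q by simp
      then show ?thesis unfolding maximal_def less_SUP_iff using lt by blast
    qed
    then show "\<exists>e>0. \<forall>y. dist y x < e \<longrightarrow> y \<in> {x. t < maximal M n T x}" using \<delta>(1) by blast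
  qed
  then show "{x \<in> space M. t < maximal M n T x} \<in> sets M" by (simp add: borel_open)
qed

lemma integrable_imp_L1loc:
  assumes "integrable M g" shows "g \<in> L1loc M"
proof -
  have "set_integrable M K g" if "compact K" for K
    unfolding set_integrable_def using that assms
    by (intro integrable_mult_indicator) (auto simp: borel_compact)
  then show ?thesis using assms by (auto simp: L1loc_def)
qed

lemma distribution_dist_of:
  assumes g: "integrable M g" shows "distribution (dist_of M g)"
proof (rule distributionI_bound)
  show "0 \<le> (\<integral>y. \<bar>g y\<bar> \<partial>M)" by (intro integral_nonneg_AE) auto
  fix \<phi> \<psi> :: "real^'d \<Rightarrow> real" assume "\<phi> \<in> test_fun" "\<psi> \<in> test_fun"
  then show "dist_of M g (\<lambda>y. \<phi> y + \<psi> y) = dist_of M g \<phi> + dist_of M g \<psi>"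
    unfolding dist_of_def distrib_left using integrable_mult_test[OF g]
    by (intro Bochner_Integration.integral_add)
next
  fix c and \<psi> :: "real^'d \<Rightarrow> real"
  show "dist_of M g (\<lambda>y. c * \<psi> y) = c * dist_of M g \<psi>"
    unfolding dist_of_def by (simp add: mult.left_commute[of _ c])
next
  fix \<phi> :: "real^'d \<Rightarrow> real" and b0 b1 :: real assume phi: "\<phi> \<in> test_fun" and b: "0 \<le> b0" "0 \<le> b1" "\<And>y. \<bar>\<phi> y\<bar> \<le> b0"
  have "\<bar>dist_of M g \<phi>\<bar> \<le> (\<integral>y. \<bar>g y * \<phi> y\<bar> \<partial>M)" unfolding dist_of_def by (rule integral_abs_bound)
  also have "\<dots> \<le> (\<integral>y. \<bar>g y\<bar> * (b0 + b1) \<partial>M)"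
  proof (rule integral_mono)
    show "\<bar>g y * \<phi> y\<bar> \<le> \<bar>g y\<bar> * (b0 + b1)" for y using b(3)[of y] b(2) by (simp add: abs_mult mult_left_mono)
  qed (use integrable_mult_test[OF g phi] g in auto)
  finally show "\<bar>dist_of M g \<phi>\<bar> \<le> (\<integral>y. \<bar>g y\<bar> \<partial>M) * (b0 + b1)" by simp
qed

end

section \<open>Summation over the blocks\<close>

context mean_family
begin

theorem product_in_L1_plus_H_wp_star:
  assumes "atomic_decomposition M n h R b lam"
  shows "\<exists>T1 T2.
       dist_sums M (\<lambda>j y. (f y - cube_mean (R j)) * b j y) T1 \<and>
       dist_sums M (\<lambda>j y. cube_mean (R j) * b j y) T2 \<and>
       (\<lambda>\<psi>. T1 \<psi> + T2 \<psi>) \<in> L1_plus_H_wp_star M n"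
proof -
  have blk: "atomic_block M n (R j) (b j) (lam j)" for j using assms by (simp add: atomic_decomposition_def)
  have bi: "integrable M (b j)" for j by (rule atomic_blockE[OF blk]) blast
  then have [measurable]: "b j \<in> borel_measurable M" for j by auto
  define s where "s j = enn2real (block_size (lam j))" for j
  have fin: "(\<Sum>j. block_size (lam j)) < \<infinity>" using assms by (simp add: atomic_decomposition_def)
  have bs: "block_size (lam j) = ennreal (s j)" for j
  proof -
    have "block_size (lam j) \<le> (\<Sum>j. block_size (lam j))" by (rule ennreal_le_suminf)
    then have "block_size (lam j) < \<infinity>" using fin by (rule order_le_less_trans)
    then show ?thesis by (simp add: s_def)
  qed
  have s0: "0 \<le> s j" for j by (simp add: s_def)
  have "summable s" using fin s0 unfolding bs by (intro summable_suminf_not_top) auto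
  then have ssum: "(\<lambda>j. s j) sums (\<Sum>j. s j)" by (rule summable_sums)
  have S0: "0 \<le> (\<Sum>j. s j)" using \<open>summable s\<close> s0 by (intro suminf_nonneg)

  obtain C where C: "0 \<le> C" "\<And>R b lam. atomic_block M n R b lam \<Longrightarrow>
    (\<integral>\<^sup>+y. ennreal \<bar>b y\<bar> * ennreal \<bar>f y - cube_mean R\<bar> \<partial>M) \<le> ennreal C * block_size lam"
    using block_oscillation by blast
  define u where "u j y = (f y - cube_mean (R j)) * b j y" for j y
  have um [measurable]: "u j \<in> borel_measurable M" for j unfolding u_def by measurable
  have un: "(\<integral>\<^sup>+y. ennreal \<bar>u j y\<bar> \<partial>M) \<le> ennreal (C * s j)" for j
    using C(2)[OF blk[of j]] C(1) s0 by (simp add: u_def abs_mult ennreal_mult bs mult.commute)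
  have ui: "integrable M (u j)" for j
    using un[of j] by (intro integrableI_bounded) (auto intro: order_le_less_trans)
  have uint: "(\<integral>y. \<bar>u j y\<bar> \<partial>M) \<le> C * s j" for j
  proof -
    have "(\<integral>\<^sup>+y. ennreal \<bar>u j y\<bar> \<partial>M) = ennreal (\<integral>y. \<bar>u j y\<bar> \<partial>M)"
      using ui[of j] by (intro nn_integral_eq_integral) auto
    then have "ennreal (\<integral>y. \<bar>u j y\<bar> \<partial>M) \<le> ennreal (C * s j)" using un[of j] by simp
    then show ?thesis using C(1) s0[of j] by (subst (asm) ennreal_le_iff) auto
  qed
  have usum: "summable (\<lambda>j. \<integral>y. norm (u j y) \<partial>M)"
  proof (rule summable_comparison_test')
    show "summable (\<lambda>j. C * s j)" using \<open>summable s\<close> by (rule summable_mult)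
    have "0 \<le> (\<integral>y. \<bar>u j y\<bar> \<partial>M)" for j by (rule Bochner_Integration.integral_nonneg) simp
    then show "norm (\<integral>y. norm (u j y) \<partial>M) \<le> C * s j" for j using uint[of j] by (simp only: real_norm_def abs_of_nonneg)
  qed
  have uAE: "AE y in M. summable (\<lambda>j. norm (u j y))"
  proof -
    have "(\<integral>\<^sup>+y. (\<Sum>j. ennreal \<bar>u j y\<bar>) \<partial>M) = (\<Sum>j. \<integral>\<^sup>+y. ennreal \<bar>u j y\<bar> \<partial>M)" by (rule nn_integral_suminf) measurable
    also have "\<dots> \<le> (\<Sum>j. ennreal (C * s j))" using un by (intro suminf_le summableI)
    also have "\<dots> = ennreal (\<Sum>j. C * s j)"
      using \<open>summable s\<close> s0 C(1) by (intro suminf_ennreal2 summable_mult) auto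
    finally have "(\<integral>\<^sup>+y. (\<Sum>j. ennreal \<bar>u j y\<bar>) \<partial>M) \<noteq> \<infinity>" by (auto simp: top_unique)
    then have "AE y in M. (\<Sum>j. ennreal \<bar>u j y\<bar>) \<noteq> \<infinity>" by (intro nn_integral_PInf_AE) measurable
    then show ?thesis
    proof eventually_elim
      fix y assume "(\<Sum>j. ennreal \<bar>u j y\<bar>) \<noteq> \<infinity>"
      then show "summable (\<lambda>j. norm (u j y))" by (intro summable_suminf_not_top) auto
    qed
  qed
  define g where "g y = (\<Sum>j. u j y)" for y
  have gi: "integrable M g" unfolding g_def by (rule integrable_suminf[OF ui uAE usum])
  have T1: "dist_sums M u (dist_of M g)"
    unfolding dist_sums_def
  proof (intro conjI allI ballI)
    show "u j \<in> L1loc M" for j using ui by (rule integrable_imp_L1loc)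
    show "distribution (dist_of M g)" by (rule distribution_dist_of[OF gi])
    fix \<psi> :: "real^'d \<Rightarrow> real" assume psi: "\<psi> \<in> test_fun"
    obtain B where B: "0 \<le> B" "\<And>y. \<bar>\<psi> y\<bar> \<le> B" by (rule test_fun_bounded[OF psi]) blast
    have i: "integrable M (\<lambda>y. u j y * \<psi> y)" for j by (rule integrable_mult_test[OF ui psi])
    have sm: "AE y in M. summable (\<lambda>j. norm (u j y * \<psi> y))"
      using uAE by eventually_elim (simp add: abs_mult summable_mult2)
    have si: "summable (\<lambda>j. \<integral>y. norm (u j y * \<psi> y) \<partial>M)"
    proof (rule summable_comparison_test')
      show "summable (\<lambda>j. B * (\<integral>y. norm (u j y) \<partial>M))" using usum by (rule summable_mult)
      fix j
      have "(\<integral>y. norm (u j y * \<psi> y) \<partial>M) \<le> (\<integral>y. B * norm (u j y) \<partial>M)"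
      proof (rule integral_mono)
        show "norm (u j y * \<psi> y) \<le> B * norm (u j y)" for y
          using B(2)[of y] by (simp add: abs_mult mult.commute mult_right_mono mult_left_mono)
      qed (use i[of j] ui[of j] in auto)
      then show "norm (\<integral>y. norm (u j y * \<psi> y) \<partial>M) \<le> B * (\<integral>y. norm (u j y) \<partial>M)"
        by (simp add: integral_nonneg_AE)
    qed
    have "(\<integral>y. (\<Sum>j. u j y * \<psi> y) \<partial>M) = (\<integral>y. g y * \<psi> y \<partial>M)"
    proof (rule integral_cong_AE)
      show "AE y in M. (\<Sum>j. u j y * \<psi> y) = g y * \<psi> y"
        using uAE
      proof eventually_elim
        fix y assume "summable (\<lambda>j. norm (u j y))"
        then have "summable (\<lambda>j. u j y)" by (rule summable_norm_cancel)
        then show "(\<Sum>j. u j y * \<psi> y) = g y * \<psi> y" unfolding g_def by (rule suminf_mult2[symmetric])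
      qed
      show "(\<lambda>y. \<Sum>j. u j y * \<psi> y) \<in> borel_measurable M"
        using integrable_suminf[OF i sm si] by (rule borel_measurable_integrable)
      show "(\<lambda>y. g y * \<psi> y) \<in> borel_measurable M"
        using integrable_mult_test[OF gi psi] by (rule borel_measurable_integrable)
    qed
    then show "(\<lambda>j. dist_of M (u j) \<psi>) sums dist_of M g \<psi>"
      using sums_integral[OF i sm si] by (simp add: dist_of_def)
  qed

  obtain D where D: "0 \<le> D" "\<And>R b lam (\<phi> :: real^'d \<Rightarrow> real) b0 b1. atomic_block M n R b lam \<Longrightarrow> \<phi> \<in> test_fun \<Longrightarrow>
    0 \<le> b0 \<Longrightarrow> 0 \<le> b1 \<Longrightarrow> (\<And>y. \<bar>\<phi> y\<bar> \<le> b0) \<Longrightarrow> (\<And>y. norm (grad \<phi> y) \<le> b1) \<Longrightarrow>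
    ennreal \<bar>cube_mean R * (\<integral>y. b y * \<phi> y \<partial>M)\<bar> \<le> ennreal (D * (b0 + b1)) * block_size lam"
    using block_test_bound by blast
  define w where "w \<psi> j = cube_mean (R j) * (\<integral>y. b j y * \<psi> y \<partial>M)" for \<psi> j
  \<comment> \<open>T2 is given only by its action on test functions: each term of the second series
    is integrable, but the norms need not be summable.\<close>
  define T2 where "T2 \<psi> = (\<Sum>j. w \<psi> j)" for \<psi>
  have dw: "dist_of M (\<lambda>y. cube_mean (R j) * b j y) \<psi> = w \<psi> j" for j \<psi>
    by (simp add: dist_of_def w_def mult.assoc)
  have wb: "\<bar>w \<phi> j\<bar> \<le> D * (b0 + b1) * s j"
    if "\<phi> \<in> test_fun" "0 \<le> b0" "0 \<le> b1" "\<And>y. \<bar>\<phi> y\<bar> \<le> b0" "\<And>y. norm (grad \<phi> y) \<le> b1" for \<phi> b0 b1 j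
  proof -
    have "ennreal \<bar>w \<phi> j\<bar> \<le> ennreal (D * (b0 + b1) * s j)"
      using D(2)[OF blk[of j] that] D(1) s0 that(2,3) unfolding w_def bs by (simp add: ennreal_mult)
    then show ?thesis using D(1) s0 that(2,3) by (simp add: ennreal_le_iff)
  qed
  have wsum: "summable (\<lambda>j. \<bar>w \<phi> j\<bar>)" if phi: "\<phi> \<in> test_fun" for \<phi>
  proof -
    obtain b0 where b0: "0 \<le> b0" "\<And>y. \<bar>\<phi> y\<bar> \<le> b0" by (rule test_fun_bounded[OF phi]) blast
    obtain b1 where b1: "0 \<le> b1" "\<And>y. norm (grad \<phi> y) \<le> b1" by (rule test_fun_grad_bounded[OF phi]) blast
    show ?thesis
    proof (rule summable_comparison_test')
      show "summable (\<lambda>j. D * (b0 + b1) * s j)" using \<open>summable s\<close> by (rule summable_mult)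
      show "norm \<bar>w \<phi> j\<bar> \<le> D * (b0 + b1) * s j" for j using wb[OF phi b0(1) b1(1) b0(2) b1(2)] by simp
    qed
  qed
  have wsum': "summable (w \<phi>)" if "\<phi> \<in> test_fun" for \<phi>
    using wsum[OF that] by (rule summable_rabs_cancel)
  have T2d: "distribution T2"
  proof (rule distributionI_bound)
    show "0 \<le> D * (\<Sum>j. s j)" using D(1) S0 by simp
    fix \<phi> \<psi> :: "real^'d \<Rightarrow> real" assume t: "\<phi> \<in> test_fun" "\<psi> \<in> test_fun"
    have "w (\<lambda>y. \<phi> y + \<psi> y) j = w \<phi> j + w \<psi> j" for j
    proof -
      have "(\<integral>y. b j y * (\<phi> y + \<psi> y) \<partial>M) = (\<integral>y. b j y * \<phi> y \<partial>M) + (\<integral>y. b j y * \<psi> y \<partial>M)"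
        unfolding distrib_left using t by (intro Bochner_Integration.integral_add integrable_mult_test bi)
      then show ?thesis by (simp add: w_def distrib_left)
    qed
    then have "w (\<lambda>y. \<phi> y + \<psi> y) = (\<lambda>j. w \<phi> j + w \<psi> j)" by (rule ext)
    then show "T2 (\<lambda>y. \<phi> y + \<psi> y) = T2 \<phi> + T2 \<psi>"
      unfolding T2_def using suminf_add[OF wsum'[OF t(1)] wsum'[OF t(2)]] by simp
  next
    fix c and \<psi> :: "real^'d \<Rightarrow> real" assume t: "\<psi> \<in> test_fun"
    have "w (\<lambda>y. c * \<psi> y) j = c * w \<psi> j" for j by (simp add: w_def mult.left_commute[of _ c])
    then have "w (\<lambda>y. c * \<psi> y) = (\<lambda>j. c * w \<psi> j)" by (rule ext)
    then show "T2 (\<lambda>y. c * \<psi> y) = c * T2 \<psi>" unfolding T2_def using suminf_mult[OF wsum'[OF t]] by simp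
  next
    fix \<phi> :: "real^'d \<Rightarrow> real" and b0 b1
    assume A: "\<phi> \<in> test_fun" "0 \<le> b0" "0 \<le> b1" "\<And>y. \<bar>\<phi> y\<bar> \<le> b0" "\<And>y. norm (grad \<phi> y) \<le> b1"
    have "\<bar>T2 \<phi>\<bar> \<le> (\<Sum>j. \<bar>w \<phi> j\<bar>)" unfolding T2_def by (rule summable_rabs[OF wsum[OF A(1)]])
    also have "\<dots> \<le> (\<Sum>j. D * (b0 + b1) * s j)"
      using wb[OF A] wsum[OF A(1)] \<open>summable s\<close> by (intro suminf_le summable_mult)
    also have "\<dots> = D * (b0 + b1) * (\<Sum>j. s j)" by (rule suminf_mult[OF \<open>summable s\<close>])
    also have "\<dots> = D * (\<Sum>j. s j) * (b0 + b1)" by (simp only: mult_ac)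
    finally show "\<bar>T2 \<phi>\<bar> \<le> D * (\<Sum>j. s j) * (b0 + b1)" .
  qed
  have T2: "dist_sums M (\<lambda>j y. cube_mean (R j) * b j y) T2"
    unfolding dist_sums_def dw
  proof (intro conjI allI ballI T2d)
    show "(\<lambda>y. cube_mean (R j) * b j y) \<in> L1loc M" for j using bi by (intro integrable_imp_L1loc) simp
    show "w \<psi> sums T2 \<psi>" if "\<psi> \<in> test_fun" for \<psi> unfolding T2_def using wsum'[OF that] by (rule summable_sums)
  qed

  obtain t0 A K where JN: "0 \<le> t0" "0 < A" "0 \<le> K"
    "\<And>k u. emeasure M (msupp M \<inter> level (t0 + real k * A) \<inter> qc u 1) \<le> ennreal (K * (1/2) ^ k)"
    using John_Nirenberg by blast
  define J where "J = level_count t0 A"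
  obtain a where a: "0 < a" "\<forall>R b lam. atomic_block M n R b lam \<longrightarrow> (\<exists>G\<in>borel_measurable M.
    (\<integral>\<^sup>+x. G x \<partial>M) \<le> ennreal a * block_size lam \<and>
    (\<forall>x\<in>msupp M. \<forall>\<phi>\<in>F_class M n x \<inter> test_fun.
       ennreal \<bar>cube_mean R * (\<integral>y. b y * \<phi> y \<partial>M)\<bar> \<le> ennreal a * (1 + J x) * G x))"
    using block_maximal[OF JN(2,1)] unfolding J_def by (elim exE conjE)
  \<comment> \<open>A predicate of j and G, from which all majorants are chosen at once. Their sum
    is integrable because the block sizes are summable.\<close>
  define P where "P j G \<longleftrightarrow> G \<in> borel_measurable M \<and> (\<integral>\<^sup>+x. G x \<partial>M) \<le> ennreal a * block_size (lam j) \<and>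
    (\<forall>x\<in>msupp M. \<forall>\<phi>\<in>F_class M n x \<inter> test_fun. ennreal \<bar>w \<phi> j\<bar> \<le> ennreal a * (1 + J x) * G x)" for j G
  have "\<forall>j. \<exists>G. P j G" using a(2)[rule_format, OF blk] unfolding P_def w_def Bex_def by (intro allI)
  then obtain G where GP: "\<forall>j. P j (G j)" by (rule choice[THEN exE])
  have G: "\<And>j. G j \<in> borel_measurable M" "\<And>j. (\<integral>\<^sup>+x. G j x \<partial>M) \<le> ennreal a * block_size (lam j)"
    "\<And>j x \<phi>. x \<in> msupp M \<Longrightarrow> \<phi> \<in> F_class M n x \<inter> test_fun \<Longrightarrow> ennreal \<bar>w \<phi> j\<bar> \<le> ennreal a * (1 + J x) * G j x"
    using GP unfolding P_def by (simp_all only:)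
  note [measurable] = G(1)
  have "maximal M n T2 \<in> L_wp_star M"
  proof (rule exp_weight_in_L_wp_star[where E = "\<lambda>k. msupp M \<inter> level (t0 + real k * A)" and G = "\<lambda>x. \<Sum>j. G j x" and K = K and a = a])
    show "msupp M \<inter> level (t0 + real (Suc k) * A) \<subseteq> msupp M \<inter> level (t0 + real k * A)" for k
      using JN(2) by (intro Int_mono level_mono) (auto simp: algebra_simps)
    show "(\<lambda>x. \<Sum>j. G j x) \<in> borel_measurable M" by measurable
    have "(\<integral>\<^sup>+x. (\<Sum>j. G j x) \<partial>M) = (\<Sum>j. \<integral>\<^sup>+x. G j x \<partial>M)" by (rule nn_integral_suminf) measurable
    also have "\<dots> \<le> (\<Sum>j. ennreal a * block_size (lam j))" using G(2) by (intro suminf_le summableI)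
    also have "\<dots> = ennreal a * (\<Sum>j. block_size (lam j))" by simp
    also have "\<dots> < \<infinity>" using fin by (simp add: ennreal_mult_less_top)
    finally show "(\<integral>\<^sup>+x. (\<Sum>j. G j x) \<partial>M) < \<infinity>" .
    show "maximal M n T2 \<in> borel_measurable M" by (rule maximal_measurable[OF T2d])
    show "AE x in M. maximal M n T2 x \<le> ennreal a * (1 + (\<Sum>k. indicator (msupp M \<inter> level (t0 + real k * A)) x)) * (\<Sum>j. G j x)"
      using AE_msupp[OF sets_M]
    proof eventually_elim
      fix x assume x: "x \<in> msupp M"
      show "maximal M n T2 x \<le> ennreal a * (1 + (\<Sum>k. indicator (msupp M \<inter> level (t0 + real k * A)) x)) * (\<Sum>j. G j x)"
        unfolding maximal_def level_count_def[symmetric] J_def[symmetric]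
      proof (rule SUP_least)
        fix \<phi> assume phi: "\<phi> \<in> F_class M n x \<inter> test_fun"
        then have "w \<phi> sums T2 \<phi>" unfolding T2_def using wsum' by (intro summable_sums) auto
        then have "ennreal \<bar>T2 \<phi>\<bar> \<le> (\<Sum>j. ennreal \<bar>w \<phi> j\<bar>)" by (rule ennreal_abs_sums_le)
        also have "\<dots> \<le> (\<Sum>j. ennreal a * (1 + J x) * G j x)" using G(3)[OF x phi] by (intro suminf_le summableI)
        also have "\<dots> = ennreal a * (1 + J x) * (\<Sum>j. G j x)" by simp
        finally show "ennreal \<bar>T2 \<phi>\<bar> \<le> ennreal a * (1 + J x) * (\<Sum>j. G j x)" .
      qed
    qed
  qed (use JN a in auto)
  then have "T2 \<in> H_wp_star M n" using T2d by (simp add: H_wp_star_def)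
  then have "(\<lambda>\<psi>. dist_of M g \<psi> + T2 \<psi>) \<in> L1_plus_H_wp_star M n"
    unfolding L1_plus_H_wp_star_def using gi by blast
  then show ?thesis using T1 T2 unfolding u_def by blast
qed

end

section \<open>Application to functions in \<open>rbmo\<close>\<close>

theorem theorem4p2:
  fixes M :: "(real^'d) measure" and n :: nat and C0 \<eta> \<rho> \<beta> :: real
    and f h :: "real^'d \<Rightarrow> real"
  assumes "0 < n" and "n \<le> CARD('d)"
    and "growth_measure M n C0"
    and "1 < \<eta>" and "\<eta> \<le> \<rho>"
    and "doubling_constant M n \<rho> \<beta>"
    and "h \<in> H1 M n"
    and "f \<in> rbmo M n \<eta> \<rho> \<beta>"
  shows "\<forall>R b lam. atomic_decomposition M n h R b lam \<longrightarrow>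
    (\<exists>T1 T2.
       dist_sums M (\<lambda>j y. (f y - avg M f (tilde M \<rho> \<beta> (R j))) * b j y) T1 \<and>
       dist_sums M (\<lambda>j y. avg M f (tilde M \<rho> \<beta> (R j)) * b j y) T2 \<and>
       (\<lambda>\<psi>. T1 \<psi> + T2 \<psi>) \<in> L1_plus_H_wp_star M n)"
proof -
  \<comment> \<open>\<open>growth_space\<close> asks for a positive constant; enlarging
    \<open>C0\<close> preserves the growth bounds and provides one.\<close>
  have "growth_measure M n (max C0 1)"
    unfolding growth_measure_def
  proof (intro conjI allI impI)
    show "sets M = sets borel" using assms(3) by (simp add: growth_measure_def)
    have le: "ennreal (C0 * r ^ n) \<le> ennreal (max C0 1 * r ^ n)" if "0 < r" for r
      using that by (intro ennreal_leI mult_right_mono) auto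
    show "emeasure M (ball x r) \<le> ennreal (max C0 1 * r ^ n)" if "0 < r" for x r
      using assms(3) that le[OF that] unfolding growth_measure_def by (meson order_trans)
    show "emeasure M (cube_set (Cube x l)) \<le> ennreal (max C0 1 * l ^ n)" if "is_cube M (Cube x l)" for x l
    proof -
      have "0 < l" using that by simp
      moreover have "emeasure M (cube_set (Cube x l)) \<le> ennreal (C0 * l ^ n)"
        using assms(3) that unfolding growth_measure_def by blast
      ultimately show ?thesis using le by (meson order_trans)
    qed
  qed
  then interpret growth_space M n "max C0 1" using assms(1) by unfold_locales auto
  obtain C3 where C3: "0 \<le> C3"
    "\<And>Q. is_cube M Q \<Longrightarrow> side Q \<le> 1 \<Longrightarrow>
        (\<integral>\<^sup>+y\<in>cube_set Q. ennreal \<bar>f y - avg M f (tilde M \<rho> \<beta> Q)\<bar> \<partial>M)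
          / emeasure M (cube_set (dilate \<eta> Q)) \<le> ennreal C3"
    "\<And>Q R. is_cube M Q \<Longrightarrow> is_cube M R \<Longrightarrow> cube_set Q \<subseteq> cube_set R \<Longrightarrow>
        doubling M \<rho> \<beta> Q \<Longrightarrow> doubling M \<rho> \<beta> R \<Longrightarrow> side Q \<le> 1 \<Longrightarrow>
        \<bar>avg M f Q - avg M f R\<bar> \<le> C3 * S_coeff M n Q R"
    "\<And>Q. is_cube M Q \<Longrightarrow> side Q > 1 \<Longrightarrow>
        (\<integral>\<^sup>+y\<in>cube_set Q. ennreal \<bar>f y\<bar> \<partial>M) / emeasure M (cube_set (dilate \<eta> Q)) \<le> ennreal C3"
    using assms(8) unfolding rbmo_def by blast
  interpret rbmo_space M n "max C0 1" f \<eta> \<rho> \<beta> C3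
  proof unfold_locales
    show "\<exists>N. doubling M \<rho> \<beta> (dilate (2 ^ N) Q)" if "is_cube M Q" for Q
      using assms(6) that by (simp add: doubling_constant_def)
    show "\<rho> ^ n < \<beta>" using assms(6) by (simp add: doubling_constant_def)
    show "f \<in> L1loc M" using assms(8) by (simp add: rbmo_def)
  qed (use assms C3 in auto)
  obtain C1 where "mean_family M n (max C0 1) f (\<lambda>x l. avg M f (tilde M \<rho> \<beta> (Cube x l)))
      (avg M f (tilde M \<rho> \<beta> Whole)) \<eta> C1"
    using mean_family by blast
  then interpret F: mean_family M n "max C0 1" f "\<lambda>x l. avg M f (tilde M \<rho> \<beta> (Cube x l))"
    "avg M f (tilde M \<rho> \<beta> Whole)" \<eta> C1 .
  have "F.cube_mean R = avg M f (tilde M \<rho> \<beta> R)" for R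
    unfolding F.cube_mean_def by (cases R) auto
  then show ?thesis using F.product_in_L1_plus_H_wp_star by simp
qed

end
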